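(* Let $k$ be an infinite field, $<$ a monomial preorder on $k[X]=k[x_1,\dots,x_n]$, and $I$ an arbitrary homogeneous ideal in $k[X]$. Then $$r(k[X]/I)\le r(k[X]/L_<(I)).$$
   Context: "Homogeneous" is with respect to the standard grading $\deg x_i=1$. For $a\in\mathbb{N}^n$ write $x^a=x_1^{\alpha_1}\cdots x_n^{\alpha_n}$. A weak order on a set is a strict partial order for which incomparability is an equivalence relation. A monomial preorder on $k[X]$ is a weak order $<$ on the monomials such that for all $a,b,c\in\mathbb{N}^n$: $x^a<x^b$ if and only if $x^ax^c<x^bx^c$. For $f=\sum c_ax^a\in k[X]$, the leading part $L_<(f)$ is the sum of those terms $c_ax^a$ ($c_a\ne0$) such that no monomial $x^b$ occurring in $f$ satisfies $x^a<x^b$. For $I\subseteq k[X]$, $L_<(I)$ is the ideal of $k[X]$ generated by all $L_<(f)$, $f\in I$; for homogeneous $I$ it is again homogeneous. Let $R$ be a standard graded algebra over the infinite field $k$ with $d=\dim R$. An ideal $Q$ of $R$ is called a minimal reduction of $R$ if $Q$ is generated by a system of linear forms $z_1,\dots,z_d$ such that $k[z_1,\dots,z_d]\hookrightarrow R$ is a Noether normalization. Let $r_Q(R)$ denote the maximum degree of the (minimal homogeneous) generators of $R$ as a graded $k[z_1,\dots,z_d]$-module. The reduction number of $R$ is $r(R)=\min\{r_Q(R)\mid Q\text{ is a minimal reduction of }R\}$. *)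

theory Defs
  imports
    "HOL-Library.Poly_Mapping"
    "HOL-Library.Extended_Nat"
    "HOL-Algebra.Ideal"
    "HOL-Algebra.QuotRing"
    "HOL-Algebra.Module"
    "HOL-Algebra.Generated_Rings"
    "HOL-Algebra.Algebraic_Closure_Type"
begin

section \<open>Polynomials and monomial preorders\<close>

text \<open>
  A monomial is identified with its exponent vector, so that the product of monomials is the sum of
  exponent vectors. The variables are indexed by a finite type.
\<close>

type_synonym 'n monomial = "'n \<Rightarrow>\<^sub>0 nat"
type_synonym ('n, 'k) mpoly = "'n monomial \<Rightarrow>\<^sub>0 'k"

abbreviation mpoly_ring :: "('n, 'k::comm_ring_1) mpoly ring"
  where "mpoly_ring \<equiv> ring_of_type_algebra"

definition monomial_degree :: "'n monomial \<Rightarrow> nat"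
  where "monomial_degree a = (\<Sum>i\<in>Poly_Mapping.keys a. Poly_Mapping.lookup a i)"

definition homogeneous :: "nat \<Rightarrow> ('n, 'k::zero) mpoly \<Rightarrow> bool"
  where "homogeneous d f \<longleftrightarrow> (\<forall>a\<in>Poly_Mapping.keys f. monomial_degree a = d)"

definition homogeneous_ideal :: "('n, 'k::comm_ring_1) mpoly set \<Rightarrow> bool"
  where "homogeneous_ideal I \<longleftrightarrow>
    ideal I mpoly_ring \<and>
    (\<exists>H. (\<forall>f\<in>H. \<exists>d. homogeneous d f) \<and> I = Idl\<^bsub>mpoly_ring\<^esub> H)"

definition incomparable :: "('a \<Rightarrow> 'a \<Rightarrow> bool) \<Rightarrow> 'a \<Rightarrow> 'a \<Rightarrow> bool"
  where "incomparable lt a b \<longleftrightarrow> \<not> lt a b \<and> \<not> lt b a"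

definition weak_order :: "('a \<Rightarrow> 'a \<Rightarrow> bool) \<Rightarrow> bool"
  where "weak_order lt \<longleftrightarrow> irreflp lt \<and> transp lt \<and> equivp (incomparable lt)"

definition monomial_preorder :: "('n monomial \<Rightarrow> 'n monomial \<Rightarrow> bool) \<Rightarrow> bool"
  where "monomial_preorder lt \<longleftrightarrow>
    weak_order lt \<and> (\<forall>a b c. lt a b \<longleftrightarrow> lt (a + c) (b + c))"

definition leading_part ::
    "('n monomial \<Rightarrow> 'n monomial \<Rightarrow> bool) \<Rightarrow> ('n, 'k::comm_monoid_add) mpoly \<Rightarrow> ('n, 'k) mpoly"
  where "leading_part lt f =
    (\<Sum>a | a \<in> Poly_Mapping.keys f \<and> \<not> (\<exists>b\<in>Poly_Mapping.keys f. lt a b).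
      Poly_Mapping.single a (Poly_Mapping.lookup f a))"

definition leading_ideal ::
    "('n monomial \<Rightarrow> 'n monomial \<Rightarrow> bool) \<Rightarrow> ('n, 'k::comm_ring_1) mpoly set \<Rightarrow> ('n, 'k) mpoly set"
  where "leading_ideal lt I = Idl\<^bsub>mpoly_ring\<^esub> (leading_part lt ` I)"


section \<open>Graded algebras and the reduction number\<close>

text \<open>
  The carrier data of a graded algebra: \<^term>\<open>component A d\<close> is the set of homogeneous elements of
  degree \<open>d\<close>, zero included.
\<close>

record ('k, 'r) graded_algebra = "('k, 'r) module" +
  component :: "nat \<Rightarrow> 'r set"

text \<open>
  The length of a chain of primes is its number of strict inclusions. The zero ring has no primes;
  its dimension is the supremum of the empty set, which is 0 here.
\<close>

definition krull_dim :: "('r, 'm) ring_scheme \<Rightarrow> enat"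
  where "krull_dim A = Sup {enat m | m P.
    (\<forall>i\<le>m. primeideal (P i) A) \<and> (\<forall>i<m. P i \<subset> P (Suc i))}"

definition eval_at ::
    "('k, 'r) graded_algebra \<Rightarrow> 'r list \<Rightarrow> (nat, 'k::zero) mpoly \<Rightarrow> 'r"
  where "eval_at A zs p =
    (\<Oplus>\<^bsub>A\<^esub>a\<in>Poly_Mapping.keys p.
      Poly_Mapping.lookup p a \<odot>\<^bsub>A\<^esub>
        (\<Otimes>\<^bsub>A\<^esub>i\<in>Poly_Mapping.keys a. (zs ! i) [^]\<^bsub>A\<^esub> Poly_Mapping.lookup a i))"

definition alg_independent :: "('k::zero, 'r) graded_algebra \<Rightarrow> 'r list \<Rightarrow> bool"
  where "alg_independent A zs \<longleftrightarrow>
    (\<forall>p. (\<forall>a\<in>Poly_Mapping.keys p. Poly_Mapping.keys a \<subseteq> {..<length zs}) \<and>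
      eval_at A zs p = \<zero>\<^bsub>A\<^esub> \<longrightarrow> p = 0)"

text \<open>The subalgebra \<open>k[z\<^sub>1, \<dots>, z\<^sub>d]\<close>; the first set below is the image of \<open>k\<close> in the algebra.\<close>

definition generated_subalgebra :: "('k, 'r) graded_algebra \<Rightarrow> 'r list \<Rightarrow> 'r set"
  where "generated_subalgebra A zs =
    generate_ring A (range (\<lambda>c. c \<odot>\<^bsub>A\<^esub> \<one>\<^bsub>A\<^esub>) \<union> set zs)"

definition module_span :: "('r, 'm) ring_scheme \<Rightarrow> 'r set \<Rightarrow> 'r set \<Rightarrow> 'r set"
  where "module_span A B S =
    {\<Oplus>\<^bsub>A\<^esub>s\<in>F. c s \<otimes>\<^bsub>A\<^esub> s | F c. finite F \<and> F \<subseteq> S \<and> c \<in> F \<rightarrow> B}"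

definition noether_normalization :: "('k::zero, 'r) graded_algebra \<Rightarrow> 'r list \<Rightarrow> bool"
  where "noether_normalization A zs \<longleftrightarrow>
    set zs \<subseteq> carrier A \<and> alg_independent A zs \<and>
    (\<exists>S. finite S \<and> S \<subseteq> carrier A \<and> module_span A (generated_subalgebra A zs) S = carrier A)"

definition linear_noether_system :: "('k::zero, 'r) graded_algebra \<Rightarrow> 'r list \<Rightarrow> bool"
  where "linear_noether_system A zs \<longleftrightarrow>
    enat (length zs) = krull_dim A \<and> set zs \<subseteq> component A 1 \<and> noether_normalization A zs"

definition minimal_reduction :: "('k::zero, 'r) graded_algebra \<Rightarrow> 'r set \<Rightarrow> bool"
  where "minimal_reduction A Q \<longleftrightarrow> (\<exists>zs. linear_noether_system A zs \<and> Q = Idl\<^bsub>A\<^esub> (set zs))"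

definition minimal_homogeneous_generators ::
    "('k, 'r) graded_algebra \<Rightarrow> 'r set \<Rightarrow> 'r set \<Rightarrow> bool"
  where "minimal_homogeneous_generators A B S \<longleftrightarrow>
    S \<subseteq> (\<Union>d. component A d) \<and> module_span A B S = carrier A \<and>
    (\<forall>T. T \<subset> S \<longrightarrow> module_span A B T \<noteq> carrier A)"

text \<open>
  The degrees of a minimal homogeneous generating system depend neither on the system nor on the
  linear forms chosen to generate \<open>Q\<close>, and there are only finitely many of them, so the supremum
  over all choices is the maximal degree for any single choice.
\<close>

definition reduction_number_wrt :: "('k::zero, 'r) graded_algebra \<Rightarrow> 'r set \<Rightarrow> enat"
  where "reduction_number_wrt A Q = Sup {enat e | e zs S s.
    linear_noether_system A zs \<and> Q = Idl\<^bsub>A\<^esub> (set zs) \<and>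
    minimal_homogeneous_generators A (generated_subalgebra A zs) S \<and> s \<in> S \<and> s \<in> component A e}"

text \<open>
  The infimum is a minimum because \<^typ>\<open>enat\<close> is well-ordered. Only if there is no minimal
  reduction (as for the zero ring) is it \<open>\<infinity>\<close>.
\<close>

definition reduction_number :: "('k::zero, 'r) graded_algebra \<Rightarrow> enat"
  where "reduction_number A = Inf {reduction_number_wrt A Q | Q. minimal_reduction A Q}"


section \<open>The quotient of a polynomial ring by a homogeneous ideal\<close>

definition quotient_algebra ::
    "('n, 'k::comm_ring_1) mpoly set \<Rightarrow> ('k, ('n, 'k) mpoly set) graded_algebra"
  where "quotient_algebra I =
    (let R = mpoly_ring Quot I in
      \<lparr>carrier = carrier R, monoid.mult = monoid.mult R, one = monoid.one R,
       zero = ring.zero R, add = ring.add R,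
       module.smult = (\<lambda>c C. (I +>\<^bsub>mpoly_ring\<^esub> Poly_Mapping.single 0 c) \<otimes>\<^bsub>R\<^esub> C),
       component = (\<lambda>d. {I +>\<^bsub>mpoly_ring\<^esub> f | f. homogeneous d f})\<rparr>)"

end

theory Submission
  imports Defs "Jordan_Normal_Form.Determinant"
begin

text \<open>
  By graded Nakayama, linear forms \<open>y\<^sub>1, \<dots>, y\<^sub>d\<close> of a Noether normalization of \<open>k[X]/J\<close> give
  reduction number at most \<open>r\<close> iff every monomial of degree \<open>r + 1\<close> lies in \<open>J + (y\<^sub>1, \<dots>, y\<^sub>d)\<close>. If this holds for
  \<open>J = L\<^sub><(I)\<close>, then the degree \<open>r + 1\<close> component has a basis of leading parts \<open>L\<^sub><(f)\<close>, \<open>f \<in> I\<close>, and products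
  \<open>x\<^sup>b y\<^sub>i\<close>. Replacing each \<open>L\<^sub><(f)\<close> by \<open>f(s\<^sub>1 x\<^sub>1, \<dots>, s\<^sub>n x\<^sub>n)\<close> with indeterminates \<open>s\<^sub>i\<close> turns the coefficient
  determinant into a polynomial in \<open>s\<close> whose leading part with respect to \<open><\<close> is, at \<open>s = 1\<close>, the
  original nonzero determinant. Hence it does not vanish at some point \<open>s\<close> of the torus, and scaling back
  gives linear forms \<open>z\<^sub>i\<close> that work for \<open>I\<close>.

  It remains to see that the \<open>z\<^sub>i\<close> form a Noether normalization of \<open>k[X]/I\<close> of length \<open>dim k[X]/I\<close>. Finiteness is
  clear. A set of monomials that is a basis modulo \<open>L\<^sub><(I)\<close> stays independent modulo \<open>I\<close>, so the
  Hilbert function of \<open>k[X]/I\<close> grows too fast for the \<open>z\<^sub>i\<close> to be algebraically dependent. The same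
  count bounds the length of prime chains by \<open>d\<close>, and a chain of length \<open>d\<close> is built from primes containing
  \<open>z\<^sub>1, \<dots>, z\<^sub>i\<close> and avoiding \<open>k[z\<^sub>i\<^sub>+\<^sub>1, \<dots>, z\<^sub>d] - {0}\<close>.
\<close>

section \<open>Restriction of polynomials to sets of monomials\<close>

text \<open>The relation \<open>lt\<close> is only a weak order compatible with multiplication: it
  may have infinite descending chains and need not separate monomials, so there is no division with
  remainder to rely on. What survives is that the part of a product lying in the top class is the
  product of the top parts. This is why the deformation is carried out on a single determinant,
  whose expansion involves nothing but products, with one torus parameter for each variable.

  The dimension of \<open>k[X]/I\<close> is not assumed to agree with that of the degenerate
  quotient. It is computed afresh for the new linear forms by comparing binomial coefficients: a
  module with \<open>N\<close> generators over a polynomial ring in \<open>d\<close> variables grows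
  at most like N times (t + d choose d), and the monomials independent modulo the leading ideal
  force growth at least (t + d choose d).

  Homogeneity of \<open>I\<close> makes every comparison finite dimensional, one degree at a time.
  That \<open>k\<close> is infinite enters only through the choice of the torus point.\<close>

abbreviation const :: "'k::zero \<Rightarrow> ('n, 'k) mpoly"
  where "const \<equiv> Poly_Mapping.single 0"

abbreviation monomial_poly :: "'n monomial \<Rightarrow> ('n, 'k::zero_neq_one) mpoly"
  where "monomial_poly a \<equiv> Poly_Mapping.single a 1"

lemma const_comm_ring_hom: "comm_ring_hom (const :: 'k::comm_ring_1 \<Rightarrow> ('n, 'k) mpoly)"
  by unfold_locales (auto simp: single_add mult_single)

lemma const_add: "const (a + b) = (const a + const b :: ('n, 'k::comm_ring_1) mpoly)"
  by (simp add: single_add)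

lemma const_mult: "const (a * b) = (const a * const b :: ('n, 'k::comm_ring_1) mpoly)"
  by (simp add: mult_single)

lemma const_sum: "const (sum f A) = (\<Sum>a\<in>A. const (f a) :: ('n, 'k::comm_ring_1) mpoly)"
  by (induction A rule: infinite_finite_induct) (auto simp: single_add)

lemma lookup_const_mult: "Poly_Mapping.lookup (const c * f) a = (c :: 'k::comm_ring_1) * Poly_Mapping.lookup f a"
  by (auto simp: Poly_Mapping.map.rep_eq when_def simp flip: mult_map_scale_conv_mult)

lemma poly_mapping_sum_single:
  "f = (\<Sum>a\<in>Poly_Mapping.keys f. Poly_Mapping.single a (Poly_Mapping.lookup f a))"
proof (rule poly_mapping_eqI)
  fix k
  show "Poly_Mapping.lookup f k = Poly_Mapping.lookup (\<Sum>a\<in>Poly_Mapping.keys f. Poly_Mapping.single a (Poly_Mapping.lookup f a)) k"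
    by (simp add: lookup_sum lookup_single when_def in_keys_iff)
qed

lemma poly_mapping_single_induct [case_names zero single add]:
  fixes f :: "'a \<Rightarrow>\<^sub>0 'b::comm_monoid_add"
  assumes "P 0"
    and "\<And>a c. P (Poly_Mapping.single a c)"
    and "\<And>f g. P f \<Longrightarrow> P g \<Longrightarrow> P (f + g)"
  shows "P f"
proof -
  have "P (\<Sum>a\<in>A. Poly_Mapping.single a (Poly_Mapping.lookup f a))" if "finite A" for A
    using that by induction (auto intro: assms)
  then show ?thesis
    using poly_mapping_sum_single[of f] by (metis finite_keys)
qed

text \<open>Homogeneous components, leading parts and setting variables to zero are all of this
  form, so that \<open>part_mult\<close> serves all three.\<close>

definition part :: "('a \<Rightarrow> bool) \<Rightarrow> ('a \<Rightarrow>\<^sub>0 'b::zero) \<Rightarrow> ('a \<Rightarrow>\<^sub>0 'b)"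
  where "part P f = Poly_Mapping.mapp (\<lambda>a c. if P a then c else 0) f"

lemma lookup_part: "Poly_Mapping.lookup (part P f) a = (if P a then Poly_Mapping.lookup f a else 0)"
  unfolding part_def by (auto simp: lookup_mapp when_def in_keys_iff)

lemma keys_part: "Poly_Mapping.keys (part P f) = {a \<in> Poly_Mapping.keys f. P a}"
  by (auto simp: in_keys_iff lookup_part split: if_splits)

lemma part_add: "part P (f + g) = part P f + part P (g :: 'a \<Rightarrow>\<^sub>0 'b::monoid_add)"
  by (rule poly_mapping_eqI) (simp add: lookup_part lookup_add)

lemma part_diff: "part P (f - g) = part P f - part P (g :: 'a \<Rightarrow>\<^sub>0 'b::ab_group_add)"
  by (rule poly_mapping_eqI) (simp add: lookup_part lookup_minus)

lemma part_zero [simp]: "part P 0 = 0"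
  by (rule poly_mapping_eqI) (simp add: lookup_part)

lemma part_sum: "part P (sum f A) = (\<Sum>x\<in>A. part P (f x :: 'a \<Rightarrow>\<^sub>0 'b::comm_monoid_add))"
  by (induction A rule: infinite_finite_induct) (auto simp: part_add)

lemma part_idI: "(\<And>a. a \<in> Poly_Mapping.keys f \<Longrightarrow> P a) \<Longrightarrow> part P f = f"
  by (rule poly_mapping_eqI) (auto simp: lookup_part in_keys_iff)

lemma part_zeroI: "(\<And>a. a \<in> Poly_Mapping.keys f \<Longrightarrow> \<not> P a) \<Longrightarrow> part P f = 0"
  by (rule poly_mapping_eqI) (auto simp: lookup_part in_keys_iff)

lemma part_compl: "part P f + part (\<lambda>a. \<not> P a) f = (f :: 'a \<Rightarrow>\<^sub>0 'b::monoid_add)"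
  by (rule poly_mapping_eqI) (auto simp: lookup_part lookup_add)

lemma part_single: "part P (Poly_Mapping.single a c) = (if P a then Poly_Mapping.single a c else 0)"
  by (rule poly_mapping_eqI) (auto simp: lookup_part lookup_single when_def)

text \<open>By the hypotheses a product term satisfies \<open>R\<close> exactly when both of its
  factors are selected, so in the expansion only the product of the two selected parts
  survives.\<close>

lemma part_mult:
  fixes f g :: "'a::monoid_add \<Rightarrow>\<^sub>0 'b::semiring_0"
  assumes "\<And>a b. \<lbrakk>a \<in> Poly_Mapping.keys f; b \<in> Poly_Mapping.keys g; P a; Q b\<rbrakk> \<Longrightarrow> R (a + b)"
    and "\<And>a b. \<lbrakk>a \<in> Poly_Mapping.keys f; b \<in> Poly_Mapping.keys g; R (a + b)\<rbrakk> \<Longrightarrow> P a \<and> Q b"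
  shows "part R (f * g) = part P f * part Q g"
proof -
  let ?f = "part P f" and ?f' = "part (\<lambda>a. \<not> P a) f"
  let ?g = "part Q g" and ?g' = "part (\<lambda>a. \<not> Q a) g"
  have fg: "f * g = ?f * ?g + ?f * ?g' + ?f' * g"
    by (metis part_compl distrib_left distrib_right)
  have 1: "part R (?f * ?g) = ?f * ?g"
    using keys_mult[of ?f ?g] by (intro part_idI) (auto simp: keys_part intro: assms(1))
  have 2: "part R (?f * ?g') = 0"
    using keys_mult[of ?f ?g'] by (intro part_zeroI) (use assms(2) in \<open>fastforce simp: keys_part\<close>)
  have 3: "part R (?f' * g) = 0"
    using keys_mult[of ?f' g] by (intro part_zeroI) (use assms(2) in \<open>fastforce simp: keys_part\<close>)
  show ?thesis
    by (subst fg) (simp add: part_add 1 2 3)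
qed

lemma leading_part_eq_part:
  "leading_part lt f = part (\<lambda>a. \<not> (\<exists>b\<in>Poly_Mapping.keys f. lt a b)) (f :: ('n, 'k::comm_monoid_add) mpoly)"
  by (rule poly_mapping_eqI)
     (auto simp: leading_part_def lookup_part lookup_sum lookup_single when_def in_keys_iff)


section \<open>Degrees and homogeneous components\<close>

lemma monomial_degree_superset:
  assumes "finite A" "Poly_Mapping.keys a \<subseteq> A"
  shows "monomial_degree a = (\<Sum>i\<in>A. Poly_Mapping.lookup a i)"
  unfolding monomial_degree_def
  by (rule sum.mono_neutral_left) (use assms in \<open>auto simp: in_keys_iff\<close>)

lemma monomial_degree_add [simp]: "monomial_degree (a + b) = monomial_degree a + monomial_degree b"
proof -
  let ?A = "Poly_Mapping.keys a \<union> Poly_Mapping.keys b"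
  have "Poly_Mapping.keys (a + b) \<subseteq> ?A"
    by (rule keys_add)
  then show ?thesis
    by (simp add: monomial_degree_superset[where A = ?A] lookup_add sum.distrib)
qed

lemma monomial_degree_zero [simp]: "monomial_degree 0 = 0"
  by (simp add: monomial_degree_def)

lemma monomial_degree_single [simp]: "monomial_degree (Poly_Mapping.single i n) = n"
  by (simp add: monomial_degree_def)

lemma keys_plus_nat: "Poly_Mapping.keys (a + b :: 'n monomial) = Poly_Mapping.keys a \<union> Poly_Mapping.keys b"
  by (auto simp: in_keys_iff lookup_add)

lemma monomial_minus_single:
  assumes "i \<in> Poly_Mapping.keys (a :: 'n monomial)"
  obtains b where "a = Poly_Mapping.single i 1 + b"
proof
  show "a = Poly_Mapping.single i 1 + (a - Poly_Mapping.single i 1)"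
    using assms by (intro poly_mapping_eqI) (auto simp: lookup_add lookup_minus lookup_single when_def in_keys_iff)
qed

lemma monomial_degree_eq_0_iff: "monomial_degree a = 0 \<longleftrightarrow> a = 0"
proof
  assume "monomial_degree a = 0"
  then have "Poly_Mapping.lookup a i = 0" for i
    by (cases "i \<in> Poly_Mapping.keys a") (auto simp: monomial_degree_def in_keys_iff)
  then show "a = 0"
    by (intro poly_mapping_eqI) simp
qed simp

lemma monomial_split_degree:
  assumes "n \<le> monomial_degree a"
  obtains b c where "a = b + c" "monomial_degree b = n"
  using assms
proof (induction n arbitrary: thesis)
  case 0
  then show ?case
    using monomial_degree_zero by (metis add_0)
next
  case (Suc n)
  then obtain b c where bc: "a = b + c" "monomial_degree b = n"
    by (metis Suc_leD)
  then have "c \<noteq> 0"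
    using Suc.prems(2) by auto
  then obtain i where "i \<in> Poly_Mapping.keys c"
    by (metis in_keys_iff lookup_zero poly_mapping_eqI)
  then obtain c' where c': "c = Poly_Mapping.single i 1 + c'"
    by (rule monomial_minus_single)
  show ?case
    by (rule Suc.prems(1)[of "b + Poly_Mapping.single i 1" c'])
       (use bc c' in \<open>simp_all add: add.assoc\<close>)
qed

definition deg_le :: "nat \<Rightarrow> ('n, 'k::zero) mpoly \<Rightarrow> bool"
  where "deg_le t f \<longleftrightarrow> (\<forall>a\<in>Poly_Mapping.keys f. monomial_degree a \<le> t)"

abbreviation hcomp :: "nat \<Rightarrow> ('n, 'k::zero) mpoly \<Rightarrow> ('n, 'k) mpoly"
  where "hcomp t \<equiv> part (\<lambda>a. monomial_degree a = t)"

lemma homogeneous_hcomp [simp]: "homogeneous t (hcomp t f)"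
  by (auto simp: homogeneous_def keys_part)

lemma hcomp_homogeneous: "homogeneous t f \<Longrightarrow> hcomp s f = (if s = t then f else 0)"
  by (auto simp: homogeneous_def intro: part_idI part_zeroI)

lemma homogeneous_zero [simp]: "homogeneous t 0"
  by (simp add: homogeneous_def)

lemma homogeneous_mult:
  "homogeneous s f \<Longrightarrow> homogeneous t g \<Longrightarrow> homogeneous (s + t) (f * (g :: ('n, 'k::comm_ring_1) mpoly))"
  unfolding homogeneous_def using keys_mult[of f g] by fastforce

lemma homogeneous_single: "monomial_degree a = t \<Longrightarrow> homogeneous t (Poly_Mapping.single a c)"
  by (simp add: homogeneous_def)

lemma homogeneous_const [simp]: "homogeneous 0 (const c)"
  by (simp add: homogeneous_def)

lemma homogeneous_one [simp]: "homogeneous 0 (1 :: ('n, 'k::comm_ring_1) mpoly)"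
  by (simp add: homogeneous_def)

lemma homogeneous_prod_power:
  assumes "\<And>i. i \<in> A \<Longrightarrow> homogeneous 1 (w i :: ('n, 'k::comm_ring_1) mpoly)"
  shows "homogeneous (\<Sum>i\<in>A. n i) (\<Prod>i\<in>A. w i ^ n i)"
proof -
  have pow: "homogeneous m (f ^ m)" if "homogeneous 1 f" for f :: "('n, 'k) mpoly" and m
    using that homogeneous_mult[of 1 f] by (induction m) auto
  show ?thesis
    using assms by (induction A rule: infinite_finite_induct) (simp_all add: homogeneous_mult pow)
qed

lemma hcomp_mult_homogeneous:
  fixes g h :: "('n, 'k::comm_ring_1) mpoly"
  assumes "homogeneous e h"
  shows "hcomp t (g * h) = (if e \<le> t then hcomp (t - e) g * h else 0)"
proof -
  have "part (\<lambda>a. monomial_degree a = t) (g * h) =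
      part (\<lambda>a. monomial_degree a + e = t) g * part (\<lambda>a. monomial_degree a = e) h"
    using assms by (intro part_mult) (auto simp: homogeneous_def)
  also have "part (\<lambda>a. monomial_degree a = e) h = h"
    using assms by (intro part_idI) (auto simp: homogeneous_def)
  also have "part (\<lambda>a. monomial_degree a + e = t) g * h = (if e \<le> t then hcomp (t - e) g * h else 0)"
    by (cases "e \<le> t") (auto intro!: arg_cong[where f = "\<lambda>P. part P g * h"] simp: part_zeroI)
  finally show ?thesis .
qed

lemma hcomp_const_mult: "hcomp t (const c * g) = const c * hcomp t (g :: ('n, 'k::comm_ring_1) mpoly)"
  using hcomp_mult_homogeneous[of 0 "const c" t g] by (simp add: mult.commute)

lemma deg_le_mult: "deg_le s f \<Longrightarrow> deg_le t g \<Longrightarrow> deg_le (s + t) (f * (g :: ('n, 'k::comm_ring_1) mpoly))"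
  unfolding deg_le_def using keys_mult[of f g] by (fastforce intro: add_mono)

lemma homogeneous_imp_deg_le: "homogeneous t f \<Longrightarrow> t \<le> s \<Longrightarrow> deg_le s f"
  by (simp add: deg_le_def homogeneous_def)

lemma deg_le_mono: "deg_le t f \<Longrightarrow> t \<le> s \<Longrightarrow> deg_le s f"
  by (fastforce simp: deg_le_def)

lemma deg_le_exists: "\<exists>t. deg_le t f"
  unfolding deg_le_def using finite_keys[of f]
  by (intro exI[of _ "Max (monomial_degree ` Poly_Mapping.keys f)"]) auto

lemma sum_hcomp: "deg_le t f \<Longrightarrow> f = (\<Sum>s\<le>t. hcomp s (f :: ('n, 'k::comm_ring_1) mpoly))"
  by (rule poly_mapping_eqI) (auto simp: lookup_sum lookup_part deg_le_def in_keys_iff)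

lemma finite_monomials_le: 
  assumes "finite T"
  shows "finite {a :: 'n monomial. Poly_Mapping.keys a \<subseteq> T \<and> monomial_degree a \<le> t}"
proof (rule finite_imageD)
  have "Poly_Mapping.lookup a i \<le> t" if "monomial_degree a \<le> t" for a :: "'n monomial" and i
    using that member_le_sum[of i "Poly_Mapping.keys a" "Poly_Mapping.lookup a"]
    unfolding monomial_degree_def by (cases "i \<in> Poly_Mapping.keys a") (auto simp: in_keys_iff)
  then have "Poly_Mapping.lookup ` {a :: 'n monomial. Poly_Mapping.keys a \<subseteq> T \<and> monomial_degree a \<le> t}
      \<subseteq> {f. \<forall>i. (i \<in> T \<longrightarrow> f i \<in> {..t}) \<and> (i \<notin> T \<longrightarrow> f i = 0)}"
    by (auto simp: in_keys_iff)
  then show "finite (Poly_Mapping.lookup ` {a :: 'n monomial. Poly_Mapping.keys a \<subseteq> T \<and> monomial_degree a \<le> t})"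
    by (rule finite_subset) (rule finite_set_of_finite_funs[OF assms], simp)
  show "inj_on Poly_Mapping.lookup {a :: 'n monomial. Poly_Mapping.keys a \<subseteq> T \<and> monomial_degree a \<le> t}"
    by (rule inj_onI) (simp add: poly_mapping.lookup_inject)
qed

lemma finite_monomials_degree_le: "finite {a :: 'n::finite monomial. monomial_degree a \<le> t}"
  using finite_monomials_le[of "UNIV :: 'n set" t] by simp

section \<open>Evaluation of polynomials\<close>

definition meval :: "('i \<Rightarrow> 'r::comm_semiring_1) \<Rightarrow> 'i monomial \<Rightarrow> 'r"
  where "meval w a = (\<Prod>i\<in>Poly_Mapping.keys a. w i ^ Poly_Mapping.lookup a i)"

text \<open>The coefficient map is a parameter: \<open>const\<close> gives substitution of
  polynomials, the identity gives values in the field.\<close>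

definition peval :: "('k::zero \<Rightarrow> 'r) \<Rightarrow> ('i \<Rightarrow> 'r::comm_semiring_1) \<Rightarrow> ('i, 'k) mpoly \<Rightarrow> 'r"
  where "peval \<phi> w p = (\<Sum>a\<in>Poly_Mapping.keys p. \<phi> (Poly_Mapping.lookup p a) * meval w a)"

abbreviation subst :: "('i \<Rightarrow> ('n, 'k::comm_ring_1) mpoly) \<Rightarrow> ('i, 'k) mpoly \<Rightarrow> ('n, 'k) mpoly"
  where "subst \<equiv> peval const"

lemma meval_superset:
  assumes "finite A" "Poly_Mapping.keys a \<subseteq> A"
  shows "meval w a = (\<Prod>i\<in>A. w i ^ Poly_Mapping.lookup a i)"
  unfolding meval_def
  by (rule prod.mono_neutral_left) (use assms in \<open>auto simp: in_keys_iff\<close>)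

lemma meval_zero [simp]: "meval w 0 = 1"
  by (simp add: meval_def)

lemma meval_add: "meval w (a + b) = meval w a * meval w b"
proof -
  let ?A = "Poly_Mapping.keys a \<union> Poly_Mapping.keys b"
  show ?thesis
    using keys_add[of a b]
    by (simp add: meval_superset[where A = ?A] lookup_add power_add prod.distrib)
qed

lemma meval_single [simp]: "meval w (Poly_Mapping.single i n) = w i ^ n"
  by (simp add: meval_def)

lemma meval_mult: "meval (\<lambda>i. v i * w i) a = meval v a * meval w a"
  by (simp add: meval_def power_mult_distrib prod.distrib)

lemma meval_mono_variable: 
  "meval (\<lambda>i. monomial_poly (Poly_Mapping.single i 1) :: ('n, 'k::comm_ring_1) mpoly) a = monomial_poly a"
proof -
  have pow: "monomial_poly (Poly_Mapping.single i (Suc 0)) ^ n = (monomial_poly (Poly_Mapping.single i n) :: ('n, 'k) mpoly)" for i n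
    by (induction n) (auto simp: mult_single simp flip: single_add)
  have "(\<Prod>i\<in>A. monomial_poly (Poly_Mapping.single i (n i)) :: ('n, 'k) mpoly) = monomial_poly (\<Sum>i\<in>A. Poly_Mapping.single i (n i))"
    for A and n :: "'n \<Rightarrow> nat"
    by (induction A rule: infinite_finite_induct) (auto simp: mult_single)
  from this[where n = "Poly_Mapping.lookup a" and A = "Poly_Mapping.keys a"] show ?thesis
    by (simp add: meval_def pow flip: poly_mapping_sum_single)
qed

context comm_ring_hom
begin

lemma peval_superset:
  assumes "finite A" "Poly_Mapping.keys p \<subseteq> A"
  shows "peval hom w p = (\<Sum>a\<in>A. hom (Poly_Mapping.lookup p a) * meval w a)"
  unfolding peval_def
  by (rule sum.mono_neutral_left) (use assms in \<open>auto simp: in_keys_iff\<close>)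

lemma peval_zero [simp]: "peval hom w 0 = 0"
  by (simp add: peval_def)

lemma peval_single: "peval hom w (Poly_Mapping.single a c) = hom c * meval w a"
  by (simp add: peval_superset[where A = "{a}"])

lemma peval_const [simp]: "peval hom w (const c) = hom c"
  by (simp add: peval_single)

lemma peval_add: "peval hom w (p + q) = peval hom w p + peval hom w q"
  using keys_add[of p q]
  by (simp add: peval_superset[where A = "Poly_Mapping.keys p \<union> Poly_Mapping.keys q"]
      lookup_add hom_add distrib_right sum.distrib)

lemma peval_mult: "peval hom w (p * q) = peval hom w p * peval hom w q"
proof (induction p rule: poly_mapping_single_induct)
  case (single a c)
  show ?case
    by (induction q rule: poly_mapping_single_induct)
      (simp_all add: peval_add peval_single mult_single hom_mult meval_add algebra_simps)
qed (simp_all add: peval_add distrib_right)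

lemma comm_ring_hom_peval: "comm_ring_hom (peval hom w)"
  by unfold_locales (auto simp: peval_add peval_mult simp del: single_one simp flip: single_one)

lemma hom_meval: "hom (meval w a) = meval (\<lambda>i. hom (w i)) a"
  by (simp add: meval_def hom_prod hom_power)

end

lemma homogeneous_meval:
  assumes "\<And>i. homogeneous 1 (w i :: ('n, 'k::comm_ring_1) mpoly)"
  shows "homogeneous (monomial_degree a) (meval w a)"
  unfolding meval_def monomial_degree_def by (rule homogeneous_prod_power) (rule assms)

text \<open>Linear forms substituted into a monomial give a form of the same degree, so substitution
  respects the gradings.\<close>

lemma hcomp_subst:
  assumes "\<And>i. homogeneous 1 (w i :: ('n, 'k::comm_ring_1) mpoly)"
  shows "hcomp t (subst w p) = subst w (hcomp t p)"
proof -
  interpret c: comm_ring_hom "const :: 'k \<Rightarrow> ('n, 'k) mpoly" by (rule const_comm_ring_hom)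
  show ?thesis
    by (induction p rule: poly_mapping_single_induct)
      (auto simp: c.peval_add part_add c.peval_single part_single hcomp_const_mult
        hcomp_homogeneous[OF homogeneous_meval[OF assms]])
qed

section \<open>Polynomials in a subset of the variables\<close>

definition vars_in :: "'i set \<Rightarrow> ('i, 'k::zero) mpoly \<Rightarrow> bool"
  where "vars_in T p \<longleftrightarrow> (\<forall>a\<in>Poly_Mapping.keys p. Poly_Mapping.keys a \<subseteq> T)"

abbreviation restrict_vars :: "'i set \<Rightarrow> ('i, 'k::zero) mpoly \<Rightarrow> ('i, 'k) mpoly"
  where "restrict_vars T \<equiv> part (\<lambda>a. Poly_Mapping.keys a \<subseteq> T)"

lemma vars_in_restrict_vars [simp]: "vars_in T (restrict_vars T p)"
  by (auto simp: vars_in_def keys_part)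

lemma restrict_vars_id: "vars_in T p \<Longrightarrow> restrict_vars T p = p"
  by (rule part_idI) (auto simp: vars_in_def)

text \<open>This is the map that sets the variables outside \<open>T\<close> to zero. Exponents
  cannot cancel, so a product of monomials avoids these variables iff both factors do.\<close>

lemma restrict_vars_comm_ring_hom:
  "comm_ring_hom (restrict_vars T :: ('i, 'k::comm_ring_1) mpoly \<Rightarrow> _)"
proof unfold_locales
  show "restrict_vars T (p * q) = restrict_vars T p * restrict_vars T q" for p q :: "('i, 'k) mpoly"
    by (rule part_mult) (auto simp: keys_plus_nat)
  show "restrict_vars T 1 = (1 :: ('i, 'k) mpoly)"
    by (rule part_idI) auto
qed (auto simp: part_add)

lemma vars_in_zero [simp]: "vars_in T 0"
  by (simp add: vars_in_def)

lemma vars_in_const [simp]: "vars_in T (const c)"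
  by (simp add: vars_in_def)

lemma vars_in_one [simp]: "vars_in T (1 :: ('i, 'k::comm_ring_1) mpoly)"
  by (simp add: vars_in_def)

lemma vars_in_single: "Poly_Mapping.keys a \<subseteq> T \<Longrightarrow> vars_in T (Poly_Mapping.single a c)"
  by (simp add: vars_in_def)

lemma vars_in_add: "vars_in T p \<Longrightarrow> vars_in T q \<Longrightarrow> vars_in T (p + (q :: ('i, 'k::comm_ring_1) mpoly))"
  unfolding vars_in_def using keys_add[of p q] by blast

lemma vars_in_mult: "vars_in T p \<Longrightarrow> vars_in T q \<Longrightarrow> vars_in T (p * (q :: ('i, 'k::comm_ring_1) mpoly))"
  unfolding vars_in_def using keys_mult[of p q] by (fastforce simp: keys_plus_nat)

lemma vars_in_uminus: "vars_in T p \<Longrightarrow> vars_in T (- (p :: ('i, 'k::comm_ring_1) mpoly))"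
  unfolding vars_in_def by (auto simp: in_keys_iff)

lemma vars_in_sum:
  "(\<And>x. x \<in> A \<Longrightarrow> vars_in T (f x)) \<Longrightarrow> vars_in T (\<Sum>x\<in>A. f x :: ('i, 'k::comm_ring_1) mpoly)"
  by (induction A rule: infinite_finite_induct) (auto intro: vars_in_add)

lemma vars_in_mono: "vars_in S p \<Longrightarrow> S \<subseteq> T \<Longrightarrow> vars_in T p"
  by (auto simp: vars_in_def)

lemma vars_in_part: "vars_in T p \<Longrightarrow> vars_in T (part P p)"
  by (auto simp: vars_in_def keys_part)


section \<open>Ideals and linear independence modulo an ideal\<close>

text \<open>Ideals of a type-class ring; \<open>ideal_mpoly_ring_iff\<close> identifies them with
  the record-based ideals in the statement.\<close>

definition ring_ideal :: "'r::comm_ring_1 set \<Rightarrow> bool"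
  where "ring_ideal J \<longleftrightarrow> 0 \<in> J \<and> (\<forall>x\<in>J. \<forall>y\<in>J. x + y \<in> J) \<and> (\<forall>r. \<forall>x\<in>J. r * x \<in> J)"

lemma ring_idealI:
  "\<lbrakk>0 \<in> J; \<And>x y. x \<in> J \<Longrightarrow> y \<in> J \<Longrightarrow> x + y \<in> J; \<And>r x. x \<in> J \<Longrightarrow> r * x \<in> J\<rbrakk> \<Longrightarrow> ring_ideal J"
  by (simp add: ring_ideal_def)

lemma ring_ideal_zero: "ring_ideal J \<Longrightarrow> 0 \<in> J"
  by (simp add: ring_ideal_def)

lemma ring_ideal_add: "ring_ideal J \<Longrightarrow> x \<in> J \<Longrightarrow> y \<in> J \<Longrightarrow> x + y \<in> J"
  by (simp add: ring_ideal_def)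

lemma ring_ideal_mult: "ring_ideal J \<Longrightarrow> x \<in> J \<Longrightarrow> r * x \<in> J"
  by (simp add: ring_ideal_def)

lemma ring_ideal_mult_right: "ring_ideal J \<Longrightarrow> x \<in> J \<Longrightarrow> x * r \<in> J"
  by (metis ring_ideal_mult mult.commute)

lemma ring_ideal_uminus: "ring_ideal J \<Longrightarrow> x \<in> J \<Longrightarrow> - x \<in> J"
  using ring_ideal_mult[of J x "- 1"] by simp

lemma ring_ideal_diff: "ring_ideal J \<Longrightarrow> x \<in> J \<Longrightarrow> y \<in> J \<Longrightarrow> x - y \<in> J"
  using ring_ideal_add[of J x "- y"] ring_ideal_uminus[of J y] by simp

lemma ring_ideal_diff_sym: "ring_ideal J \<Longrightarrow> x - y \<in> J \<Longrightarrow> y - x \<in> J"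
  using ring_ideal_uminus[of J "x - y"] by simp

lemma ring_ideal_diff_trans: "ring_ideal J \<Longrightarrow> x - y \<in> J \<Longrightarrow> y - z \<in> J \<Longrightarrow> x - z \<in> J"
  using ring_ideal_add[of J "x - y" "y - z"] by simp

lemma ring_ideal_mem_cong: "ring_ideal J \<Longrightarrow> x - y \<in> J \<Longrightarrow> y \<in> J \<Longrightarrow> x \<in> J"
  using ring_ideal_add[of J "x - y" y] by simp

lemma ring_ideal_sum: "ring_ideal J \<Longrightarrow> (\<And>x. x \<in> A \<Longrightarrow> f x \<in> J) \<Longrightarrow> sum f A \<in> J"
  by (induction A rule: infinite_finite_induct) (auto intro: ring_ideal_add ring_ideal_zero)

lemma ring_ideal_sum_diff:
  "ring_ideal J \<Longrightarrow> (\<And>x. x \<in> A \<Longrightarrow> f x - g x \<in> J) \<Longrightarrow> sum f A - sum g A \<in> J"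
  by (simp add: ring_ideal_sum flip: sum_subtractf)

lemma ring_ideal_0: "ring_ideal {0}"
  by (rule ring_idealI) auto

text \<open>Independence is that of an indexed family, so equal values at different indices count as
  dependent and cardinalities of index sets can be compared.\<close>

definition indep_mod :: "('n, 'k::comm_ring_1) mpoly set \<Rightarrow> ('a \<Rightarrow> ('n, 'k) mpoly) \<Rightarrow> 'a set \<Rightarrow> bool"
  where "indep_mod J g A \<longleftrightarrow>
    (\<forall>c. (\<Sum>a\<in>A. const (c a) * g a) \<in> J \<longrightarrow> (\<forall>a\<in>A. c a = 0))"

definition spans_mod :: "('n, 'k::comm_ring_1) mpoly set \<Rightarrow> ('a \<Rightarrow> ('n, 'k) mpoly) \<Rightarrow> 'a set \<Rightarrow> ('n, 'k) mpoly \<Rightarrow> bool"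
  where "spans_mod J g A f \<longleftrightarrow> (\<exists>c. f - (\<Sum>a\<in>A. const (c a) * g a) \<in> J)"

lemma indep_modD: "indep_mod J g A \<Longrightarrow> (\<Sum>a\<in>A. const (c a) * g a) \<in> J \<Longrightarrow> a \<in> A \<Longrightarrow> c a = 0"
  by (auto simp: indep_mod_def)

text \<open>Gaussian elimination by induction on the equations: a pivot \<open>a0\<close> of the
  equation \<open>b0\<close> removes one unknown together with one equation.\<close>

lemma nontrivial_solution:
  fixes M :: "'a \<Rightarrow> 'b \<Rightarrow> 'k::field"
  assumes "finite B" "finite A" "card B < card A"
  shows "\<exists>c. (\<exists>a\<in>A. c a \<noteq> 0) \<and> (\<forall>b\<in>B. (\<Sum>a\<in>A. c a * M a b) = 0)"
  using assms
proof (induction B arbitrary: A M rule: finite_induct)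
  case empty
  then show ?case
    by (intro exI[of _ "\<lambda>_. 1"]) (auto simp: card_gt_0_iff)
next
  case (insert b0 B)
  show ?case
  proof (cases "\<forall>a\<in>A. M a b0 = 0")
    case True
    moreover obtain c where "\<exists>a\<in>A. c a \<noteq> 0" "\<forall>b\<in>B. (\<Sum>a\<in>A. c a * M a b) = 0"
      using insert.IH[of A M] insert.prems insert.hyps by auto
    ultimately show ?thesis
      by (intro exI[of _ c]) auto
  next
    case False
    then obtain a0 where a0: "a0 \<in> A" "M a0 b0 \<noteq> 0"
      by auto
    let ?A = "A - {a0}"
    let ?M = "\<lambda>a b. M a b - M a b0 / M a0 b0 * M a0 b"
    have "finite ?A" "card B < card ?A"
      using insert a0 by auto
    then obtain c where c: "\<exists>a\<in>?A. c a \<noteq> 0" "\<forall>b\<in>B. (\<Sum>a\<in>?A. c a * ?M a b) = 0"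
      using insert.IH[of ?A ?M] by auto
    \<comment> \<open>The value of the pivot unknown that solves the equation
      \<open>b0\<close>.\<close>
    define e where "e = - (\<Sum>a\<in>?A. c a * M a b0) / M a0 b0"
    define c' where "c' = c(a0 := e)"
    have sum: "(\<Sum>a\<in>A. c' a * M a b) = e * M a0 b + (\<Sum>a\<in>?A. c a * M a b)" for b
      using insert.prems(1) a0(1) by (subst sum.remove[of _ a0]) (auto simp: c'_def intro!: sum.cong)
    have "(\<Sum>a\<in>A. c' a * M a b) = 0" if "b \<in> insert b0 B" for b
    proof (cases "b = b0")
      case True
      then show ?thesis
        using a0(2) by (simp add: sum e_def)
    next
      case False
      then have "0 = (\<Sum>a\<in>?A. c a * ?M a b)"
        using that c by auto
      also have "\<dots> = (\<Sum>a\<in>?A. c a * M a b) - (\<Sum>a\<in>?A. c a * M a b0) / M a0 b0 * M a0 b"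
        by (simp add: algebra_simps sum_subtractf sum_distrib_left sum_distrib_right sum_divide_distrib)
      finally show ?thesis
        by (simp add: sum e_def)
    qed
    moreover have "\<exists>a\<in>A. c' a \<noteq> 0"
      using c(1) by (auto simp: c'_def)
    ultimately show ?thesis
      by blast
  qed
qed

text \<open>Steinitz bound: if there were more \<open>g\<close> than \<open>h\<close>, the
  coefficients of the \<open>g\<close> over the \<open>h\<close> would admit a nontrivial relation,
  which would become a relation modulo \<open>J\<close>. Every dimension comparison below is an
  instance.\<close>

lemma card_indep_le_spanning:
  fixes g :: "'a \<Rightarrow> ('n, 'k::field) mpoly"
  assumes J: "ring_ideal J" and "finite A" "finite B"
    and ind: "indep_mod J g A" and sp: "\<And>a. a \<in> A \<Longrightarrow> spans_mod J h B (g a)"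
  shows "card A \<le> card B"
proof (rule ccontr)
  assume "\<not> card A \<le> card B"
  obtain M where M: "\<And>a. a \<in> A \<Longrightarrow> g a - (\<Sum>b\<in>B. const (M a b) * h b) \<in> J"
    using sp unfolding spans_mod_def by metis
  obtain c where c: "\<exists>a\<in>A. c a \<noteq> 0" "\<forall>b\<in>B. (\<Sum>a\<in>A. c a * M a b) = 0"
    using nontrivial_solution[of B A M] assms(2,3) \<open>\<not> card A \<le> card B\<close> by auto
  have "(\<Sum>a\<in>A. const (c a) * (\<Sum>b\<in>B. const (M a b) * h b)) = (\<Sum>a\<in>A. \<Sum>b\<in>B. const (c a * M a b) * h b)"
    by (simp add: sum_distrib_left const_mult mult.assoc)
  also have "\<dots> = (\<Sum>b\<in>B. const (\<Sum>a\<in>A. c a * M a b) * h b)"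
    by (subst sum.swap) (simp add: const_sum sum_distrib_right)
  also have "\<dots> = 0"
    using c(2) by simp
  finally have "(\<Sum>a\<in>A. const (c a) * g a) = (\<Sum>a\<in>A. const (c a) * (g a - (\<Sum>b\<in>B. const (M a b) * h b)))"
    by (simp add: algebra_simps sum_subtractf)
  also have "\<dots> \<in> J"
    by (intro ring_ideal_sum J ring_ideal_mult M)
  finally show False
    using indep_modD[OF ind] c(1) by blast
qed

text \<open>Take an independent subset of maximal cardinality. A further index \<open>a\<close>
  creates a relation, in which the coefficient of \<open>g a\<close> cannot vanish, so
  \<open>g a\<close> can be solved for.\<close>

lemma maximal_indep_mod:
  fixes g :: "'a \<Rightarrow> ('n, 'k::field) mpoly"
  assumes J: "ring_ideal J" and "finite A"
  obtains B where "B \<subseteq> A" "indep_mod J g B" "\<And>a. a \<in> A \<Longrightarrow> spans_mod J g B (g a)"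
proof -
  let ?P = "\<lambda>B. B \<subseteq> A \<and> indep_mod J g B"
  have "?P {}"
    by (simp add: indep_mod_def)
  moreover have "card B < Suc (card A)" if "?P B" for B
    using that \<open>finite A\<close> by (simp add: card_mono less_Suc_eq_le)
  ultimately obtain B where B: "?P B" and max: "\<And>B'. ?P B' \<Longrightarrow> card B' \<le> card B"
    using ex_has_greatest_nat[of ?P "{}" card "Suc (card A)"] by blast
  have "finite B"
    using B \<open>finite A\<close> finite_subset by blast
  have "spans_mod J g B (g a)" if a: "a \<in> A" for a
  proof (cases "a \<in> B")
    case True
    have "(\<Sum>b\<in>B. const (if b = a then 1 else 0) * g b) = g a"
      using True \<open>finite B\<close> by (subst sum.remove[of _ a]) auto
    then show ?thesis
      unfolding spans_mod_def using ring_ideal_zero[OF J] 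
      by (intro exI[of _ "\<lambda>b. if b = a then 1 else 0"]) simp
  next
    case False
    then have "\<not> ?P (insert a B)"
      using max[of "insert a B"] \<open>finite B\<close> by auto
    then obtain c where c: "(\<Sum>b\<in>insert a B. const (c b) * g b) \<in> J" "\<exists>b\<in>insert a B. c b \<noteq> 0"
      using a B by (auto simp: indep_mod_def)
    have sum: "(\<Sum>b\<in>insert a B. const (c b) * g b) = const (c a) * g a + (\<Sum>b\<in>B. const (c b) * g b)"
      using False \<open>finite B\<close> by simp
    have "c a \<noteq> 0"
      using c sum B unfolding indep_mod_def by force
    have 1: "const (1 / c a) * (const (c a) * g a) = g a"
      using \<open>c a \<noteq> 0\<close> by (simp add: mult_single flip: mult.assoc)
    have 2: "const (1 / c a) * (const (c b) * g b) = - (const (- c b / c a) * g b)" for b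
      by (simp add: mult_single single_uminus flip: mult.assoc)
    have "g a - (\<Sum>b\<in>B. const (- c b / c a) * g b) = const (1 / c a) * (\<Sum>b\<in>insert a B. const (c b) * g b)"
      unfolding sum distrib_left 1 unfolding sum_distrib_left 2 sum_negf by simp
    also have "\<dots> \<in> J"
      by (intro ring_ideal_mult J c)
    finally show ?thesis
      unfolding spans_mod_def by (rule exI[of _ "\<lambda>b. - c b / c a"])
  qed
  then show thesis
    using that B by blast
qed

lemma spans_modI:
  assumes J: "ring_ideal J" and "a \<in> A" "finite A"
  shows "spans_mod J g A (g a)"
proof -
  have "(\<Sum>b\<in>A. const (if b = a then 1 else 0) * g b) = g a"
    using assms by (subst sum.remove[of _ a]) auto
  then show ?thesis
    unfolding spans_mod_def using ring_ideal_zero[OF J] 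
    by (intro exI[of _ "\<lambda>b. if b = a then 1 else 0"]) simp
qed

lemma spans_mod_cong: "ring_ideal J \<Longrightarrow> f - f' \<in> J \<Longrightarrow> spans_mod J g A f' \<Longrightarrow> spans_mod J g A f"
  unfolding spans_mod_def using ring_ideal_diff_trans by blast

lemma spans_mod_zero: "ring_ideal J \<Longrightarrow> spans_mod J g A 0"
  unfolding spans_mod_def by (intro exI[of _ "\<lambda>_. 0"]) (simp add: ring_ideal_zero)

lemma spans_mod_add:
  assumes "ring_ideal J" "spans_mod J g A f" "spans_mod J g A f'"
  shows "spans_mod J g A (f + f')"
proof -
  obtain c c' where "f - (\<Sum>a\<in>A. const (c a) * g a) \<in> J" "f' - (\<Sum>a\<in>A. const (c' a) * g a) \<in> J"
    using assms(2,3) unfolding spans_mod_def by blast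
  from ring_ideal_add[OF assms(1) this]
  have "f + f' - (\<Sum>a\<in>A. const (c a + c' a) * g a) \<in> J"
    by (simp add: const_add distrib_right sum.distrib algebra_simps)
  then show ?thesis
    unfolding spans_mod_def by (intro exI[of _ "\<lambda>a. c a + c' a"])
qed

lemma spans_mod_const_mult:
  assumes "ring_ideal J" "spans_mod J g A f"
  shows "spans_mod J g A (const e * f)"
proof -
  obtain c where "f - (\<Sum>a\<in>A. const (c a) * g a) \<in> J"
    using assms(2) unfolding spans_mod_def by blast
  from ring_ideal_mult[OF assms(1) this, of "const e"]
  have "const e * f - (\<Sum>a\<in>A. const (e * c a) * g a) \<in> J"
    by (simp add: const_mult right_diff_distrib sum_distrib_left mult.assoc)
  then show ?thesis
    unfolding spans_mod_def by (intro exI[of _ "\<lambda>a. e * c a"])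
qed

lemma spans_mod_sum:
  "ring_ideal J \<Longrightarrow> (\<And>x. x \<in> S \<Longrightarrow> spans_mod J g A (f x)) \<Longrightarrow> spans_mod J g A (\<Sum>x\<in>S. f x)"
  by (induction S rule: infinite_finite_induct) (auto intro: spans_mod_add spans_mod_zero)

lemma spans_mod_trans:
  assumes J: "ring_ideal J" and "spans_mod J g A f" "\<And>a. a \<in> A \<Longrightarrow> spans_mod J h B (g a)"
  shows "spans_mod J h B f"
proof -
  obtain c where c: "f - (\<Sum>a\<in>A. const (c a) * g a) \<in> J"
    using assms(2) unfolding spans_mod_def by blast
  have "spans_mod J h B (\<Sum>a\<in>A. const (c a) * g a)"
    by (intro spans_mod_sum spans_mod_const_mult J assms(3))
  then show ?thesis
    by (rule spans_mod_cong[OF J c])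
qed


section \<open>Counting monomials\<close>

definition monomials :: "nat \<Rightarrow> nat \<Rightarrow> nat monomial set"
  where "monomials d t = {a. Poly_Mapping.keys a \<subseteq> {..<d} \<and> monomial_degree a \<le> t}"

lemma finite_monomials [simp]: "finite (monomials d t)"
  unfolding monomials_def by (rule finite_monomials_le) simp

lemma monomials_zero_degree: "monomials d 0 = {0}"
  by (auto simp: monomials_def monomial_degree_eq_0_iff)

lemma monomials_zero_variables: "monomials 0 t = {0}"
  by (auto simp: monomials_def intro!: poly_mapping_eqI simp: in_keys_iff)

text \<open>The split according to divisibility by the last variable. It becomes Pascal's rule in
  \<open>card_monomials\<close> and drives the double induction in
  \<open>indep_mod_descending_primes\<close>.\<close>

lemma monomials_Suc_Suc:
  "monomials (Suc d) (Suc t) = monomials d (Suc t) \<union> (\<lambda>b. Poly_Mapping.single d 1 + b) ` monomials (Suc d) t"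
proof (intro Set.equalityI subsetI)
  fix a assume a: "a \<in> monomials (Suc d) (Suc t)"
  show "a \<in> monomials d (Suc t) \<union> (\<lambda>b. Poly_Mapping.single d 1 + b) ` monomials (Suc d) t"
  proof (cases "d \<in> Poly_Mapping.keys a")
    case True
    then obtain b where "a = Poly_Mapping.single d 1 + b"
      by (rule monomial_minus_single)
    then show ?thesis
      using a by (auto simp: monomials_def keys_plus_nat)
  next
    case False
    then have "Poly_Mapping.keys a \<subseteq> {..<d}"
      using a by (auto simp: monomials_def less_Suc_eq)
    then show ?thesis
      using a by (simp add: monomials_def)
  qed
qed (auto simp: monomials_def keys_plus_nat)

lemma monomials_disjoint: 
  "monomials d s \<inter> (\<lambda>b. Poly_Mapping.single d 1 + b) ` M = {}"
  by (auto simp: monomials_def keys_plus_nat)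

lemma card_monomials: "card (monomials d t) = (t + d) choose d"
proof (induction "t + d" arbitrary: t d)
  case 0
  then show ?case
    by (simp add: monomials_zero_degree)
next
  case (Suc n)
  show ?case
  proof (cases "t = 0 \<or> d = 0")
    case True
    then show ?thesis
      by (auto simp: monomials_zero_degree monomials_zero_variables)
  next
    case False
    then obtain t' d' where td: "t = Suc t'" "d = Suc d'"
      by (metis not0_implies_Suc)
    have "card (monomials d t) = card (monomials d' t) + card (monomials d t')"
      unfolding td monomials_Suc_Suc
      by (subst card_Un_disjoint) (simp_all only: finite_monomials finite_imageI monomials_disjoint, 
          simp add: card_image inj_on_def)
    also have "\<dots> = (t + d' choose d') + (t' + d choose d)"
      using Suc td by simp
    also have "\<dots> = (t + d) choose d"
      by (simp add: td)
    finally show ?thesis .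
  qed
qed

section \<open>Leading parts with respect to a monomial preorder\<close>

locale monomial_preorder_loc =
  fixes lt :: "'n monomial \<Rightarrow> 'n monomial \<Rightarrow> bool"
  assumes monomial_preorder: "monomial_preorder lt"
begin

abbreviation eqv :: "'n monomial \<Rightarrow> 'n monomial \<Rightarrow> bool"
  where "eqv \<equiv> incomparable lt"

text \<open>The bound \<open>u\<close> need not occur in \<open>p\<close>, so
  \<open>part (eqv u) p\<close> may be zero. This slack lets the product and determinant formulas
  hold without any condition of nonvanishing.\<close>

definition below :: "'n monomial \<Rightarrow> ('n, 'k::zero) mpoly \<Rightarrow> bool"
  where "below u p \<longleftrightarrow> (\<forall>a\<in>Poly_Mapping.keys p. lt a u \<or> eqv u a)"

lemma lt_irrefl: "\<not> lt a a"
  using monomial_preorder unfolding monomial_preorder_def weak_order_def by (auto dest: irreflpD)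

lemma lt_trans: "lt a b \<Longrightarrow> lt b c \<Longrightarrow> lt a c"
  using monomial_preorder unfolding monomial_preorder_def weak_order_def by (blast dest: transpD)

lemma lt_add_right: "lt (a + c) (b + c) \<longleftrightarrow> lt a b"
  using monomial_preorder unfolding monomial_preorder_def by blast

lemma lt_add_left: "lt (c + a) (c + b) \<longleftrightarrow> lt a b"
  using lt_add_right by (metis add.commute)

lemma eqv_refl: "eqv a a"
  by (simp add: incomparable_def lt_irrefl)

lemma eqv_sym: "eqv a b \<Longrightarrow> eqv b a"
  by (simp add: incomparable_def)

lemma eqv_trans: "eqv a b \<Longrightarrow> eqv b c \<Longrightarrow> eqv a c"
  using monomial_preorder unfolding monomial_preorder_def weak_order_def by (meson equivp_transp)

lemma eqv_add_left: "eqv (c + a) (c + b) \<longleftrightarrow> eqv a b"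
  by (simp add: incomparable_def lt_add_left)

lemma eqv_add: "eqv a b \<Longrightarrow> eqv c d \<Longrightarrow> eqv (a + c) (b + d)"
  using eqv_add_left by (metis add.commute eqv_trans)

lemma eqv_lt: "eqv a b \<Longrightarrow> lt b c \<Longrightarrow> lt a c"
  using lt_trans eqv_trans eqv_sym unfolding incomparable_def by metis

lemma lt_eqv: "lt a b \<Longrightarrow> eqv b c \<Longrightarrow> lt a c"
  using lt_trans eqv_trans eqv_sym unfolding incomparable_def by metis

lemma lt_add_le: "lt a u \<Longrightarrow> lt b v \<or> eqv v b \<Longrightarrow> lt (a + b) (u + v)"
  by (metis lt_add_left lt_add_right lt_trans lt_eqv eqv_sym eqv_add_left)

text \<open>If one of two bounded factors were strictly below its bound, the product would be
  strictly below \<open>u + v\<close>; hence a product monomial is in the top class only if both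
  factors are.\<close>

lemma part_eqv_mult:
  assumes "below u p" "below v q"
  shows "part (eqv (u + v)) (p * q) = part (eqv u) p * part (eqv v) (q :: ('n, 'k::comm_ring_1) mpoly)"
proof (rule part_mult)
  fix a b assume ab: "a \<in> Poly_Mapping.keys p" "b \<in> Poly_Mapping.keys q" "eqv (u + v) (a + b)"
  have "\<not> lt a u"
    using ab assms lt_add_le[of a u b v] unfolding below_def incomparable_def by blast
  moreover have "\<not> lt b v"
    using ab assms lt_add_le[of b v a u] unfolding below_def incomparable_def by (metis add.commute)
  ultimately show "eqv u a \<and> eqv v b"
    using ab assms unfolding below_def by blast
qed (rule eqv_add)

lemma below_mult:
  assumes "below u p" "below v q"
  shows "below (u + v) (p * (q :: ('n, 'k::comm_ring_1) mpoly))"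
proof -
  have "lt (a + b) (u + v) \<or> eqv (u + v) (a + b)"
    if "lt a u \<or> eqv u a" "lt b v \<or> eqv v b" for a b
    using that lt_add_le[of a u b v] lt_add_le[of b v a u] eqv_add by (metis add.commute)
  then show ?thesis
    using assms keys_mult[of p q] unfolding below_def by blast
qed

lemma below_zero [simp]: "below u 0"
  by (simp add: below_def)

lemma below_prod:
  "(\<And>i. i \<in> A \<Longrightarrow> below (u i) (p i)) \<Longrightarrow>
    below (\<Sum>i\<in>A. u i) (\<Prod>i\<in>A. p i :: ('n, 'k::comm_ring_1) mpoly) \<and>
    part (eqv (\<Sum>i\<in>A. u i)) (\<Prod>i\<in>A. p i) = (\<Prod>i\<in>A. part (eqv (u i)) (p i))"
proof (induction A rule: infinite_finite_induct)
  case (insert x A)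
  then show ?case
    by (simp add: below_mult part_eqv_mult)
qed (auto simp: below_def eqv_refl intro!: part_idI)

text \<open>Each term of the Leibniz expansion takes one entry from every row. Since the bound
  depends on the row alone, all terms share the bound \<Sum> u i, and the top part can be taken
  entrywise.\<close>

lemma part_eqv_det:
  fixes m :: "nat \<Rightarrow> nat \<Rightarrow> ('n, 'k::comm_ring_1) mpoly"
  assumes "\<And>i j. i < n \<Longrightarrow> j < n \<Longrightarrow> below (u i) (m i j)"
  shows "part (eqv (\<Sum>i<n. u i)) (det (mat n n (\<lambda>(i, j). m i j))) =
    det (mat n n (\<lambda>(i, j). part (eqv (u i)) (m i j)))"
proof -
  have sign: "part P (signof p * f) = signof p * part P f" for P and p :: "nat \<Rightarrow> nat" and f :: "('n, 'k) mpoly"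
    using part_diff[of P 0 f] by (simp add: sign_def)
  have "part (eqv (\<Sum>i<n. u i)) (\<Prod>i<n. m i (p i)) = (\<Prod>i<n. part (eqv (u i)) (m i (p i)))"
    if "p permutes {0..<n}" for p
    using that by (intro conjunct2[OF below_prod] assms) (auto dest: permutes_in_image)
  moreover have "(\<Prod>i<n. mat n n (\<lambda>(i, j). f i j) $$ (i, p i)) = (\<Prod>i<n. f i (p i))"
    if "p permutes {0..<n}" for p and f :: "nat \<Rightarrow> nat \<Rightarrow> ('n, 'k) mpoly"
    using that permutes_in_image[OF that] by (intro prod.cong) auto
  ultimately show ?thesis
    by (simp add: det_def part_sum sign atLeast0LessThan)
qed

lemma maximal_monomial_exists:
  assumes "finite A" "A \<noteq> {}"
  shows "\<exists>u\<in>A. \<forall>a\<in>A. \<not> lt u a"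
  using assms
proof (induction rule: finite_ne_induct)
  case (insert x A)
  then show ?case
    using lt_trans lt_irrefl by (metis insert_iff)
qed (auto simp: lt_irrefl)

text \<open>In a weak order the maximal monomials of \<open>f\<close> form a single class of
  incomparable monomials, so any one of them cuts out the leading part.\<close>

lemma leading_part_part_eqv:
  obtains u where "below u f" "leading_part lt f = part (eqv u) (f :: ('n, 'k::comm_ring_1) mpoly)"
proof (cases "f = 0")
  case True
  then show ?thesis
    by (intro that[of 0]) (auto simp: leading_part_eq_part)
next
  case False
  have "Poly_Mapping.keys f \<noteq> {}"
    using False by (metis all_not_in_conv in_keys_iff lookup_zero poly_mapping_eqI)
  then obtain u where u: "u \<in> Poly_Mapping.keys f" "\<forall>a\<in>Poly_Mapping.keys f. \<not> lt u a"
    using maximal_monomial_exists finite_keys by metis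
  show ?thesis
  proof (rule that[of u])
    show "below u f"
      using u by (auto simp: below_def incomparable_def)
    have "(\<not> (\<exists>b\<in>Poly_Mapping.keys f. lt a b)) \<longleftrightarrow> eqv u a" if "a \<in> Poly_Mapping.keys f" for a
      using u that eqv_lt[of u a] unfolding incomparable_def by blast
    then show "leading_part lt f = part (eqv u) f"
      unfolding leading_part_eq_part
      by (intro poly_mapping_eqI) (auto simp: lookup_part in_keys_iff)
  qed
qed

lemma leading_part_single_mult:
  assumes "c \<noteq> 0"
  shows "Poly_Mapping.single b c * leading_part lt f =
    leading_part lt (Poly_Mapping.single b c * (f :: ('n, 'k::field) mpoly))"
proof -
  have keys: "Poly_Mapping.keys (Poly_Mapping.single b c * f) = (\<lambda>a. b + a) ` Poly_Mapping.keys f"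
  proof
    show "Poly_Mapping.keys (Poly_Mapping.single b c * f) \<subseteq> (\<lambda>a. b + a) ` Poly_Mapping.keys f"
      using keys_mult[of "Poly_Mapping.single b c" f] by (fastforce split: if_splits)
    have "Poly_Mapping.lookup (Poly_Mapping.single b c * f) (b + a) = c * Poly_Mapping.lookup f a" for a
      by (induction f rule: poly_mapping_single_induct)
        (auto simp: mult_single lookup_single lookup_add distrib_left when_def)
    then show "(\<lambda>a. b + a) ` Poly_Mapping.keys f \<subseteq> Poly_Mapping.keys (Poly_Mapping.single b c * f)"
      using assms by (auto simp: in_keys_iff)
  qed
  show ?thesis
    unfolding leading_part_eq_part keys
    by (subst part_mult[where P = "\<lambda>a. a = b" and Q = "\<lambda>a. \<not> (\<exists>b\<in>Poly_Mapping.keys f. lt a b)"])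
      (auto simp: lt_add_left part_single split: if_splits)
qed

end


section \<open>Deforming the leading parts into the polynomials\<close>

text \<open>Artin's argument for the linear independence of the characters \<open>s \<mapsto> s\<^sup>a\<close> of the torus.\<close>

lemma nonzero_poly_nonvanishing_on_torus:
  fixes p :: "('n, 'k::field) mpoly"
  assumes inf: "infinite (UNIV :: 'k set)" and "p \<noteq> 0"
  shows "\<exists>s. (\<forall>i. s i \<noteq> 0) \<and> peval (\<lambda>x. x) s p \<noteq> 0"
  using \<open>p \<noteq> 0\<close>
proof (induction "card (Poly_Mapping.keys p)" arbitrary: p rule: less_induct)
  case less
  obtain a where a: "a \<in> Poly_Mapping.keys p"
    using less.prems by (metis in_keys_iff lookup_zero poly_mapping_eqI)
  show ?case
  proof (cases "Poly_Mapping.keys p = {a}")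
    case True
    then have "peval (\<lambda>x. x) (\<lambda>_. 1) p \<noteq> 0"
      by (simp add: peval_def meval_def in_keys_iff[symmetric])
    then show ?thesis
      by (intro exI[of _ "\<lambda>_. 1"]) simp
  next
    case False
    then obtain b where b: "b \<in> Poly_Mapping.keys p" "b \<noteq> a"
      using a by blast
    obtain i where i: "Poly_Mapping.lookup a i \<noteq> Poly_Mapping.lookup b i"
      using b(2) by (metis poly_mapping_eqI)
    \<comment> \<open>The difference of the characters at \<open>a\<close> and \<open>b\<close> on a
      one-parameter subgroup moving only the coordinate \<open>i\<close>; a nonzero \<open>x\<close>
      that is not a root separates them.\<close>
    let ?q = "Polynomial.monom (1::'k) (Poly_Mapping.lookup a i) - Polynomial.monom 1 (Poly_Mapping.lookup b i)"
    have "Polynomial.coeff ?q (Poly_Mapping.lookup a i) = 1"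
      using i by simp
    then have "?q \<noteq> 0"
      by (metis coeff_0 zero_neq_one)
    then have "finite ({x. poly ?q x = 0} \<union> {0})"
      using poly_roots_finite by blast
    from ex_new_if_finite[OF inf this] obtain x where x: "poly ?q x \<noteq> 0" "x \<noteq> 0"
      by blast
    define u where "u = (\<lambda>j. if j = i then x else 1)"
    have meval_u: "meval u c = x ^ Poly_Mapping.lookup c i" for c
    proof -
      have "meval u c = (\<Prod>j\<in>insert i (Poly_Mapping.keys c). u j ^ Poly_Mapping.lookup c j)"
        by (rule meval_superset) auto
      also have "\<dots> = (\<Prod>j\<in>{i}. u j ^ Poly_Mapping.lookup c j)"
        by (rule prod.mono_neutral_right) (auto simp: u_def)
      finally show ?thesis
        by (simp add: u_def)
    qed
    have u: "meval u a \<noteq> meval u b" "\<And>j. u j \<noteq> 0"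
      unfolding meval_u using x by (simp_all add: poly_monom u_def)
    \<comment> \<open>As a function, p'(s) = p(u s) - u^b p(s). The term of \<open>b\<close> cancels
      while that of \<open>a\<close> stays, and if p' does not vanish at s, then p does not vanish
      at s or at u s.\<close>
    define p' where "p' = Poly_Mapping.mapp (\<lambda>c e. e * (meval u c - meval u b)) p"
    have lookup_p': "Poly_Mapping.lookup p' c = Poly_Mapping.lookup p c * (meval u c - meval u b)" for c
      by (auto simp: p'_def lookup_mapp when_def in_keys_iff)
    have sub: "Poly_Mapping.keys p' \<subseteq> Poly_Mapping.keys p - {b}"
      by (auto simp: in_keys_iff lookup_p')
    then have "card (Poly_Mapping.keys p') \<le> card (Poly_Mapping.keys p - {b})"
      by (intro card_mono) auto
    also have "\<dots> < card (Poly_Mapping.keys p)"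
      using b(1) by (intro psubset_card_mono) auto
    finally have "card (Poly_Mapping.keys p') < card (Poly_Mapping.keys p)" .
    moreover have "p' \<noteq> 0"
      using a u lookup_p'[of a] by (auto simp: in_keys_iff)
    ultimately obtain s where s: "\<forall>i. s i \<noteq> 0" "peval (\<lambda>x. x) s p' \<noteq> 0"
      using less.hyps by blast
    have "peval (\<lambda>x. x) s p' = (\<Sum>c\<in>Poly_Mapping.keys p. Poly_Mapping.lookup p' c * meval s c)"
      unfolding peval_def using sub by (intro sum.mono_neutral_left) (auto simp: in_keys_iff)
    also have "\<dots> = peval (\<lambda>x. x) (\<lambda>j. u j * s j) p - meval u b * peval (\<lambda>x. x) s p"
      by (simp add: peval_def lookup_p' meval_mult sum_distrib_left algebra_simps sum_subtractf)
    finally have "peval (\<lambda>x. x) (\<lambda>j. u j * s j) p \<noteq> 0 \<or> peval (\<lambda>x. x) s p \<noteq> 0"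
      using s(2) by auto
    moreover have "\<forall>j. u j * s j \<noteq> 0"
      using s u by simp
    ultimately show ?thesis
      using s(1) by (elim disjE) (rule exI, erule (1) conjI)+
  qed
qed

section \<open>Spans and coefficient matrices in one degree\<close>

interpretation mpoly_module: Modules.module "\<lambda>c f. const c * f :: ('n, 'k::comm_ring_1) mpoly"
  by unfold_locales (simp_all add: const_add const_mult distrib_left distrib_right mult.assoc)

text \<open>Allowing every finite superset of the support lets the supports of several polynomials
  be merged into one.\<close>

lemma span_imp_spans_mod:
  assumes "f \<in> mpoly_module.span G"
  shows "\<exists>F. finite F \<and> F \<subseteq> G \<and> (\<forall>F'. finite F' \<longrightarrow> F \<subseteq> F' \<longrightarrow> spans_mod {0} (\<lambda>f. f) F' f)"
proof -
  obtain F c where F: "finite F" "F \<subseteq> G" "f = (\<Sum>a\<in>F. const (c a) * a)"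
    using assms by (auto simp: mpoly_module.span_explicit)
  have "spans_mod {0} (\<lambda>f. f) F' f" if "finite F'" "F \<subseteq> F'" for F'
    unfolding F(3) using that
    by (intro spans_mod_sum spans_mod_const_mult ring_ideal_0 spans_modI) auto
  then show ?thesis
    using F(1,2) by (intro exI[of _ F]) simp
qed

lemma homogeneous_sum_monomials:
  assumes "finite M" "\<And>a. monomial_degree a = t \<longleftrightarrow> a \<in> M" "homogeneous t f"
  shows "f = (\<Sum>a\<in>M. const (Poly_Mapping.lookup f a) * monomial_poly a :: ('n, 'k::comm_ring_1) mpoly)"
proof -
  have "f = (\<Sum>a\<in>Poly_Mapping.keys f. Poly_Mapping.single a (Poly_Mapping.lookup f a))"
    by (rule poly_mapping_sum_single)
  also have "\<dots> = (\<Sum>a\<in>M. Poly_Mapping.single a (Poly_Mapping.lookup f a))"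
    using assms by (intro sum.mono_neutral_left) (auto simp: homogeneous_def in_keys_iff)
  finally show ?thesis
    by (simp add: mult_single)
qed

lemma indep_mod_monomials:
  "finite M \<Longrightarrow> indep_mod {0} (monomial_poly :: 'n monomial \<Rightarrow> ('n, 'k::comm_ring_1) mpoly) M"
  unfolding indep_mod_def
proof (intro allI impI ballI)
  fix c :: "'n monomial \<Rightarrow> 'k" and a
  assume "finite M" and c: "(\<Sum>a\<in>M. const (c a) * monomial_poly a) \<in> {0}" and "a \<in> M"
  have "Poly_Mapping.lookup (\<Sum>a\<in>M. const (c a) * monomial_poly a) a = c a"
    using \<open>finite M\<close> \<open>a \<in> M\<close> by (simp add: mult_single lookup_sum lookup_single when_def)
  then show "c a = 0"
    using c by simp
qed

text \<open>A kernel vector defines a linear functional that kills every \<open>r i\<close>, hence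
  every monomial of the list; but its values on these monomials are the entries of the
  vector.\<close>

lemma coefficient_matrix_det_nonzero:
  fixes r :: "nat \<Rightarrow> ('n, 'k::field) mpoly"
  assumes "distinct ms" "\<And>a. a \<in> set ms \<Longrightarrow> spans_mod {0} r {..<length ms} (monomial_poly a)"
  shows "det (mat (length ms) (length ms) (\<lambda>(i, j). Poly_Mapping.lookup (r i) (ms ! j))) \<noteq> 0"
proof
  let ?n = "length ms"
  let ?A = "mat ?n ?n (\<lambda>(i, j). Poly_Mapping.lookup (r i) (ms ! j))"
  assume "det ?A = 0"
  then obtain v where v: "v \<in> carrier_vec ?n" "v \<noteq> 0\<^sub>v ?n" "?A *\<^sub>v v = 0\<^sub>v ?n"
    by (subst (asm) det_0_iff_vec_prod_zero_field) auto
  have row: "(\<Sum>j<?n. Poly_Mapping.lookup (r i) (ms ! j) * v $ j) = 0" if "i < ?n" for i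
  proof -
    have "(?A *\<^sub>v v) $ i = 0"
      using v that by simp
    then show ?thesis
      using v(1) that by (simp add: scalar_prod_def atLeast0LessThan)
  qed
  have "v $ k = 0" if k: "k < ?n" for k
  proof -
    obtain c where c: "monomial_poly (ms ! k) = (\<Sum>i<?n. const (c i) * r i)"
      using assms(2)[of "ms ! k"] k unfolding spans_mod_def by auto
    have "v $ k = (\<Sum>j<?n. if j = k then v $ j else 0)"
      using k by simp
    also have "\<dots> = (\<Sum>j<?n. (if j = k then 1 else 0) * v $ j)"
      by (intro sum.cong) auto
    also have "\<dots> = (\<Sum>j<?n. Poly_Mapping.lookup (monomial_poly (ms ! k)) (ms ! j) * v $ j)"
      using k \<open>distinct ms\<close> by (intro sum.cong refl) (auto simp: lookup_single when_def nth_eq_iff_index_eq)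
    also have "\<dots> = (\<Sum>j<?n. (\<Sum>i<?n. c i * Poly_Mapping.lookup (r i) (ms ! j)) * v $ j)"
      unfolding c by (simp add: lookup_sum lookup_const_mult)
    also have "\<dots> = (\<Sum>i<?n. c i * (\<Sum>j<?n. Poly_Mapping.lookup (r i) (ms ! j) * v $ j))"
      by (simp add: sum_distrib_left sum_distrib_right mult.assoc) (rule sum.swap)
    also have "\<dots> = 0"
      using row by simp
    finally show ?thesis .
  qed
  then show False
    using v(1,2) by auto
qed

text \<open>Cramer's rule: the coefficients are a row of the adjugate matrix divided by the
  determinant.\<close>

lemma spans_mod_if_coefficient_matrix_det_nonzero:
  fixes r :: "nat \<Rightarrow> ('n, 'k::field) mpoly"
  assumes ms: "distinct ms" "a \<in> set ms"
    and r: "\<And>i. i < length ms \<Longrightarrow> Poly_Mapping.keys (r i) \<subseteq> set ms"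
    and det: "det (mat (length ms) (length ms) (\<lambda>(i, j). Poly_Mapping.lookup (r i) (ms ! j))) \<noteq> 0"
  shows "spans_mod {0} r {..<length ms} (monomial_poly a)"
proof -
  let ?n = "length ms"
  let ?A = "mat ?n ?n (\<lambda>(i, j). Poly_Mapping.lookup (r i) (ms ! j))"
  have A: "?A \<in> carrier_mat ?n ?n"
    by simp
  obtain k where k: "k < ?n" "a = ms ! k"
    using ms by (metis in_set_conv_nth)
  define c where "c i = adj_mat ?A $$ (k, i) / det ?A" for i
  have row: "(\<Sum>i<?n. c i * Poly_Mapping.lookup (r i) (ms ! j)) = (if j = k then 1 else 0)" if j: "j < ?n" for j
  proof -
    have "(adj_mat ?A * ?A) $$ (k, j) = (det ?A \<cdot>\<^sub>m 1\<^sub>m ?n) $$ (k, j)"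
      using adj_mat(3)[OF A] by simp
    then have "(\<Sum>i<?n. adj_mat ?A $$ (k, i) * Poly_Mapping.lookup (r i) (ms ! j)) = (if j = k then det ?A else 0)"
      using j k adj_mat(1)[OF A] by (auto simp: scalar_prod_def atLeast0LessThan)
    then have "(\<Sum>i<?n. adj_mat ?A $$ (k, i) * Poly_Mapping.lookup (r i) (ms ! j)) / det ?A = (if j = k then 1 else 0)"
      using det by auto
    then show ?thesis
      by (simp add: c_def sum_divide_distrib)
  qed
  have "monomial_poly a = (\<Sum>i<?n. const (c i) * r i)"
  proof (rule poly_mapping_eqI)
    fix b
    have eq: "Poly_Mapping.lookup (\<Sum>i<?n. const (c i) * r i) b = (\<Sum>i<?n. c i * Poly_Mapping.lookup (r i) b)"
      by (simp add: lookup_sum lookup_const_mult)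
    show "Poly_Mapping.lookup (monomial_poly a) b = Poly_Mapping.lookup (\<Sum>i<?n. const (c i) * r i) b"
    proof (cases "b \<in> set ms")
      case True
      then obtain j where j: "j < ?n" "b = ms ! j"
        by (metis in_set_conv_nth)
      then show ?thesis
        unfolding eq using row[of j] k ms(1) by (simp add: lookup_single when_def nth_eq_iff_index_eq eq_commute)
    next
      case False
      then have "Poly_Mapping.lookup (r i) b = 0" if "i < ?n" for i
        using r[OF that] by (auto simp: in_keys_iff)
      then show ?thesis
        unfolding eq using False ms(2) by (auto simp: lookup_single when_def)
    qed
  qed
  then show ?thesis
    unfolding spans_mod_def by auto
qed

section \<open>The torus action and the deformation\<close>

definition rescale :: "('n \<Rightarrow> 'k::comm_ring_1) \<Rightarrow> ('n, 'k) mpoly \<Rightarrow> ('n, 'k) mpoly"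
  where "rescale s = subst (\<lambda>i. const (s i) * monomial_poly (Poly_Mapping.single i 1))"

lemma rescale_comm_ring_hom: "comm_ring_hom (rescale s)"
  unfolding rescale_def by (rule comm_ring_hom.comm_ring_hom_peval[OF const_comm_ring_hom])

lemma rescale_single:
  fixes s :: "'n \<Rightarrow> 'k::comm_ring_1"
  shows "rescale s (Poly_Mapping.single a c) = Poly_Mapping.single a (c * meval s a)"
proof -
  interpret c: comm_ring_hom "const :: 'k \<Rightarrow> ('n, 'k) mpoly" by (rule const_comm_ring_hom)
  show ?thesis
    unfolding rescale_def c.peval_single meval_mult meval_mono_variable c.hom_meval[symmetric]
    by (simp add: mult_single)
qed

lemma rescale_add: "rescale s (f + g) = rescale s f + rescale s g"
proof -
  interpret comm_ring_hom "rescale s" by (rule rescale_comm_ring_hom)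
  show ?thesis
    by (rule hom_add)
qed

lemma lookup_rescale: "Poly_Mapping.lookup (rescale s f) a = Poly_Mapping.lookup f a * meval s a"
proof (induction f rule: poly_mapping_single_induct)
  case zero
  show ?case
    using rescale_single[of s 0 0] by simp
qed (auto simp: rescale_single rescale_add lookup_add lookup_single when_def distrib_right)

text \<open>Here \<open>G\<close> supplies polynomials to be deformed from their leading parts, and
  \<open>H\<close> supplies vectors that stay fixed, later the multiples of the linear
  forms.\<close>

lemma (in monomial_preorder_loc) deform_leading_parts:
  fixes G H :: "('n, 'k::field) mpoly set"
  assumes inf: "infinite (UNIV :: 'k set)"
    and fin: "finite {a :: 'n monomial. monomial_degree a = t}"
    and hom: "\<And>f. f \<in> G \<union> H \<Longrightarrow> homogeneous t f"
    and span: "\<And>a. monomial_degree a = t \<Longrightarrow> monomial_poly a \<in> mpoly_module.span (leading_part lt ` G \<union> H)"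
  obtains s where "\<And>i. s i \<noteq> 0"
    and "\<And>a. monomial_degree a = t \<Longrightarrow> monomial_poly a \<in> mpoly_module.span (rescale s ` G \<union> H)"
proof -
  let ?K = "leading_part lt ` G \<union> H"
  obtain ms where ms: "distinct ms" "set ms = {a :: 'n monomial. monomial_degree a = t}"
    using finite_distinct_list[OF fin] by blast
  let ?n = "length ms"
  have homK: "homogeneous t f" if "f \<in> ?K" for f
    using that hom by (fastforce simp: homogeneous_def leading_part_eq_part keys_part)
  define spanning where "spanning a F \<longleftrightarrow> finite F \<and> F \<subseteq> ?K \<and>
      (\<forall>F'. finite F' \<longrightarrow> F \<subseteq> F' \<longrightarrow> spans_mod {0} (\<lambda>f. f) F' (monomial_poly a :: ('n, 'k) mpoly))" for a F
  have "\<exists>F. spanning a F" if a: "a \<in> set ms" for a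
  proof -
    have "monomial_poly a \<in> mpoly_module.span ?K"
      using a ms(2) by (intro span) simp
    then show ?thesis
      unfolding spanning_def by (rule span_imp_spans_mod)
  qed
  then obtain F where spanning: "\<And>a. a \<in> set ms \<Longrightarrow> spanning a (F a)"
    by metis
  have F: "\<And>a. a \<in> set ms \<Longrightarrow> finite (F a)" "\<And>a. a \<in> set ms \<Longrightarrow> F a \<subseteq> ?K"
    "\<And>a F'. a \<in> set ms \<Longrightarrow> finite F' \<Longrightarrow> F a \<subseteq> F' \<Longrightarrow>
      spans_mod {0} (\<lambda>f. f) F' (monomial_poly a :: ('n, 'k) mpoly)"
    using spanning unfolding spanning_def by simp_all
  define F' where "F' = (\<Union>a\<in>set ms. F a)"
  have F': "finite F'" "F' \<subseteq> ?K" "\<And>a. a \<in> set ms \<Longrightarrow> spans_mod {0} (\<lambda>f. f) F' (monomial_poly a)"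
    unfolding F'_def using F by (auto intro!: F(3))
  obtain B where B: "B \<subseteq> F'" "indep_mod {0} (\<lambda>f. f) B" "\<And>f. f \<in> F' \<Longrightarrow> spans_mod {0} (\<lambda>f. f) B f"
    using maximal_indep_mod[OF ring_ideal_0 F'(1), of "\<lambda>f. f"] by blast
  have spanB: "spans_mod {0} (\<lambda>f. f) B (monomial_poly a)" if "a \<in> set ms" for a
    using F'(3)[OF that] B(3) by (rule spans_mod_trans[OF ring_ideal_0])
  have finB: "finite B"
    using B(1) F'(1) finite_subset by blast
  \<comment> \<open>The two inequalities make \<open>B\<close> a basis of the component of degree
    \<open>t\<close>, so its coefficient matrix is square.\<close>
  have "card (set ms) \<le> card B"
    by (rule card_indep_le_spanning[OF ring_ideal_0 _ finB indep_mod_monomials spanB]) auto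
  moreover have "card B \<le> card (set ms)"
  proof (rule card_indep_le_spanning[OF ring_ideal_0 finB _ B(2), where h = monomial_poly])
    fix f assume "f \<in> B"
    then have "homogeneous t f"
      using B F' homK by blast
    then have f: "f = (\<Sum>a\<in>set ms. const (Poly_Mapping.lookup f a) * monomial_poly a)"
      using ms(2) fin by (intro homogeneous_sum_monomials) auto
    show "spans_mod {0} monomial_poly (set ms) f"
      unfolding spans_mod_def by (rule exI[of _ "Poly_Mapping.lookup f"]) (simp flip: f)
  qed auto
  ultimately have cardB: "card B = ?n"
    using ms(1) by (simp add: distinct_card)
  obtain bs where bs: "set bs = B" "distinct bs"
    using finite_distinct_list[OF finB] by blast
  then have len: "length bs = ?n"
    using cardB distinct_card by metis
  \<comment> \<open>A basis vector lying in both families is treated as a leading part.\<close>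
  define scaled where "scaled i \<longleftrightarrow> bs ! i \<in> leading_part lt ` G" for i
  define row where "row i = (if scaled i then SOME f. f \<in> G \<and> leading_part lt f = bs ! i else bs ! i)" for i
  have row_scaled: "row i \<in> G" "leading_part lt (row i) = bs ! i" if "scaled i" for i
  proof -
    have "\<exists>f. f \<in> G \<and> leading_part lt f = bs ! i"
      using that by (auto simp: scaled_def)
    from someI_ex[OF this] show "row i \<in> G" "leading_part lt (row i) = bs ! i"
      using that by (auto simp: row_def)
  qed
  have row_H: "row i \<in> H" "row i = bs ! i" if "\<not> scaled i" "i < ?n" for i
  proof -
    have "bs ! i \<in> ?K"
      using that bs B(1) F'(2) len by (metis nth_mem subsetD)
    then show "row i \<in> H" "row i = bs ! i"
      using that by (auto simp: row_def scaled_def)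
  qed
  have "\<exists>u. below u (row i) \<and> leading_part lt (row i) = part (eqv u) (row i)" for i
    using leading_part_part_eqv[of "row i"] by blast
  then obtain u where u: "\<And>i. below (u i) (row i)" "\<And>i. leading_part lt (row i) = part (eqv (u i)) (row i)"
    by metis
  \<comment> \<open>The coefficient of \<open>ms ! j\<close> after x_i is replaced by s_i x_i; the
    polynomial type is reused for polynomials in the parameters s. Rows from \<open>H\<close> are
    constant in s, hence bounded by the exponent 0.\<close>
  define m where "m i j = (if scaled i then Poly_Mapping.single (ms ! j) (Poly_Mapping.lookup (row i) (ms ! j))
      else const (Poly_Mapping.lookup (row i) (ms ! j)))" for i j
  define v where "v i = (if scaled i then u i else 0)" for i
  have below: "below (v i) (m i j)" for i j
    using u(1)[of i] by (auto simp: m_def v_def below_def in_keys_iff eqv_refl split: if_splits)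
  have id_hom: "comm_ring_hom (\<lambda>x::'k. x)"
    by unfold_locales auto
  define ev where "ev s = (peval (\<lambda>x::'k. x) s :: ('n, 'k) mpoly \<Rightarrow> 'k)" for s
  have ev_hom: "comm_ring_hom (ev s)" for s
    unfolding ev_def by (rule comm_ring_hom.comm_ring_hom_peval[OF id_hom])
  have ev_single: "ev s (Poly_Mapping.single a c) = c * meval s a" for s a c
    unfolding ev_def by (rule comm_ring_hom.peval_single[OF id_hom])
  have det_ev: "ev s (det (mat ?n ?n (\<lambda>(i, j). f i j))) = det (mat ?n ?n (\<lambda>(i, j). ev s (f i j)))" for s f
    by (subst comm_ring_hom.hom_det[OF ev_hom, symmetric]) (rule arg_cong[where f = det], rule eq_matI, auto)
  \<comment> \<open>At s = 1 the powers of s disappear, and the top part of a scaled row retains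
    exactly the coefficients of the leading part.\<close>
  have top: "ev (\<lambda>_. 1) (part (eqv (v i)) (m i j)) = Poly_Mapping.lookup (bs ! i) (ms ! j)" if "i < ?n" for i j
  proof (cases "scaled i")
    case True
    have "part (eqv (v i)) (m i j) = Poly_Mapping.single (ms ! j) (Poly_Mapping.lookup (bs ! i) (ms ! j))"
      unfolding row_scaled(2)[OF True, symmetric] u(2)
      using True by (simp add: m_def v_def part_single lookup_part)
    then show ?thesis
      by (simp add: ev_single meval_def)
  next
    case False
    then show ?thesis
      using that row_H(2) by (simp add: m_def v_def part_single eqv_refl ev_single)
  qed
  have "det (mat ?n ?n (\<lambda>(i, j). ev (\<lambda>_. 1) (part (eqv (v i)) (m i j)))) =
      det (mat ?n ?n (\<lambda>(i, j). Poly_Mapping.lookup (bs ! i) (ms ! j)))"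
    by (rule arg_cong[where f = det], rule eq_matI) (auto simp: top)
  also have "\<dots> \<noteq> 0"
  proof (rule coefficient_matrix_det_nonzero[OF ms(1)])
    fix a assume "a \<in> set ms"
    from spanB[OF this] obtain c where c: "monomial_poly a = (\<Sum>f\<in>B. const (c f) * f)"
      by (auto simp: spans_mod_def)
    have "(\<Sum>f\<in>B. const (c f) * f) = (\<Sum>i<?n. const (c (bs ! i)) * bs ! i)"
      using bs len bij_betw_nth[OF bs(2) refl refl] by (intro sum.reindex_bij_betw[symmetric]) (simp add: bs(1))
    then show "spans_mod {0} (\<lambda>i. bs ! i) {..<?n} (monomial_poly a)"
      unfolding spans_mod_def c by (intro exI[of _ "\<lambda>i. c (bs ! i)"]) simp
  qed
  finally have "ev (\<lambda>_. 1) (det (mat ?n ?n (\<lambda>(i, j). part (eqv (v i)) (m i j)))) \<noteq> 0"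
    by (simp add: det_ev)
  then have "det (mat ?n ?n (\<lambda>(i, j). part (eqv (v i)) (m i j))) \<noteq> 0"
    using ev_single[of "\<lambda>_. 1" 0 0] by auto
  then have "det (mat ?n ?n (\<lambda>(i, j). m i j)) \<noteq> 0"
    using part_eqv_det[where n = ?n and m = m and u = v, OF below] by auto
  from nonzero_poly_nonvanishing_on_torus[OF inf this]
  obtain s where s: "\<And>i. s i \<noteq> 0" "ev s (det (mat ?n ?n (\<lambda>(i, j). m i j))) \<noteq> 0"
    unfolding ev_def by blast
  define r where "r i = (if scaled i then rescale s (row i) else row i)" for i
  have row_hom: "homogeneous t (row i)" if "i < ?n" for i
    using hom row_scaled(1)[of i] row_H(1)[of i] that by blast
  have "mat ?n ?n (\<lambda>(i, j). ev s (m i j)) = mat ?n ?n (\<lambda>(i, j). Poly_Mapping.lookup (r i) (ms ! j))"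
    by (rule eq_matI) (auto simp: m_def r_def ev_single lookup_rescale)
  then have det: "det (mat ?n ?n (\<lambda>(i, j). Poly_Mapping.lookup (r i) (ms ! j))) \<noteq> 0"
    using s(2) by (simp add: det_ev)
  have keys_r: "Poly_Mapping.keys (r i) \<subseteq> set ms" if "i < ?n" for i
    using row_hom[OF that] by (auto simp: r_def ms(2) homogeneous_def in_keys_iff lookup_rescale)
  have r_in: "r i \<in> rescale s ` G \<union> H" if "i < ?n" for i
    using row_scaled(1)[of i] row_H(1)[of i] that by (auto simp: r_def)
  have "monomial_poly a \<in> mpoly_module.span (rescale s ` G \<union> H)" if "monomial_degree a = t" for a
  proof -
    have "a \<in> set ms"
      using that ms(2) by simp
    from spans_mod_if_coefficient_matrix_det_nonzero[OF ms(1) this keys_r det]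
    obtain c where c: "monomial_poly a = (\<Sum>i<?n. const (c i) * r i)"
      by (auto simp: spans_mod_def)
    show ?thesis
      unfolding c
      by (intro mpoly_module.span_sum mpoly_module.span_scale mpoly_module.span_base r_in) simp
  qed
  then show ?thesis
    using that s(1) by blast
qed

section \<open>The quotient algebra\<close>

lemma ideal_mpoly_ring_iff: "ideal J (mpoly_ring :: ('n, 'k::comm_ring_1) mpoly ring) \<longleftrightarrow> ring_ideal J"
proof
  assume "ideal J (mpoly_ring :: ('n, 'k) mpoly ring)"
  then interpret ideal J "mpoly_ring :: ('n, 'k) mpoly ring" .
  show "ring_ideal J"
    using additive_subgroup.zero_closed[OF is_additive_subgroup] additive_subgroup.a_closed[OF is_additive_subgroup] I_l_closed
    by (auto simp: ring_ideal_def ring_of_type_algebra_def)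
next
  assume J: "ring_ideal J"
  interpret ring "mpoly_ring :: ('n, 'k) mpoly ring" by (rule ring_from_type_algebra)
  have inv: "inv\<^bsub>add_monoid mpoly_ring\<^esub> x = - x" for x :: "('n, 'k) mpoly"
  proof -
    have "\<ominus>\<^bsub>mpoly_ring\<^esub> x = - x"
      by (rule minus_equality) (auto simp: ring_of_type_algebra_def)
    then show ?thesis
      by (simp add: a_inv_def)
  qed
  show "ideal J (mpoly_ring :: ('n, 'k) mpoly ring)"
  proof (rule idealI[OF ring_axioms])
    show "subgroup J (add_monoid mpoly_ring)"
      proof (rule subgroup.intro)
      fix x assume "x \<in> J"
      then show "inv\<^bsub>add_monoid mpoly_ring\<^esub> x \<in> J"
        unfolding inv by (rule ring_ideal_uminus[OF J])
    qed (auto simp: ring_of_type_algebra_def ring_ideal_add[OF J] ring_ideal_zero[OF J])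
  qed (auto simp: ring_of_type_algebra_def ring_ideal_mult[OF J] ring_ideal_mult_right[OF J])
qed

lemma genideal_mpoly_ring:
  fixes H :: "('n, 'k::comm_ring_1) mpoly set"
  shows "ring_ideal (Idl\<^bsub>mpoly_ring\<^esub> H)" "H \<subseteq> Idl\<^bsub>mpoly_ring\<^esub> H"
    and "\<And>J. ring_ideal J \<Longrightarrow> H \<subseteq> J \<Longrightarrow> Idl\<^bsub>mpoly_ring\<^esub> H \<subseteq> J"
proof -
  interpret ring "mpoly_ring :: ('n, 'k) mpoly ring" by (rule ring_from_type_algebra)
  have H: "H \<subseteq> carrier mpoly_ring"
    by (simp add: ring_of_type_algebra_def)
  show "ring_ideal (Idl\<^bsub>mpoly_ring\<^esub> H)"
    using genideal_ideal[OF H] by (simp add: ideal_mpoly_ring_iff)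
  show "H \<subseteq> Idl\<^bsub>mpoly_ring\<^esub> H"
    by (rule genideal_self[OF H])
  show "Idl\<^bsub>mpoly_ring\<^esub> H \<subseteq> J" if "ring_ideal J" "H \<subseteq> J" for J
    using genideal_minimal[of J H] that by (simp add: ideal_mpoly_ring_iff)
qed

section \<open>Graded ideals and ideals with adjoined forms\<close>

definition graded :: "('n, 'k::comm_ring_1) mpoly set \<Rightarrow> bool"
  where "graded J \<longleftrightarrow> (\<forall>f\<in>J. \<forall>t. hcomp t f \<in> J)"

lemma gradedD: "graded J \<Longrightarrow> f \<in> J \<Longrightarrow> hcomp t f \<in> J"
  by (simp add: graded_def)

lemma ring_ideal_mpolyI:
  assumes "0 \<in> J" "\<And>x y. x \<in> J \<Longrightarrow> y \<in> J \<Longrightarrow> x + y \<in> J"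
    and "\<And>b c x. x \<in> J \<Longrightarrow> Poly_Mapping.single b c * x \<in> J"
  shows "ring_ideal (J :: ('n, 'k::comm_ring_1) mpoly set)"
proof (rule ring_idealI)
  fix r x assume "x \<in> J"
  then show "r * x \<in> J"
    by (induction r rule: poly_mapping_single_induct) (auto intro: assms simp: distrib_right)
qed (auto intro: assms)

lemma hcomp_single_mult:
  "hcomp t (Poly_Mapping.single b c * f) =
    (if monomial_degree b \<le> t then Poly_Mapping.single b c * hcomp (t - monomial_degree b) f else 0)"
  for f :: "('n, 'k::comm_ring_1) mpoly"
  using hcomp_mult_homogeneous[OF homogeneous_single[OF refl], of t f b c] by (simp add: mult.commute)

text \<open>The polynomials all of whose components lie in \<open>I\<close> form an ideal, and this
  ideal contains the homogeneous generators.\<close>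

lemma homogeneous_ideal_graded:
  assumes "homogeneous_ideal I"
  shows "ring_ideal I" "graded I"
proof -
  obtain H where H: "\<And>f. f \<in> H \<Longrightarrow> \<exists>d. homogeneous d f" "I = Idl\<^bsub>mpoly_ring\<^esub> H"
    using assms unfolding homogeneous_ideal_def by blast
  show I: "ring_ideal I"
    unfolding H(2) by (rule genideal_mpoly_ring(1))
  let ?J = "{f. \<forall>t. hcomp t f \<in> I}"
  have "ring_ideal ?J"
    by (rule ring_ideal_mpolyI)
      (auto simp: part_add hcomp_single_mult ring_ideal_zero[OF I] intro: ring_ideal_add[OF I] ring_ideal_mult[OF I])
  moreover have "H \<subseteq> ?J"
  proof
    fix f assume f: "f \<in> H"
    then obtain d where "homogeneous d f"
      using H(1) by blast
    moreover have "f \<in> I"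
      using f genideal_mpoly_ring(2)[of H] H(2) by blast
    ultimately show "f \<in> ?J"
      using ring_ideal_zero[OF I] by (auto simp: hcomp_homogeneous)
  qed
  ultimately have "I \<subseteq> ?J"
    unfolding H(2) by (rule genideal_mpoly_ring(3))
  then show "graded I"
    by (auto simp: graded_def)
qed

text \<open>The ideal I + (w_0, ..., w_(d-1)), written with explicit coefficients so that
  homogeneous components of these coefficients can be taken.\<close>

definition ideal_adjoin ::
    "('n, 'k::comm_ring_1) mpoly set \<Rightarrow> (nat \<Rightarrow> ('n, 'k) mpoly) \<Rightarrow> nat \<Rightarrow> ('n, 'k) mpoly set"
  where "ideal_adjoin I w d = {f. \<exists>g. f - (\<Sum>i<d. g i * w i) \<in> I}"

lemma ring_ideal_adjoin:
  assumes I: "ring_ideal I"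
  shows "ring_ideal (ideal_adjoin I w d)"
proof (rule ring_idealI)
  show "0 \<in> ideal_adjoin I w d"
    unfolding ideal_adjoin_def using ring_ideal_zero[OF I] by (auto intro!: exI[of _ "\<lambda>_. 0"])
next
  fix x y assume "x \<in> ideal_adjoin I w d" "y \<in> ideal_adjoin I w d"
  then obtain g h where "x - (\<Sum>i<d. g i * w i) \<in> I" "y - (\<Sum>i<d. h i * w i) \<in> I"
    by (auto simp: ideal_adjoin_def)
  from ring_ideal_add[OF I this] have "x + y - (\<Sum>i<d. (g i + h i) * w i) \<in> I"
    by (simp add: algebra_simps sum.distrib)
  then show "x + y \<in> ideal_adjoin I w d"
    unfolding ideal_adjoin_def by (intro CollectI exI[of _ "\<lambda>i. g i + h i"])
next
  fix r x assume "x \<in> ideal_adjoin I w d"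
  then obtain g where "x - (\<Sum>i<d. g i * w i) \<in> I"
    by (auto simp: ideal_adjoin_def)
  from ring_ideal_mult[OF I this, of r] have "r * x - (\<Sum>i<d. (r * g i) * w i) \<in> I"
    by (simp add: right_diff_distrib sum_distrib_left mult.assoc)
  then show "r * x \<in> ideal_adjoin I w d"
    unfolding ideal_adjoin_def by (intro CollectI exI[of _ "\<lambda>i. r * g i"])
qed

lemma ideal_adjoin_subset: "ring_ideal I \<Longrightarrow> f \<in> I \<Longrightarrow> f \<in> ideal_adjoin I w d"
  unfolding ideal_adjoin_def by (intro CollectI exI[of _ "\<lambda>_. 0"]) simp

lemma ideal_adjoin_form:
  assumes "ring_ideal I" "i < d"
  shows "w i \<in> ideal_adjoin I w d"
proof -
  have "(\<Sum>j<d. (if j = i then 1 else 0) * w j) = w i"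
    using assms(2) by (subst sum.remove[of _ i]) auto
  then show ?thesis
    unfolding ideal_adjoin_def using ring_ideal_zero[OF assms(1)]
    by (intro CollectI exI[of _ "\<lambda>j. if j = i then 1 else 0"]) simp
qed

lemma ideal_adjoin_minimal:
  assumes "ring_ideal J" "I \<subseteq> J" "\<And>i. i < d \<Longrightarrow> w i \<in> J"
  shows "ideal_adjoin I w d \<subseteq> J"
proof
  fix f assume "f \<in> ideal_adjoin I w d"
  then obtain g where "f - (\<Sum>i<d. g i * w i) \<in> I"
    by (auto simp: ideal_adjoin_def)
  moreover have "(\<Sum>i<d. g i * w i) \<in> J"
    using assms by (intro ring_ideal_sum ring_ideal_mult) auto
  ultimately show "f \<in> J"
    using assms(1,2) ring_ideal_mem_cong by blast
qed

lemma hcomp_linear_combination: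
  assumes "\<And>i. homogeneous 1 (w i)"
  shows "hcomp (Suc t) (f - (\<Sum>i<d. g i * w i)) = hcomp (Suc t) f - (\<Sum>i<d. hcomp t (g i) * w i :: ('n, 'k::comm_ring_1) mpoly)"
  by (simp add: part_diff part_sum hcomp_mult_homogeneous[OF assms])

section \<open>The quotient algebra through polynomial representatives\<close>

locale quotient =
  fixes I :: "('n, 'k::field) mpoly set"
  assumes I: "ring_ideal I"
begin

definition \<pi> :: "('n, 'k) mpoly \<Rightarrow> ('n, 'k) mpoly set"
  where "\<pi> f = I +>\<^bsub>mpoly_ring\<^esub> f"

abbreviation A :: "('k, ('n, 'k) mpoly set) graded_algebra"
  where "A \<equiv> quotient_algebra I"

lemma \<pi>_eq_image: "\<pi> f = (\<lambda>h. h + f) ` I"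
  by (auto simp: \<pi>_def a_r_coset_def' ring_of_type_algebra_def)

lemma \<pi>_eq_iff: "\<pi> f = \<pi> g \<longleftrightarrow> f - g \<in> I"
proof
  assume "\<pi> f = \<pi> g"
  moreover have "f \<in> \<pi> f"
    unfolding \<pi>_eq_image using ring_ideal_zero[OF I] by force
  ultimately show "f - g \<in> I"
    by (auto simp: \<pi>_eq_image)
next
  have sub: "\<pi> f \<subseteq> \<pi> g" if "f - g \<in> I" for f g
  proof
    fix x assume "x \<in> \<pi> f"
    then obtain h where h: "h \<in> I" "x = h + f"
      by (auto simp: \<pi>_eq_image)
    then have "x = (h + (f - g)) + g" "h + (f - g) \<in> I"
      using ring_ideal_add[OF I _ that] by auto
    then show "x \<in> \<pi> g"
      unfolding \<pi>_eq_image by blast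
  qed
  assume "f - g \<in> I"
  then show "\<pi> f = \<pi> g"
    using sub[of f g] sub[of g f] ring_ideal_diff_sym[OF I] by blast
qed

lemma ideal_I: "ideal I mpoly_ring"
  by (simp add: ideal_mpoly_ring_iff I)

lemma mult_mpoly_ring: "x \<otimes>\<^bsub>mpoly_ring\<^esub> y = x * y" for x y :: "('n, 'k) mpoly"
  by (simp add: ring_of_type_algebra_def)

lemma add_mpoly_ring: "x \<oplus>\<^bsub>mpoly_ring\<^esub> y = x + y" for x y :: "('n, 'k) mpoly"
  by (simp add: ring_of_type_algebra_def)

lemma carrier_mpoly_ring: "carrier (mpoly_ring :: ('n, 'k) mpoly ring) = UNIV"
  by (simp add: ring_of_type_algebra_def)

lemma carrier_A: "carrier A = range \<pi>"
  by (auto simp: quotient_algebra_def FactRing_def A_RCOSETS_def' \<pi>_def a_r_coset_def' carrier_mpoly_ring)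

lemma \<pi>_carrier [simp]: "\<pi> f \<in> carrier A"
  by (simp add: carrier_A)

lemma zero_A: "\<zero>\<^bsub>A\<^esub> = \<pi> 0"
  by (simp add: quotient_algebra_def FactRing_def \<pi>_eq_image)

lemma one_A: "\<one>\<^bsub>A\<^esub> = \<pi> 1"
  by (simp add: quotient_algebra_def FactRing_def \<pi>_def ring_of_type_algebra_def)

lemma mult_A: "\<pi> f \<otimes>\<^bsub>A\<^esub> \<pi> g = \<pi> (f * g)"
  using ideal.rcoset_mult_add[OF ideal_I, of f g]
  by (simp add: quotient_algebra_def FactRing_def \<pi>_def mult_mpoly_ring carrier_mpoly_ring)

lemma add_A: "\<pi> f \<oplus>\<^bsub>A\<^esub> \<pi> g = \<pi> (f + g)"
  using abelian_subgroup.a_rcos_sum[OF abelian_subgroupI3, of I mpoly_ring f g]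
    ideal.axioms(1)[OF ideal_I] ring.is_abelian_group[OF ring_from_type_algebra]
  by (auto simp: quotient_algebra_def FactRing_def \<pi>_def add_mpoly_ring carrier_mpoly_ring)

lemma smult_A: "c \<odot>\<^bsub>A\<^esub> \<pi> f = \<pi> (const c * f)"
  using mult_A[of "const c" f] by (simp add: quotient_algebra_def Let_def \<pi>_def)

lemma component_A: "component A t = \<pi> ` {f. homogeneous t f}"
  by (auto simp: quotient_algebra_def Let_def \<pi>_def)

lemma carrier_A_E:
  assumes "x \<in> carrier A"
  obtains f where "x = \<pi> f"
  using assms by (auto simp: carrier_A)

lemma cring_A: "cring A"
proof (rule cringI)
  show "abelian_group A"
  proof (rule abelian_groupI)
    fix x assume "x \<in> carrier A"
    then obtain f where "x = \<pi> f"
      by (rule carrier_A_E)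
    then have "\<pi> (- f) \<oplus>\<^bsub>A\<^esub> x = \<zero>\<^bsub>A\<^esub>"
      by (simp add: add_A zero_A)
    then show "\<exists>y\<in>carrier A. y \<oplus>\<^bsub>A\<^esub> x = \<zero>\<^bsub>A\<^esub>"
      by (rule bexI) simp
  qed (auto simp: zero_A add_A ac_simps elim!: carrier_A_E)
  show "Group.comm_monoid A"
    by (rule comm_monoidI) (auto simp: one_A mult_A ac_simps elim!: carrier_A_E)
qed (auto simp: mult_A add_A distrib_right elim!: carrier_A_E)

lemma finsum_A: "finite F \<Longrightarrow> (\<Oplus>\<^bsub>A\<^esub>x\<in>F. \<pi> (f x)) = \<pi> (\<Sum>x\<in>F. f x)"
proof (induction F rule: finite_induct)
  case empty
  show ?case
    using abelian_monoid.finsum_empty[of A] cring_A by (simp add: zero_A cring_def ring_def abelian_group_def)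
next
  case (insert x F)
  interpret cring A by (rule cring_A)
  show ?case
    using insert by (subst finsum_insert) (auto simp: add_A)
qed

lemma nat_pow_A: "\<pi> f [^]\<^bsub>A\<^esub> (n :: nat) = \<pi> (f ^ n)"
proof -
  interpret cring A by (rule cring_A)
  show ?thesis
    by (induction n) (simp_all add: one_A mult_A mult.commute)
qed

lemma finprod_A: "finite F \<Longrightarrow> (\<Otimes>\<^bsub>A\<^esub>x\<in>F. \<pi> (f x)) = \<pi> (\<Prod>x\<in>F. f x)"
proof (induction F rule: finite_induct)
  case empty
  interpret cring A by (rule cring_A)
  show ?case
    by (simp add: one_A)
next
  case (insert x F)
  interpret cring A by (rule cring_A)
  show ?case
    using insert by (subst finprod_insert) (auto simp: mult_A)
qed

text \<open>The family \<open>w\<close> is total: beyond the length of \<open>zs\<close> it consists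
  of arbitrary linear forms, which keeps homogeneity free of index conditions.\<close>

definition lifts :: "('n, 'k) mpoly set list \<Rightarrow> (nat \<Rightarrow> ('n, 'k) mpoly) \<Rightarrow> bool"
  where "lifts zs w \<longleftrightarrow> (\<forall>i. homogeneous 1 (w i)) \<and> (\<forall>i<length zs. zs ! i = \<pi> (w i))"

lemma lifts_exists:
  assumes "set zs \<subseteq> component A 1"
  obtains w where "lifts zs w"
proof -
  have "\<forall>i. \<exists>f. homogeneous 1 f \<and> (i < length zs \<longrightarrow> zs ! i = \<pi> f)"
  proof
    fix i
    show "\<exists>f. homogeneous 1 f \<and> (i < length zs \<longrightarrow> zs ! i = \<pi> f)"
    proof (cases "i < length zs")
      case True
      then have "zs ! i \<in> component A 1"
        using assms by (metis nth_mem subsetD)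
      then show ?thesis
        by (auto simp: component_A)
    qed (auto intro: exI[of _ 0])
  qed
  then show ?thesis
    using that unfolding lifts_def by metis
qed

lemma set_lifts: "lifts zs w \<Longrightarrow> set zs = (\<lambda>i. \<pi> (w i)) ` {..<length zs}"
  by (auto simp: lifts_def set_conv_nth)

lemma eval_at_A:
  assumes "lifts zs w" "vars_in {..<length zs} p"
  shows "eval_at A zs p = \<pi> (subst w p)"
proof -
  interpret cring A by (rule cring_A)
  have "(\<Otimes>\<^bsub>A\<^esub>i\<in>Poly_Mapping.keys a. (zs ! i) [^]\<^bsub>A\<^esub> Poly_Mapping.lookup a i) = \<pi> (meval w a)"
    if a: "a \<in> Poly_Mapping.keys p" for a
  proof -
    have "(\<Otimes>\<^bsub>A\<^esub>i\<in>Poly_Mapping.keys a. (zs ! i) [^]\<^bsub>A\<^esub> Poly_Mapping.lookup a i) =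
        (\<Otimes>\<^bsub>A\<^esub>i\<in>Poly_Mapping.keys a. \<pi> (w i ^ Poly_Mapping.lookup a i))"
    proof (rule finprod_cong')
      fix i assume "i \<in> Poly_Mapping.keys a"
      then have "i < length zs"
        using a assms(2) by (auto simp: vars_in_def)
      then show "(zs ! i) [^]\<^bsub>A\<^esub> Poly_Mapping.lookup a i = \<pi> (w i ^ Poly_Mapping.lookup a i)"
        using assms(1) by (simp add: lifts_def nat_pow_A)
    qed auto
    then show ?thesis
      by (simp add: finprod_A meval_def)
  qed
  then have "eval_at A zs p =
      (\<Oplus>\<^bsub>A\<^esub>a\<in>Poly_Mapping.keys p. \<pi> (const (Poly_Mapping.lookup p a) * meval w a))"
    unfolding eval_at_def by (intro finsum_cong') (auto simp: smult_A)
  then show ?thesis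
    by (simp add: finsum_A peval_def)
qed

lemma alg_independent_A_iff:
  assumes "lifts zs w"
  shows "alg_independent A zs \<longleftrightarrow> (\<forall>p. vars_in {..<length zs} p \<and> subst w p \<in> I \<longrightarrow> p = 0)"
proof -
  have "eval_at A zs p = \<zero>\<^bsub>A\<^esub> \<longleftrightarrow> subst w p \<in> I" if "vars_in {..<length zs} p" for p
    using eval_at_A[OF assms that] by (simp add: zero_A \<pi>_eq_iff)
  then show ?thesis
    unfolding alg_independent_def vars_in_def by blast
qed

lemma generated_subalgebra_A:
  assumes "lifts zs w"
  shows "generated_subalgebra A zs = (\<lambda>p. \<pi> (subst w p)) ` {p. vars_in {..<length zs} p}" (is "_ = ?B")
proof
  interpret cring A by (rule cring_A)
  interpret c: comm_ring_hom "const :: 'k \<Rightarrow> ('n, 'k) mpoly" by (rule const_comm_ring_hom)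
  interpret w: comm_ring_hom "subst w" by (rule c.comm_ring_hom_peval)
  let ?H = "range (\<lambda>c. c \<odot>\<^bsub>A\<^esub> \<one>\<^bsub>A\<^esub>) \<union> set zs"
  show "generated_subalgebra A zs \<subseteq> ?B"
  proof
    fix x assume "x \<in> generated_subalgebra A zs"
    then have "x \<in> generate_ring A ?H"
      by (simp add: generated_subalgebra_def)
    then show "x \<in> ?B"
    proof (induction rule: generate_ring.induct)
      case one
      show ?case
        by (rule image_eqI[of _ _ 1]) (auto simp: one_A)
    next
      case (incl h)
      then consider c where "h = \<pi> (const c)" | i where "i < length zs" "h = \<pi> (w i)"
        unfolding set_lifts[OF assms] by (auto simp: one_A smult_A)
      then show ?case
      proof cases
        case 1
        then show ?thesis
          by (intro image_eqI[of _ _ "const c"]) auto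
      next
        case 2
        then show ?thesis
          by (intro image_eqI[of _ _ "monomial_poly (Poly_Mapping.single i 1)"])
            (auto simp: c.peval_single intro!: vars_in_single)
      qed
    next
      case (a_inv h)
      then obtain p where p: "vars_in {..<length zs} p" "h = \<pi> (subst w p)"
        by blast
      have "\<ominus>\<^bsub>A\<^esub> h = \<pi> (subst w (- p))"
        by (rule minus_equality) (auto simp: p add_A zero_A w.hom_uminus)
      then show ?case
        using vars_in_uminus[OF p(1)] by blast
    next
      case (eng_add h1 h2)
      then obtain p q where p: "vars_in {..<length zs} p" "h1 = \<pi> (subst w p)"
          and q: "vars_in {..<length zs} q" "h2 = \<pi> (subst w q)"
        by blast
      then have "h1 \<oplus>\<^bsub>A\<^esub> h2 = \<pi> (subst w (p + q))"
        by (simp add: add_A w.hom_add)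
      then show ?case
        using vars_in_add[OF p(1) q(1)] by blast
    next
      case (eng_mult h1 h2)
      then obtain p q where p: "vars_in {..<length zs} p" "h1 = \<pi> (subst w p)"
          and q: "vars_in {..<length zs} q" "h2 = \<pi> (subst w q)"
        by blast
      then have "h1 \<otimes>\<^bsub>A\<^esub> h2 = \<pi> (subst w (p * q))"
        by (simp add: mult_A w.hom_mult)
      then show ?case
        using vars_in_mult[OF p(1) q(1)] by blast
    qed
  qed
  have H: "\<pi> (const c) \<in> generate_ring A ?H" for c
    by (rule generate_ring.incl) (auto simp: one_A smult_A intro!: image_eqI[of _ _ c])
  have pow: "x [^]\<^bsub>A\<^esub> (n :: nat) \<in> generate_ring A ?H" if "x \<in> generate_ring A ?H" for x n
    by (induction n) (auto intro: generate_ring.intros that)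
  have one: "\<pi> 1 \<in> generate_ring A ?H"
    unfolding one_A[symmetric] by (rule generate_ring.one)
  have meval: "\<pi> (meval w a) \<in> generate_ring A ?H" if "Poly_Mapping.keys a \<subseteq> {..<length zs}" for a
  proof -
    have "\<pi> (\<Prod>i\<in>T. w i ^ Poly_Mapping.lookup a i) \<in> generate_ring A ?H" if "finite T" "T \<subseteq> {..<length zs}" for T
      using that
    proof (induction T rule: finite_induct)
      case empty
      show ?case
        using one by simp
    next
      case (insert i T)
      have "\<pi> (w i) \<in> generate_ring A ?H"
        by (rule generate_ring.incl) (use insert.prems set_lifts[OF assms] in auto)
      then show ?case
        using generate_ring.eng_mult[OF pow insert.IH, of "\<pi> (w i)"] insert by (simp add: nat_pow_A mult_A)
    qed
    then show ?thesis
      using that by (simp add: meval_def)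
  qed
  have "\<pi> (\<Sum>a\<in>T. const (Poly_Mapping.lookup p a) * meval w a) \<in> generate_ring A ?H"
    if "finite T" "T \<subseteq> Poly_Mapping.keys p" "vars_in {..<length zs} p" for T p
    using that
  proof (induction T rule: finite_induct)
    case empty
    show ?case
      using H[of 0] by simp
  next
    case (insert a T)
    then have "Poly_Mapping.keys a \<subseteq> {..<length zs}"
      by (auto simp: vars_in_def)
    from generate_ring.eng_mult[OF H meval[OF this], of "Poly_Mapping.lookup p a"]
    show ?case
      using generate_ring.eng_add insert by (fastforce simp: mult_A add_A[symmetric])
  qed
  then show "?B \<subseteq> generated_subalgebra A zs"
    unfolding generated_subalgebra_def by (auto simp: peval_def)
qed

lemma \<pi>_mem_image_iff:
  assumes "ring_ideal P" "I \<subseteq> P"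
  shows "\<pi> f \<in> \<pi> ` P \<longleftrightarrow> f \<in> P"
proof
  assume "\<pi> f \<in> \<pi> ` P"
  then obtain g where g: "g \<in> P" "f - g \<in> I"
    by (auto simp: \<pi>_eq_iff)
  then have "f - g \<in> P"
    using assms(2) by blast
  then show "f \<in> P"
    using g(1) by (rule ring_ideal_mem_cong[OF assms(1)])
qed blast

lemma ideal_A_image:
  assumes K: "ring_ideal K"
  shows "ideal (\<pi> ` K) A"
proof -
  interpret cring A by (rule cring_A)
  have inv: "inv\<^bsub>add_monoid A\<^esub> \<pi> f = \<pi> (- f)" for f
  proof -
    have "\<ominus>\<^bsub>A\<^esub> \<pi> f = \<pi> (- f)"
      by (rule minus_equality) (auto simp: add_A zero_A)
    then show ?thesis
      by (simp add: a_inv_def)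
  qed
  show ?thesis
  proof (rule idealI)
    show "subgroup (\<pi> ` K) (add_monoid A)"
    proof (rule subgroup.intro)
      fix x assume "x \<in> \<pi> ` K"
      then obtain f where f: "f \<in> K" "x = \<pi> f"
        by blast
      show "inv\<^bsub>add_monoid A\<^esub> x \<in> \<pi> ` K"
        unfolding f(2) inv by (intro imageI ring_ideal_uminus[OF K] f(1))
    qed (auto simp: add_A zero_A intro!: imageI ring_ideal_add[OF K] ring_ideal_zero[OF K])
  next
    fix a x assume "a \<in> \<pi> ` K" "x \<in> carrier A"
    then obtain f g where fg: "g \<in> K" "a = \<pi> g" "x = \<pi> f"
      by (auto elim!: carrier_A_E)
    show "x \<otimes>\<^bsub>A\<^esub> a \<in> \<pi> ` K" "a \<otimes>\<^bsub>A\<^esub> x \<in> \<pi> ` K"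
      unfolding fg mult_A by (intro imageI ring_ideal_mult[OF K] ring_ideal_mult_right[OF K] fg)+
  qed (rule ring_axioms)
qed

lemma genideal_A:
  assumes "lifts zs w"
  shows "\<pi> f \<in> Idl\<^bsub>A\<^esub> (set zs) \<longleftrightarrow> f \<in> ideal_adjoin I w (length zs)"
proof
  interpret cring A by (rule cring_A)
  let ?K = "ideal_adjoin I w (length zs)"
  have zs: "set zs \<subseteq> carrier A"
    by (auto simp: set_lifts[OF assms])
  have K: "ring_ideal ?K"
    by (rule ring_ideal_adjoin[OF I])
  have "ideal (\<pi> ` ?K) A"
    by (rule ideal_A_image[OF K])
  moreover have "set zs \<subseteq> \<pi> ` ?K"
    using ideal_adjoin_form[OF I] by (auto simp: set_lifts[OF assms])
  ultimately have "Idl\<^bsub>A\<^esub> (set zs) \<subseteq> \<pi> ` ?K"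
    by (rule genideal_minimal)
  then show "f \<in> ?K" if "\<pi> f \<in> Idl\<^bsub>A\<^esub> (set zs)"
    using that \<pi>_mem_image_iff[OF K] ideal_adjoin_subset[OF I] by blast
  interpret Q: ideal "Idl\<^bsub>A\<^esub> (set zs)" A
    by (rule genideal_ideal[OF zs])
  \<comment> \<open>The preimage of the generated ideal is an ideal of k[X] containing
    \<open>I\<close> and the forms \<open>w i\<close>, hence contains the ideal they
    generate.\<close>
  let ?J = "{f. \<pi> f \<in> Idl\<^bsub>A\<^esub> (set zs)}"
  have "ring_ideal ?J"
  proof (rule ring_idealI)
    show "0 \<in> ?J"
      using Q.zero_closed by (simp add: zero_A)
    show "x + y \<in> ?J" if "x \<in> ?J" "y \<in> ?J" for x y
      using Q.a_closed that by (simp add: add_A[symmetric])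
    show "r * x \<in> ?J" if "x \<in> ?J" for r x
      using Q.I_l_closed[of "\<pi> x" "\<pi> r"] that by (simp add: mult_A)
  qed
  moreover have "I \<subseteq> ?J"
  proof
    fix h assume "h \<in> I"
    then have "\<pi> h = \<zero>\<^bsub>A\<^esub>"
      by (simp add: zero_A \<pi>_eq_iff)
    then show "h \<in> ?J"
      using Q.zero_closed by simp
  qed
  moreover have "w i \<in> ?J" if "i < length zs" for i
    using that genideal_self[OF zs] set_lifts[OF assms] by auto
  ultimately have "?K \<subseteq> ?J"
    by (rule ideal_adjoin_minimal)
  then show "\<pi> f \<in> Idl\<^bsub>A\<^esub> (set zs)" if "f \<in> ?K"
    using that by blast
qed

text \<open>The preimage in k[X] of the span of \<open>S\<close> as a module over k[z]. The map
  \<open>r\<close> chooses the representatives, so that homogeneous ones can be used where degrees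
  matter.\<close>

definition lspan :: "(nat \<Rightarrow> ('n, 'k) mpoly) \<Rightarrow> nat \<Rightarrow> ('s \<Rightarrow> ('n, 'k) mpoly) \<Rightarrow> 's set \<Rightarrow> ('n, 'k) mpoly set"
  where "lspan w d r S = {f. \<exists>F c. finite F \<and> F \<subseteq> S \<and> (\<forall>s\<in>F. vars_in {..<d} (c s)) \<and>
    f - (\<Sum>s\<in>F. subst w (c s) * r s) \<in> I}"

lemma module_span_A:
  assumes "lifts zs w" "\<And>s. s \<in> S \<Longrightarrow> \<pi> (r s) = s"
  shows "\<pi> f \<in> module_span A (generated_subalgebra A zs) S \<longleftrightarrow> f \<in> lspan w (length zs) r S"
proof
  interpret cring A by (rule cring_A)
  let ?B = "generated_subalgebra A zs"
  assume "\<pi> f \<in> module_span A ?B S"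
  then obtain F c where F: "finite F" "F \<subseteq> S" "c \<in> F \<rightarrow> ?B" "\<pi> f = (\<Oplus>\<^bsub>A\<^esub>s\<in>F. c s \<otimes>\<^bsub>A\<^esub> s)"
    unfolding module_span_def by blast
  have "\<forall>s\<in>F. \<exists>p. vars_in {..<length zs} p \<and> c s = \<pi> (subst w p)"
    using F(3) unfolding generated_subalgebra_A[OF assms(1)] by auto
  then obtain p where p: "\<And>s. s \<in> F \<Longrightarrow> vars_in {..<length zs} (p s)" "\<And>s. s \<in> F \<Longrightarrow> c s = \<pi> (subst w (p s))"
    by metis
  have "\<pi> f = (\<Oplus>\<^bsub>A\<^esub>s\<in>F. \<pi> (subst w (p s) * r s))"
    unfolding F(4)
  proof (rule finsum_cong')
    fix s assume s: "s \<in> F"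
    then have "\<pi> (r s) = s"
      using F(2) assms(2) by blast
    then show "c s \<otimes>\<^bsub>A\<^esub> s = \<pi> (subst w (p s) * r s)"
      using p(2)[OF s] by (metis mult_A)
  qed auto
  then have "f - (\<Sum>s\<in>F. subst w (p s) * r s) \<in> I"
    using F(1) by (simp add: finsum_A \<pi>_eq_iff)
  then show "f \<in> lspan w (length zs) r S"
    unfolding lspan_def using F(1,2) p(1) by (intro CollectI exI[of _ F] exI[of _ p]) simp
next
  interpret cring A by (rule cring_A)
  let ?B = "generated_subalgebra A zs"
  assume "f \<in> lspan w (length zs) r S"
  then obtain F c where F: "finite F" "F \<subseteq> S" "\<And>s. s \<in> F \<Longrightarrow> vars_in {..<length zs} (c s)"
    "f - (\<Sum>s\<in>F. subst w (c s) * r s) \<in> I"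
    unfolding lspan_def by blast
  have "\<pi> f = (\<Oplus>\<^bsub>A\<^esub>s\<in>F. \<pi> (subst w (c s) * r s))"
    using F by (simp add: finsum_A \<pi>_eq_iff)
  also have "\<dots> = (\<Oplus>\<^bsub>A\<^esub>s\<in>F. \<pi> (subst w (c s)) \<otimes>\<^bsub>A\<^esub> s)"
  proof (rule finsum_cong')
    fix s assume "s \<in> F"
    then have "\<pi> (r s) = s"
      using F(2) assms(2) by blast
    then show "\<pi> (subst w (c s) * r s) = \<pi> (subst w (c s)) \<otimes>\<^bsub>A\<^esub> s"
      by (metis mult_A)
  next
    show "(\<lambda>s. \<pi> (subst w (c s)) \<otimes>\<^bsub>A\<^esub> s) \<in> F \<rightarrow> carrier A"
    proof (rule Pi_I)
      fix s assume "s \<in> F"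
      then have "\<pi> (r s) = s"
        using F(2) assms(2) by blast
      then have "s \<in> carrier A"
        by (metis \<pi>_carrier)
      then show "\<pi> (subst w (c s)) \<otimes>\<^bsub>A\<^esub> s \<in> carrier A"
        by simp
    qed
  qed auto
  moreover have "(\<lambda>s. \<pi> (subst w (c s))) \<in> F \<rightarrow> ?B"
    using F(3) unfolding generated_subalgebra_A[OF assms(1)] by auto
  ultimately show "\<pi> f \<in> module_span A ?B S"
    unfolding module_span_def using F(1,2) by (intro CollectI exI[of _ F] exI[of _ "\<lambda>s. \<pi> (subst w (c s))"]) simp
qed

lemma module_span_A_eq_carrier:
  assumes "lifts zs w" "\<And>s. s \<in> S \<Longrightarrow> \<pi> (r s) = s"
  shows "module_span A (generated_subalgebra A zs) S = carrier A \<longleftrightarrow> lspan w (length zs) r S = UNIV"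
proof
  assume "module_span A (generated_subalgebra A zs) S = carrier A"
  then show "lspan w (length zs) r S = UNIV"
    using module_span_A[of zs w S r, OF assms] by auto
next
  interpret cring A by (rule cring_A)
  assume *: "lspan w (length zs) r S = UNIV"
  have "module_span A (generated_subalgebra A zs) S \<subseteq> carrier A"
  proof
    fix x assume "x \<in> module_span A (generated_subalgebra A zs) S"
    then obtain F c where F: "F \<subseteq> S" "c \<in> F \<rightarrow> generated_subalgebra A zs" "x = (\<Oplus>\<^bsub>A\<^esub>s\<in>F. c s \<otimes>\<^bsub>A\<^esub> s)"
      unfolding module_span_def by blast
    have "s \<in> carrier A" if "s \<in> S" for s
      using assms(2)[OF that] \<pi>_carrier by metis
    moreover have "c s \<in> carrier A" if "s \<in> F" for s
      using funcset_mem[OF F(2) that] unfolding generated_subalgebra_A[OF assms(1)] by auto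
    ultimately show "x \<in> carrier A"
      unfolding F(3) using F(1) by (intro finsum_closed) auto
  qed
  then show "module_span A (generated_subalgebra A zs) S = carrier A"
    using module_span_A[of zs w S r, OF assms] * by (auto elim!: carrier_A_E)
qed

end

section \<open>Reduction numbers in terms of degrees\<close>

context quotient
begin

lemma subst_zero: "subst w 0 = (0 :: ('n, 'k) mpoly)"
  by (simp add: peval_def)

lemma subst_one: "subst w 1 = (1 :: ('n, 'k) mpoly)"
  by (simp add: peval_def)

lemma lspan_I: "f \<in> I \<Longrightarrow> f \<in> lspan w d r S"
  unfolding lspan_def by (intro CollectI exI[of _ "{}"]) simp

lemma lspan_generator:
  assumes "s \<in> S" "vars_in {..<d} p"
  shows "subst w p * r s \<in> lspan w d r S"
  unfolding lspan_def using assms ring_ideal_zero[OF I]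
  by (intro CollectI exI[of _ "{s}"] exI[of _ "\<lambda>_. p"]) simp

lemma lspan_cong: "f - f' \<in> I \<Longrightarrow> f' \<in> lspan w d r S \<Longrightarrow> f \<in> lspan w d r S"
  unfolding lspan_def using ring_ideal_diff_trans[OF I] by blast

lemma lspan_add:
  assumes "f \<in> lspan w d r S" "g \<in> lspan w d r S"
  shows "f + g \<in> lspan w d r S"
proof -
  interpret c: comm_ring_hom "const :: 'k \<Rightarrow> ('n, 'k) mpoly" by (rule const_comm_ring_hom)
  interpret w: comm_ring_hom "subst w" by (rule c.comm_ring_hom_peval)
  obtain F c where F: "finite F" "F \<subseteq> S" "\<And>s. s \<in> F \<Longrightarrow> vars_in {..<d} (c s)"
    "f - (\<Sum>s\<in>F. subst w (c s) * r s) \<in> I"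
    using assms(1) unfolding lspan_def by blast
  obtain G e where G: "finite G" "G \<subseteq> S" "\<And>s. s \<in> G \<Longrightarrow> vars_in {..<d} (e s)"
    "g - (\<Sum>s\<in>G. subst w (e s) * r s) \<in> I"
    using assms(2) unfolding lspan_def by blast
  define c' where "c' s = (if s \<in> F then c s else 0)" for s
  define e' where "e' s = (if s \<in> G then e s else 0)" for s
  have c': "(\<Sum>s\<in>F. subst w (c s) * r s) = (\<Sum>s\<in>F \<union> G. subst w (c' s) * r s)"
    using F(1) G(1) by (intro sum.mono_neutral_cong_left) (auto simp: c'_def)
  have e': "(\<Sum>s\<in>G. subst w (e s) * r s) = (\<Sum>s\<in>F \<union> G. subst w (e' s) * r s)"
    using F(1) G(1) by (intro sum.mono_neutral_cong_left) (auto simp: e'_def)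
  have "f + g - (\<Sum>s\<in>F \<union> G. subst w (c' s + e' s) * r s) \<in> I"
    using ring_ideal_add[OF I F(4) G(4)] unfolding c' e'
    by (simp add: w.hom_add distrib_right sum.distrib algebra_simps)
  moreover have "vars_in {..<d} (c' s + e' s)" for s
    using F(3) G(3) by (auto simp: c'_def e'_def intro: vars_in_add)
  ultimately show ?thesis
    unfolding lspan_def using F(1,2) G(1,2)
    by (intro CollectI exI[of _ "F \<union> G"] exI[of _ "\<lambda>s. c' s + e' s"]) simp
qed

lemma lspan_mult:
  assumes "f \<in> lspan w d r S" "vars_in {..<d} p"
  shows "subst w p * f \<in> lspan w d r S"
proof -
  interpret c: comm_ring_hom "const :: 'k \<Rightarrow> ('n, 'k) mpoly" by (rule const_comm_ring_hom)
  interpret w: comm_ring_hom "subst w" by (rule c.comm_ring_hom_peval)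
  obtain F c where F: "finite F" "F \<subseteq> S" "\<And>s. s \<in> F \<Longrightarrow> vars_in {..<d} (c s)"
    "f - (\<Sum>s\<in>F. subst w (c s) * r s) \<in> I"
    using assms(1) unfolding lspan_def by blast
  have "subst w p * f - (\<Sum>s\<in>F. subst w (p * c s) * r s) \<in> I"
    using ring_ideal_mult[OF I F(4), of "subst w p"]
    by (simp add: right_diff_distrib sum_distrib_left w.hom_mult mult.assoc)
  then show ?thesis
    unfolding lspan_def using F assms(2)
    by (intro CollectI exI[of _ F] exI[of _ "\<lambda>s. p * c s"]) (simp add: vars_in_mult)
qed

lemma lspan_zero: "0 \<in> lspan w d r S"
  by (rule lspan_I) (rule ring_ideal_zero[OF I])

lemma lspan_sum: "(\<And>x. x \<in> X' \<Longrightarrow> f x \<in> lspan w d r S) \<Longrightarrow> (\<Sum>x\<in>X'. f x) \<in> lspan w d r S"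
  by (induction X' rule: infinite_finite_induct) (auto intro: lspan_add lspan_zero)

lemma lspan_subset:
  assumes "\<And>s. s \<in> T \<Longrightarrow> r' s \<in> lspan w d r S"
  shows "lspan w d r' T \<subseteq> lspan w d r S"
proof
  fix f assume "f \<in> lspan w d r' T"
  then obtain F c where F: "finite F" "F \<subseteq> T" "\<And>s. s \<in> F \<Longrightarrow> vars_in {..<d} (c s)"
    "f - (\<Sum>s\<in>F. subst w (c s) * r' s) \<in> I"
    unfolding lspan_def by blast
  have "(\<Sum>s\<in>F. subst w (c s) * r' s) \<in> lspan w d r S"
    using F assms by (intro lspan_sum lspan_mult) auto
  then show "f \<in> lspan w d r S"
    by (rule lspan_cong[OF F(4)])
qed

text \<open>A monomial of positive degree has some \<open>w i\<close> with \<open>i < d\<close> as a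
  factor after substitution.\<close>

lemma subst_hcomp_Suc_mem:
  assumes "vars_in {..<d} p"
  shows "subst w (hcomp (Suc t) p) \<in> ideal_adjoin I w d"
proof -
  let ?K = "ideal_adjoin I w d"
  have K: "ring_ideal ?K"
    by (rule ring_ideal_adjoin[OF I])
  have "meval w a \<in> ?K" if a: "a \<in> Poly_Mapping.keys (hcomp (Suc t) p)" for a
  proof -
    have "monomial_degree a = Suc t" "a \<in> Poly_Mapping.keys p"
      using a by (auto simp: keys_part)
    then obtain i where i: "i \<in> Poly_Mapping.keys a" "i < d"
      using assms monomial_degree_eq_0_iff[of a] unfolding vars_in_def
      by (metis in_keys_iff lessThan_iff lookup_zero nat.distinct(1) poly_mapping_eqI subsetD)
    obtain b where b: "a = Poly_Mapping.single i 1 + b"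
      using i(1) by (rule monomial_minus_single)
    show ?thesis
      using ideal_adjoin_form[OF I i(2), of w] unfolding b meval_add
      by (simp add: ring_ideal_mult_right[OF K])
  qed
  then show ?thesis
    unfolding peval_def by (intro ring_ideal_sum[OF K] ring_ideal_mult[OF K])
qed

text \<open>The component of degree \<open>e\<close> of the given relation. Generators of degree
  above \<open>e\<close> contribute nothing; the explicit 0 is essential, because the truncated
  difference \<open>e - dg s\<close> would select the constant term.\<close>

lemma homogeneous_generators_degree:
  assumes hom: "homogeneous e f" and w: "\<And>i. homogeneous 1 (w i)" and I': "graded I"
    and F: "f - (\<Sum>s\<in>F. subst w (c s) * r s) \<in> I" and r: "\<And>s. s \<in> F \<Longrightarrow> homogeneous (dg s) (r s)"
  shows "f - (\<Sum>s\<in>F. subst w (if dg s \<le> e then hcomp (e - dg s) (c s) else 0) * r s) \<in> I"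
proof -
  have "hcomp e (subst w (c s) * r s) = subst w (if dg s \<le> e then hcomp (e - dg s) (c s) else 0) * r s"
    if "s \<in> F" for s
    using r[OF that] by (simp add: hcomp_mult_homogeneous hcomp_subst[OF w] subst_zero)
  then show ?thesis
    using gradedD[OF I' F, of e] hom by (simp add: part_diff part_sum hcomp_homogeneous)
qed

text \<open>The homogeneous components of representatives of \<open>S\<close> still generate, and a
  generating subset of least cardinality is minimal under inclusion.\<close>

lemma minimal_homogeneous_generators_exists:
  assumes zs: "lifts zs w" and "finite S" "S \<subseteq> carrier A"
    and span: "module_span A (generated_subalgebra A zs) S = carrier A"
  obtains T where "finite T" "minimal_homogeneous_generators A (generated_subalgebra A zs) T"
proof -
  let ?B = "generated_subalgebra A zs"
  define r where "r x = (SOME f. \<pi> f = x)" for x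
  have r: "\<pi> (r x) = x" if "x \<in> carrier A" for x
    unfolding r_def by (rule someI_ex) (use that in \<open>auto simp: carrier_A\<close>)
  have "\<exists>t. \<forall>x\<in>S. deg_le t (r x)"
  proof -
    have "\<forall>x. \<exists>t. deg_le t (r x)"
      using deg_le_exists by blast
    then obtain t where t: "\<And>x. deg_le (t x) (r x)"
      by metis
    have "\<forall>x\<in>S. deg_le (Max (t ` S)) (r x)"
      using \<open>finite S\<close> by (intro ballI deg_le_mono[OF t Max_ge]) auto
    then show ?thesis ..
  qed
  then obtain t where t: "\<And>x. x \<in> S \<Longrightarrow> deg_le t (r x)"
    by blast
  define S' where "S' = (\<lambda>(x, s). \<pi> (hcomp s (r x))) ` (S \<times> {..t})"
  have "\<pi> (hcomp s f) \<in> component A s" for s f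
    unfolding component_A by (intro imageI) simp
  then have S': "finite S'" "S' \<subseteq> carrier A" "S' \<subseteq> (\<Union>d. component A d)"
    using \<open>finite S\<close> by (auto simp: S'_def)
  have sub_r: "\<And>s. s \<in> T \<Longrightarrow> \<pi> (r s) = s" if "T \<subseteq> carrier A" for T
    using that r by blast
  have hS': "hcomp s (r x) \<in> lspan w (length zs) r S'" if "x \<in> S" "s \<le> t" for x s
  proof -
    let ?y = "\<pi> (hcomp s (r x))"
    have "?y \<in> S'"
      using that by (auto simp: S'_def)
    then have "subst w 1 * r ?y \<in> lspan w (length zs) r S'"
      by (intro lspan_generator) auto
    moreover have "hcomp s (r x) - r ?y \<in> I"
      using r[of ?y] \<pi>_eq_iff by (metis \<pi>_carrier)
    ultimately show ?thesis
      using lspan_cong by (simp add: subst_one)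
  qed
  have "r x \<in> lspan w (length zs) r S'" if "x \<in> S" for x
    by (subst sum_hcomp[OF t[OF that]]) (use hS' that in \<open>auto intro: lspan_sum\<close>)
  then have "lspan w (length zs) r S \<subseteq> lspan w (length zs) r S'"
    by (rule lspan_subset)
  moreover have "lspan w (length zs) r S = UNIV"
    using span module_span_A_eq_carrier[OF zs sub_r[OF assms(3)]] by simp
  ultimately have "lspan w (length zs) r S' = UNIV"
    by (simp add: top.extremum_unique)
  then have "module_span A ?B S' = carrier A"
    using module_span_A_eq_carrier[OF zs sub_r[OF S'(2)]] by simp
  define spanning where "spanning T \<longleftrightarrow> T \<subseteq> S' \<and> module_span A ?B T = carrier A" for T
  have "spanning S'"
    using \<open>module_span A ?B S' = carrier A\<close> by (simp add: spanning_def)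
  from ex_has_least_nat[of spanning, OF this, of card]
  obtain T where "spanning T" and min: "\<And>T'. spanning T' \<Longrightarrow> card T \<le> card T'"
    by blast
  then have T: "T \<subseteq> S'" "module_span A ?B T = carrier A"
    by (simp_all add: spanning_def)
  have "finite T"
    using T(1) S'(1) finite_subset by blast
  moreover have "module_span A ?B T' \<noteq> carrier A" if "T' \<subset> T" for T'
  proof
    assume "module_span A ?B T' = carrier A"
    then have "card T \<le> card T'"
      using that T(1) by (intro min) (auto simp: spanning_def)
    then show False
      using psubset_card_mono[OF \<open>finite T\<close> that] by simp
  qed
  moreover have "T \<subseteq> (\<Union>d. component A d)"
    using T(1) S'(3) by (rule subset_trans)
  ultimately have "minimal_homogeneous_generators A ?B T"
    using T(2) by (simp add: minimal_homogeneous_generators_def)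
  then show ?thesis
    using that \<open>finite T\<close> by simp
qed

text \<open>All generators have degree at most \<open>r\<close>, so in degree r + 1 their
  coefficients have positive degree in the linear forms and lie in the ideal generated by
  these.\<close>

lemma monomials_mem_if_reduction_number_wrt_le:
  assumes I': "graded I" and zs: "linear_noether_system A zs" "lifts zs w"
    and le: "reduction_number_wrt A (Idl\<^bsub>A\<^esub> (set zs)) \<le> enat r"
    and a: "monomial_degree a = Suc r"
  shows "monomial_poly a \<in> ideal_adjoin I w (length zs)"
proof -
  let ?B = "generated_subalgebra A zs" and ?K = "ideal_adjoin I w (length zs)"
  have K: "ring_ideal ?K"
    by (rule ring_ideal_adjoin[OF I])
  have w: "homogeneous 1 (w i)" for i
    using zs(2) by (simp add: lifts_def)
  obtain S where S: "finite S" "minimal_homogeneous_generators A ?B S"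
    using zs(1) minimal_homogeneous_generators_exists[OF zs(2)]
    unfolding linear_noether_system_def noether_normalization_def by metis
  have "\<exists>f e. homogeneous e f \<and> \<pi> f = s \<and> e \<le> r" if s: "s \<in> S" for s
  proof -
    obtain e where e: "s \<in> component A e"
      using S(2) s unfolding minimal_homogeneous_generators_def by blast
    \<comment> \<open>A supremum over all minimal systems bounds in particular the degrees in the
      system \<open>S\<close>.\<close>
    have "enat e \<le> reduction_number_wrt A (Idl\<^bsub>A\<^esub> (set zs))"
      unfolding reduction_number_wrt_def using zs(1) S(2) s e by (intro Sup_upper CollectI) blast
    then have "e \<le> r"
      using le order_trans by fastforce
    then show ?thesis
      using e by (auto simp: component_A)
  qed
  then obtain f e where f: "\<And>s. s \<in> S \<Longrightarrow> homogeneous (e s) (f s)" "\<And>s. s \<in> S \<Longrightarrow> \<pi> (f s) = s"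
      "\<And>s. s \<in> S \<Longrightarrow> e s \<le> r"
    by metis
  have "lspan w (length zs) f S = UNIV"
    using S(2) module_span_A_eq_carrier[OF zs(2) f(2)] unfolding minimal_homogeneous_generators_def by blast
  then have "monomial_poly a \<in> lspan w (length zs) f S"
    by simp
  then obtain F c where F: "finite F" "F \<subseteq> S" "\<And>s. s \<in> F \<Longrightarrow> vars_in {..<length zs} (c s)"
      "monomial_poly a - (\<Sum>s\<in>F. subst w (c s) * f s) \<in> I"
    unfolding lspan_def by blast
  have "monomial_poly a -
      (\<Sum>s\<in>F. subst w (if e s \<le> Suc r then hcomp (Suc r - e s) (c s) else 0) * f s) \<in> I"
    using f(1) F(2) by (intro homogeneous_generators_degree[OF homogeneous_single[OF a] w I' F(4)]) blast
  then have 1: "monomial_poly a -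
      (\<Sum>s\<in>F. subst w (if e s \<le> Suc r then hcomp (Suc r - e s) (c s) else 0) * f s) \<in> ?K"
    by (rule ideal_adjoin_subset[OF I])
  have 2: "(\<Sum>s\<in>F. subst w (if e s \<le> Suc r then hcomp (Suc r - e s) (c s) else 0) * f s) \<in> ?K"
  proof (intro ring_ideal_sum[OF K] ring_ideal_mult_right[OF K])
    fix s assume s: "s \<in> F"
    then have "e s \<le> r"
      using F(2) f(3) by blast
    then show "subst w (if e s \<le> Suc r then hcomp (Suc r - e s) (c s) else 0) \<in> ?K"
      using subst_hcomp_Suc_mem[OF F(3)[OF s], of w "r - e s"] by (simp add: Suc_diff_le)
  qed
  show ?thesis
    using ring_ideal_mem_cong[OF K 1 2] .
qed

lemma homogeneous_memI:
  assumes J: "ring_ideal J" and mem: "\<And>a. monomial_degree a = t \<Longrightarrow> monomial_poly a \<in> J"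
    and f: "homogeneous s f" "t \<le> s"
  shows "f \<in> (J :: ('n, 'k) mpoly set)"
proof -
  have "Poly_Mapping.single a (Poly_Mapping.lookup f a) \<in> J" if a: "a \<in> Poly_Mapping.keys f" for a
  proof -
    obtain b c where "a = b + c" "monomial_degree b = t"
      using a f monomial_split_degree[of t a] by (auto simp: homogeneous_def)
    then show ?thesis
      using ring_ideal_mult[OF J mem[of b], of "Poly_Mapping.single c (Poly_Mapping.lookup f a)"]
      by (simp add: mult_single add.commute)
  qed
  then show ?thesis
    by (subst poly_mapping_sum_single) (rule ring_ideal_sum[OF J])
qed

lemma homogeneous_linear_combination:
  assumes I': "graded I" and w: "\<And>i. homogeneous 1 (w i)"
    and mem: "\<And>a. monomial_degree a = Suc r \<Longrightarrow> monomial_poly a \<in> ideal_adjoin I w d"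
    and f: "homogeneous (Suc t) f" "r \<le> t"
  obtains g where "\<And>i. homogeneous t (g i)" "f - (\<Sum>i<d. g i * w i) \<in> I"
proof -
  have "f \<in> ideal_adjoin I w d"
    using homogeneous_memI[OF ring_ideal_adjoin[OF I] mem f(1)] f(2) by simp
  then obtain g where "f - (\<Sum>i<d. g i * w i) \<in> I"
    by (auto simp: ideal_adjoin_def)
  from gradedD[OF I' this, of "Suc t"]
  have "f - (\<Sum>i<d. hcomp t (g i) * w i) \<in> I"
    using f(1) by (simp add: hcomp_linear_combination[OF w] hcomp_homogeneous)
  then show ?thesis
    by (intro that[of "\<lambda>i. hcomp t (g i)"]) auto
qed

text \<open>The Nakayama step. A generator of degree t + 1 > r is congruent to a combination of the
  forms \<open>w i\<close> with coefficients of degree \<open>t\<close>. Expanding these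
  coefficients in the generators never uses the generator itself, for degree reasons, so it would be
  redundant.\<close>

lemma generator_degree_le:
  assumes I': "graded I" and zs: "lifts zs w"
    and mem: "\<And>a. monomial_degree a = Suc r \<Longrightarrow> monomial_poly a \<in> ideal_adjoin I w (length zs)"
    and S: "minimal_homogeneous_generators A (generated_subalgebra A zs) S"
    and s: "s \<in> S" "s \<in> component A e"
  shows "e \<le> r"
proof (rule ccontr)
  assume "\<not> e \<le> r"
  then obtain t where t: "e = Suc t" "r \<le> t"
    by (metis Suc_le_D Suc_le_mono not_less_eq_eq)
  have w: "homogeneous 1 (w i)" for i
    using zs by (simp add: lifts_def)
  obtain f0 where f0: "homogeneous e f0" "\<pi> f0 = s"
    using s(2) by (auto simp: component_A)
  have "\<exists>f e. homogeneous e f \<and> \<pi> f = x" if x: "x \<in> S" for x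
  proof -
    have "S \<subseteq> (\<Union>d. component A d)"
      using S by (simp add: minimal_homogeneous_generators_def)
    then obtain e where "x \<in> component A e"
      using x by blast
    then show ?thesis
      by (auto simp: component_A)
  qed
  then obtain f1 e1 where f1: "\<And>x. x \<in> S \<Longrightarrow> homogeneous (e1 x) (f1 x)" "\<And>x. x \<in> S \<Longrightarrow> \<pi> (f1 x) = x"
    by metis
  \<comment> \<open>The representative of \<open>s\<close> is replaced by the one of degree
    \<open>e\<close>, so that its recorded degree is \<open>e\<close>.\<close>
  define f where "f = f1(s := f0)"
  define dg where "dg = e1(s := e)"
  have f: "homogeneous (dg x) (f x)" "\<pi> (f x) = x" if "x \<in> S" for x
    using f0 f1 that by (auto simp: f_def dg_def)
  have span: "lspan w (length zs) f S = UNIV"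
    using S module_span_A_eq_carrier[OF zs f(2)] unfolding minimal_homogeneous_generators_def by blast
  obtain g where g: "\<And>i. homogeneous t (g i)" "f0 - (\<Sum>i<length zs. g i * w i) \<in> I"
    using homogeneous_linear_combination[OF I' w mem f0(1)[unfolded t(1)] t(2)] by blast
  let ?L = "lspan w (length zs) f (S - {s})"
  have "g i \<in> ?L" for i
  proof -
    have "g i \<in> lspan w (length zs) f S"
      using span by simp
    then obtain F c where F: "finite F" "F \<subseteq> S" "\<And>x. x \<in> F \<Longrightarrow> vars_in {..<length zs} (c x)"
        "g i - (\<Sum>x\<in>F. subst w (c x) * f x) \<in> I"
      unfolding lspan_def by blast
    have "g i - (\<Sum>x\<in>F. subst w (if dg x \<le> t then hcomp (t - dg x) (c x) else 0) * f x) \<in> I"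
      using F(2) f(1) by (intro homogeneous_generators_degree[OF g(1) w I' F(4)]) blast
    moreover have "subst w (if dg x \<le> t then hcomp (t - dg x) (c x) else 0) * f x \<in> ?L" if x: "x \<in> F" for x
    proof (cases "x = s")
      case True
      \<comment> \<open>The degree Suc t of \<open>s\<close> exceeds \<open>t\<close>, so its
        coefficient is the default 0.\<close>
      then show ?thesis
        using t(1) lspan_zero by (simp add: dg_def subst_zero)
    next
      case False
      then show ?thesis
        using x F by (intro lspan_generator) (auto intro: vars_in_part)
    qed
    ultimately show ?thesis
      using lspan_cong lspan_sum by (metis (no_types, lifting))
  qed
  moreover have "w i = subst w (monomial_poly (Poly_Mapping.single i 1))" for i
    using comm_ring_hom.peval_single[OF const_comm_ring_hom, of w "Poly_Mapping.single i 1" 1] by simp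
  moreover have "vars_in {..<length zs} (monomial_poly (Poly_Mapping.single i 1) :: (nat, 'k) mpoly)" if "i < length zs" for i
    using that by (intro vars_in_single) auto
  ultimately have "g i * w i \<in> ?L" if "i < length zs" for i
    using lspan_mult that by (metis mult.commute)
  then have "f0 \<in> ?L"
    by (intro lspan_cong[OF g(2)] lspan_sum) auto
  moreover have "f x \<in> ?L" if "x \<in> S - {s}" for x
  proof -
    have "subst w 1 * f x \<in> ?L"
      using that by (intro lspan_generator) auto
    then show ?thesis
      by (simp add: subst_one)
  qed
  ultimately have "f x \<in> ?L" if "x \<in> S" for x
    using that by (cases "x = s") (auto simp: f_def)
  then have "lspan w (length zs) f S \<subseteq> ?L"
    by (rule lspan_subset)
  then have "?L = UNIV"
    using span by blast
  moreover have "\<pi> (f x) = x" if "x \<in> S - {s}" for x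
    using f(2) that by blast
  ultimately have "module_span A (generated_subalgebra A zs) (S - {s}) = carrier A"
    using module_span_A_eq_carrier[OF zs, of "S - {s}" f] by blast
  moreover have "S - {s} \<subset> S"
    using s(1) by blast
  ultimately show False
    using S unfolding minimal_homogeneous_generators_def by blast
qed

text \<open>The supremum also ranges over other systems \<open>ys\<close> of linear forms generating
  the same ideal. The membership hypothesis depends on that ideal alone and therefore passes to
  \<open>ys\<close>.\<close>

lemma reduction_number_wrt_le_if_monomials_mem:
  assumes I': "graded I" and zs: "lifts zs w"
    and mem: "\<And>a. monomial_degree a = Suc r \<Longrightarrow> monomial_poly a \<in> ideal_adjoin I w (length zs)"
  shows "reduction_number_wrt A (Idl\<^bsub>A\<^esub> (set zs)) \<le> enat r"
  unfolding reduction_number_wrt_def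
proof (rule Sup_least, clarify)
  fix e ys S s
  assume ys: "linear_noether_system A ys" "Idl\<^bsub>A\<^esub> (set zs) = Idl\<^bsub>A\<^esub> (set ys)"
    and S: "minimal_homogeneous_generators A (generated_subalgebra A ys) S" "s \<in> S" "s \<in> component A e"
  obtain v where v: "lifts ys v"
    using ys(1) lifts_exists unfolding linear_noether_system_def by blast
  have "monomial_poly a \<in> ideal_adjoin I v (length ys)" if "monomial_degree a = Suc r" for a
    using mem[OF that] ys(2) genideal_A[OF zs] genideal_A[OF v] by blast
  then show "enat e \<le> enat r"
    using generator_degree_le[OF I' v _ S] by simp
qed

text \<open>Induction on the degree: a form of degree above \<open>r\<close> is, modulo
  \<open>I\<close>, a combination of the \<open>w i\<close> with coefficients of degree one less.
  Each step raises the degree of the representing polynomials by one, which gives the bound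
  \<open>t\<close> used in counting.\<close>

lemma bounded_degree_representation:
  assumes I': "graded I" and w: "\<And>i. homogeneous 1 (w i)"
    and mem: "\<And>a. monomial_degree a = Suc r \<Longrightarrow> monomial_poly a \<in> ideal_adjoin I w d"
    and fin: "finite {a :: 'n monomial. monomial_degree a \<le> r}"
    and f: "deg_le t f"
  shows "\<exists>c. (\<forall>m. Poly_Mapping.keys (c m) \<subseteq> monomials d t) \<and>
    f - (\<Sum>m | monomial_degree m \<le> r. subst w (c m) * monomial_poly m) \<in> I"
proof -
  interpret c: comm_ring_hom "const :: 'k \<Rightarrow> ('n, 'k) mpoly" by (rule const_comm_ring_hom)
  interpret w: comm_ring_hom "subst w" by (rule c.comm_ring_hom_peval)
  let ?M = "{a :: 'n monomial. monomial_degree a \<le> r}"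
  define R where "R t f \<longleftrightarrow> (\<exists>c. (\<forall>m. Poly_Mapping.keys (c m) \<subseteq> monomials d t) \<and>
    f - (\<Sum>m\<in>?M. subst w (c m) * monomial_poly m) \<in> I)" for t f
  have R_add: "R t (f + g)" if "R t f" "R t g" for t f g
  proof -
    obtain b where b: "\<And>m. Poly_Mapping.keys (b m) \<subseteq> monomials d t" "f - (\<Sum>m\<in>?M. subst w (b m) * monomial_poly m) \<in> I"
      using \<open>R t f\<close> unfolding R_def by blast
    obtain c where c: "\<And>m. Poly_Mapping.keys (c m) \<subseteq> monomials d t" "g - (\<Sum>m\<in>?M. subst w (c m) * monomial_poly m) \<in> I"
      using \<open>R t g\<close> unfolding R_def by blast
    have "f + g - (\<Sum>m\<in>?M. subst w (b m + c m) * monomial_poly m) \<in> I"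
      using ring_ideal_add[OF I b(2) c(2)]
      by (simp add: w.hom_add distrib_right sum.distrib algebra_simps)
    moreover have "Poly_Mapping.keys (b m + c m) \<subseteq> monomials d t" for m
      using keys_add[of "b m" "c m"] b(1) c(1) by blast
    ultimately show ?thesis
      unfolding R_def by (intro exI[of _ "\<lambda>m. b m + c m"]) simp
  qed
  have R_cong: "R t f" if "f - g \<in> I" "R t g" for t f g
    using that ring_ideal_diff_trans[OF I] unfolding R_def by blast
  have R_zero: "R t 0" for t
    unfolding R_def using ring_ideal_zero[OF I] by (intro exI[of _ "\<lambda>_. 0"]) simp
  have R_sum: "R t (\<Sum>x\<in>X'. f x)" if "\<And>x. x \<in> X' \<Longrightarrow> R t (f x)" for t X' and f :: "'b \<Rightarrow> ('n, 'k) mpoly"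
    using that by (induction X' rule: infinite_finite_induct) (auto intro: R_add R_zero)
  have R_mono: "R u f" if "R t f" "t \<le> u" for t u f
  proof -
    have "monomials d t \<subseteq> monomials d u"
      using \<open>t \<le> u\<close> by (auto simp: monomials_def)
    then show ?thesis
      using \<open>R t f\<close> unfolding R_def by blast
  qed
  have R_w: "R (Suc t) (f * w i)" if "R t f" "i < d" for t f i
  proof -
    obtain b where b: "\<And>m. Poly_Mapping.keys (b m) \<subseteq> monomials d t" "f - (\<Sum>m\<in>?M. subst w (b m) * monomial_poly m) \<in> I"
      using \<open>R t f\<close> unfolding R_def by blast
    let ?x = "monomial_poly (Poly_Mapping.single i 1) :: (nat, 'k) mpoly"
    have x: "subst w ?x = w i"
      by (simp add: c.peval_single)
    have "f * w i - (\<Sum>m\<in>?M. subst w (?x * b m) * monomial_poly m) \<in> I"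
      using ring_ideal_mult_right[OF I b(2), of "w i"]
      by (simp add: w.hom_mult x[unfolded One_nat_def] right_diff_distrib sum_distrib_left mult_ac)
    moreover have "Poly_Mapping.keys (?x * b m) \<subseteq> monomials d (Suc t)" for m
      using keys_mult[of ?x "b m"] b(1)[of m] \<open>i < d\<close> by (fastforce simp: monomials_def keys_plus_nat)
    ultimately show ?thesis
      unfolding R_def by (intro exI[of _ "\<lambda>m. ?x * b m"]) simp
  qed
  \<comment> \<open>Up to degree \<open>r\<close> the polynomial is a combination of the generators
    with constant coefficients.\<close>
  have R_low: "R 0 f" if f: "deg_le r f" for f
  proof -
    have "f = (\<Sum>a\<in>Poly_Mapping.keys f. Poly_Mapping.single a (Poly_Mapping.lookup f a))"
      by (rule poly_mapping_sum_single)
    also have "\<dots> = (\<Sum>a\<in>?M. Poly_Mapping.single a (Poly_Mapping.lookup f a))"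
      using fin f by (intro sum.mono_neutral_left) (auto simp: deg_le_def in_keys_iff)
    also have "\<dots> = (\<Sum>a\<in>?M. subst w (const (Poly_Mapping.lookup f a)) * monomial_poly a)"
      by (simp add: mult_single)
    finally have "f - (\<Sum>a\<in>?M. subst w (const (Poly_Mapping.lookup f a)) * monomial_poly a) = 0"
      by (simp only: right_minus_eq)
    then show ?thesis
      unfolding R_def using ring_ideal_zero[OF I]
      by (intro exI[of _ "\<lambda>a. const (Poly_Mapping.lookup f a)"]) (auto simp: monomials_def)
  qed
  have R_hom: "R t f" if "homogeneous t f" for t f
    using that
  proof (induction t arbitrary: f)
    case 0
    then show ?case
      by (intro R_low homogeneous_imp_deg_le) auto
  next
    case (Suc t)
    show ?case
    proof (cases "r \<le> t")
      case True
      obtain g where g: "\<And>i. homogeneous t (g i)" "f - (\<Sum>i<d. g i * w i) \<in> I"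
        using homogeneous_linear_combination[OF I' w mem Suc.prems True] by blast
      show ?thesis
        by (rule R_cong[OF g(2)]) (auto intro!: R_sum R_w Suc.IH g(1))
    next
      case False
      then have "R 0 f"
        by (intro R_low homogeneous_imp_deg_le[OF Suc.prems]) simp
      then show ?thesis
        by (rule R_mono) simp
    qed
  qed
  have "R t (\<Sum>s\<le>t. hcomp s f)"
    by (intro R_sum) (rule R_mono[OF R_hom], auto)
  then show ?thesis
    using sum_hcomp[OF f] unfolding R_def by simp
qed

end

section \<open>Binomial estimates\<close>

text \<open>As a function of t, the binomial coefficient has degree d, but its increment over
  \<open>e\<close> steps only degree d - 1. By Pascal's rule each step adds at most C(t + d - 1, d -
  1).\<close>

lemma binomial_growth_dominates_increment:
  "\<exists>t\<ge>e. M * (((t + d) choose d) - ((t - e + d) choose d)) < (t + d) choose d"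
proof (cases d)
  case 0
  then show ?thesis
    by auto
next
  case (Suc d')
  have le: "((t + d) choose d) - ((t - s + d) choose d) \<le> s * ((t + d') choose d')" if "s \<le> t" for s t
    using that
  proof (induction s)
    case (Suc s)
    then obtain v where v: "t - s = Suc v"
      by (metis Suc_diff_Suc Suc_le_lessD)
    then have "t - Suc s = v"
      by simp
    have "(t - s + d) choose d = ((Suc v + d') choose d') + ((v + d) choose d)"
      using \<open>d = Suc d'\<close> v by simp
    moreover have "(Suc v + d') choose d' \<le> (t + d') choose d'"
      using v by (intro binomial_right_mono) simp
    ultimately show ?case
      using Suc \<open>t - Suc s = v\<close> by simp
  qed simp
  \<comment> \<open>Then M * e * d < t + d, and d * C(t + d, d) = (t + d) * C(t + d - 1, d - 1)
    absorbs the factor; the summand \<open>e\<close> ensures \<open>t \<ge> e\<close>.\<close>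
  define t where "t = M * e * d + e"
  let ?C = "(t + d') choose d'"
  have "?C > 0"
    by simp
  have "d * (M * (((t + d) choose d) - ((t - e + d) choose d))) \<le> d * (M * (e * ?C))"
    by (intro mult_le_mono le_refl le) (simp add: t_def)
  also have "\<dots> = (M * e * d) * ?C"
    by simp
  also have "\<dots> < (t + d) * ?C"
    using \<open>?C > 0\<close> Suc by (intro mult_strict_right_mono) (auto simp: t_def)
  also have "\<dots> = d * ((t + d) choose d)"
    using Suc_times_binomial_eq[of "t + d'" d'] Suc by (simp add: mult.commute)
  finally have "M * (((t + d) choose d) - ((t - e + d) choose d)) < (t + d) choose d"
    by simp
  then show ?thesis
    by (intro exI[of _ t]) (simp add: t_def)
qed

text \<open>Factor by factor: e n + i \<le> e (n + i) for each of the \<open>d\<close> factors of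
  the numerator.\<close>

lemma binomial_scale_le: "e \<ge> 1 \<Longrightarrow> (e * n + d) choose d \<le> e ^ d * ((n + d) choose d)"
proof (induction d)
  case (Suc d)
  have le: "e * n + Suc d \<le> e * (n + Suc d)"
    using mult_le_mono1[OF Suc.prems, of "Suc d"] by (simp only: add_mult_distrib2 mult_1 add_le_cancel_left)
  have "Suc d * ((e * n + Suc d) choose Suc d) = (e * n + Suc d) * ((e * n + d) choose d)"
    using Suc_times_binomial_eq[of "e * n + d" d] by simp
  also have "\<dots> \<le> (e * (n + Suc d)) * (e ^ d * ((n + d) choose d))"
    by (intro mult_le_mono le Suc)
  also have "\<dots> = e ^ Suc d * ((n + Suc d) * ((n + d) choose d))"
    by (simp only: power_Suc mult_ac)
  also have "(n + Suc d) * ((n + d) choose d) = Suc d * ((n + Suc d) choose Suc d)"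
    using Suc_times_binomial_eq[of "n + d" d] by simp
  finally have "Suc d * ((e * n + Suc d) choose Suc d) \<le> Suc d * (e ^ Suc d * ((n + Suc d) choose Suc d))"
    by (simp only: mult_ac)
  then show ?case
    by (metis Suc_mult_le_cancel1)
qed simp

lemma binomial_growth_exceeds_lower_dimension:
  assumes "e \<ge> 1"
  shows "\<exists>n. K * ((e * n + d) choose d) < (n + Suc d) choose Suc d"
proof -
  \<comment> \<open>Chosen to make d + 1 times the left-hand side at most n * C(n + d, d), while d +
    1 times the right-hand side is (n + d + 1) * C(n + d, d).\<close>
  define n where "n = K * e ^ d * Suc d"
  have "Suc d * (K * ((e * n + d) choose d)) \<le> Suc d * (K * (e ^ d * ((n + d) choose d)))"
    using binomial_scale_le[OF assms] by (intro mult_le_mono le_refl)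
  also have "\<dots> = n * ((n + d) choose d)"
    by (simp only: n_def mult_ac)
  also have "\<dots> < (n + Suc d) * ((n + d) choose d)"
    by (intro mult_strict_right_mono) auto
  also have "\<dots> = Suc d * ((n + Suc d) choose Suc d)"
    using Suc_times_binomial_eq[of "n + d" d] by simp
  finally have "K * ((e * n + d) choose d) < (n + Suc d) choose Suc d"
    by (metis mult_less_cancel1)
  then show ?thesis ..
qed


section \<open>Algebraic independence and dimension\<close>

lemma subst_sum_single:
  "finite M \<Longrightarrow> subst w (\<Sum>a\<in>M. Poly_Mapping.single a (c a)) = (\<Sum>a\<in>M. const (c a) * meval w a :: ('n, 'k::comm_ring_1) mpoly)"
proof (induction M rule: finite_induct)
  case (insert x M)
  then show ?case
    by (simp add: comm_ring_hom.peval_add[OF const_comm_ring_hom] comm_ring_hom.peval_single[OF const_comm_ring_hom])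
qed (simp add: peval_def)

lemma lookup_sum_single:
  "finite M \<Longrightarrow> Poly_Mapping.lookup (\<Sum>a\<in>M. Poly_Mapping.single a (c a)) b = (if b \<in> M then c b else 0)"
  by (simp add: lookup_sum lookup_single when_def)

lemma spans_mod_if_monomials:
  assumes J: "ring_ideal J"
    and "\<And>a. a \<in> Poly_Mapping.keys f \<Longrightarrow> spans_mod J g A (monomial_poly a)"
  shows "spans_mod J g A (f :: ('n, 'k::field) mpoly)"
proof -
  have "f = (\<Sum>a\<in>Poly_Mapping.keys f. Poly_Mapping.single a (Poly_Mapping.lookup f a))"
    by (rule poly_mapping_sum_single)
  also have "\<dots> = (\<Sum>a\<in>Poly_Mapping.keys f. const (Poly_Mapping.lookup f a) * monomial_poly a)"
    by (simp add: mult_single)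
  finally have f: "f = (\<Sum>a\<in>Poly_Mapping.keys f. const (Poly_Mapping.lookup f a) * monomial_poly a)" .
  show ?thesis
    by (subst f) (intro spans_mod_sum spans_mod_const_mult J assms(2))
qed

lemma indep_mod_meval:
  fixes w :: "nat \<Rightarrow> ('n, 'k::comm_ring_1) mpoly"
  assumes ind: "\<And>p. vars_in {..<d} p \<Longrightarrow> subst w p \<in> J \<Longrightarrow> p = 0"
  shows "indep_mod J (meval w) (monomials d t)"
  unfolding indep_mod_def
proof (intro allI impI ballI)
  fix c :: "nat monomial \<Rightarrow> 'k" and a
  assume *: "(\<Sum>a\<in>monomials d t. const (c a) * meval w a) \<in> J" and a: "a \<in> monomials d t"
  let ?p = "\<Sum>a\<in>monomials d t. Poly_Mapping.single a (c a)"
  have "vars_in {..<d} ?p"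
    by (intro vars_in_sum vars_in_single) (auto simp: monomials_def)
  then have "?p = 0"
    using * by (intro ind) (simp_all add: subst_sum_single)
  then show "c a = 0"
    using lookup_sum_single[of "monomials d t" c a] a by simp
qed

context monomial_preorder_loc
begin

lemma leading_part_eq_zero_iff: "leading_part lt f = 0 \<longleftrightarrow> (f :: ('n, 'k::comm_ring_1) mpoly) = 0"
proof
  assume *: "leading_part lt f = 0"
  show "f = 0"
  proof (rule ccontr)
    assume "f \<noteq> 0"
    then have "Poly_Mapping.keys f \<noteq> {}"
      by (metis all_not_in_conv in_keys_iff lookup_zero poly_mapping_eqI)
    then obtain u where "u \<in> Poly_Mapping.keys f" "\<forall>a\<in>Poly_Mapping.keys f. \<not> lt u a"
      using maximal_monomial_exists finite_keys by metis
    then have "u \<in> Poly_Mapping.keys (leading_part lt f)"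
      by (auto simp: leading_part_eq_part keys_part)
    then show False
      using * by simp
  qed
qed (simp add: leading_part_eq_part)

text \<open>If a combination of monomials of \<open>B\<close> lies in \<open>I\<close>, its leading
  part is again such a combination and lies in the leading ideal. It is therefore zero, and so is
  the combination.\<close>

lemma indep_mod_if_indep_mod_leading_ideal:
  fixes I :: "('n, 'k::field) mpoly set"
  assumes ind: "indep_mod (leading_ideal lt I) monomial_poly B" and "finite B"
  shows "indep_mod I monomial_poly B"
  unfolding indep_mod_def
proof (intro allI impI)
  fix c :: "'n monomial \<Rightarrow> 'k"
  assume "(\<Sum>a\<in>B. const (c a) * monomial_poly a) \<in> I"
  moreover define f where "f = (\<Sum>a\<in>B. Poly_Mapping.single a (c a))"
  ultimately have "f \<in> I"
    by (simp add: mult_single)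
  then have "leading_part lt f \<in> leading_ideal lt I"
    unfolding leading_ideal_def using genideal_mpoly_ring(2) by blast
  moreover obtain P where P: "leading_part lt f = part P f"
    by (simp add: leading_part_eq_part)
  have "part P f = (\<Sum>a\<in>B. const (if P a then c a else 0) * monomial_poly a)"
    unfolding f_def part_sum by (intro sum.cong) (auto simp: part_single mult_single)
  ultimately have "\<forall>a\<in>B. (if P a then c a else 0) = 0"
    using indep_modD[OF ind, of "\<lambda>a. if P a then c a else 0"] P by (metis (no_types, lifting))
  then have "part P f = 0"
    using \<open>part P f = _\<close> by simp
  then have "f = 0"
    using leading_part_eq_zero_iff P by metis
  show "\<forall>a\<in>B. c a = 0"
  proof
    fix a assume "a \<in> B"
    then have "Poly_Mapping.lookup f a = c a"
      unfolding f_def lookup_sum_single[OF \<open>finite B\<close>] by simp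
    then show "c a = 0"
      using \<open>f = 0\<close> by simp
  qed
qed

text \<open>A maximal set of monomials of degree at most \<open>t\<close> independent modulo the
  leading ideal must span the (t + d choose d) independent monomials in the forms
  \<open>w i\<close>. It stays independent modulo \<open>I\<close>.\<close>

lemma indep_monomials_exist:
  fixes I :: "('n, 'k::field) mpoly set"
  assumes fin: "finite {a :: 'n monomial. monomial_degree a \<le> t}"
    and w: "\<And>i. homogeneous 1 (w i)"
    and ind: "\<And>p. vars_in {..<d} p \<Longrightarrow> subst w p \<in> leading_ideal lt I \<Longrightarrow> p = 0"
  obtains B where "B \<subseteq> {a. monomial_degree a \<le> t}" "indep_mod I monomial_poly B" "(t + d) choose d \<le> card B"
proof -
  let ?L = "leading_ideal lt I" and ?A = "{a :: 'n monomial. monomial_degree a \<le> t}"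
  have L: "ring_ideal ?L"
    unfolding leading_ideal_def by (rule genideal_mpoly_ring(1))
  obtain B where B: "B \<subseteq> ?A" "indep_mod ?L monomial_poly B"
      "\<And>a. a \<in> ?A \<Longrightarrow> spans_mod ?L monomial_poly B (monomial_poly a)"
    using maximal_indep_mod[OF L fin, of monomial_poly] by blast
  have "finite B"
    using B(1) fin finite_subset by blast
  have "card (monomials d t) \<le> card B"
  proof (rule card_indep_le_spanning[OF L finite_monomials \<open>finite B\<close>])
    show "indep_mod ?L (meval w) (monomials d t)"
      by (rule indep_mod_meval[OF ind])
    fix a :: "nat monomial" assume "a \<in> monomials d t"
    then have "deg_le t (meval w a)"
      by (intro homogeneous_imp_deg_le[OF homogeneous_meval[OF w]]) (simp add: monomials_def)
    then have "b \<in> ?A" if "b \<in> Poly_Mapping.keys (meval w a)" for b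
      using that by (simp add: deg_le_def)
    then show "spans_mod ?L monomial_poly B (meval w a)"
      by (rule spans_mod_if_monomials[OF L B(3)])
  qed
  moreover have "indep_mod I monomial_poly B"
    using B(2) \<open>finite B\<close> by (rule indep_mod_if_indep_mod_leading_ideal)
  ultimately show ?thesis
    using that B(1) by (simp add: card_monomials)
qed

end

lemma deg_le_power:
  "deg_le e f \<Longrightarrow> deg_le (e * n) (f ^ n :: ('n, 'k::comm_ring_1) mpoly)"
proof (induction n)
  case (Suc n)
  then show ?case
    using deg_le_mult[of e f "e * n" "f ^ n"] by simp
qed (simp add: deg_le_def)

lemma deg_le_meval:
  fixes w :: "'i \<Rightarrow> ('n, 'k::comm_ring_1) mpoly"
  assumes "\<And>i. i \<in> Poly_Mapping.keys a \<Longrightarrow> deg_le e (w i)"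
  shows "deg_le (e * monomial_degree a) (meval w a)"
proof -
  have "deg_le (e * (\<Sum>i\<in>T. n i)) (\<Prod>i\<in>T. w i ^ n i)" if "finite T" "T \<subseteq> Poly_Mapping.keys a" for T n
    using that
  proof (induction T rule: finite_induct)
    case (insert i T)
    then show ?case
      using deg_le_mult[OF deg_le_power[OF assms[of i], of "n i"] insert.IH] by (simp add: distrib_left)
  qed (simp add: deg_le_def)
  then show ?thesis
    unfolding meval_def monomial_degree_def by simp
qed

section \<open>Prime ideals and algebraically independent elements\<close>

definition prime_ring_ideal :: "'r::comm_ring_1 set \<Rightarrow> bool"
  where "prime_ring_ideal P \<longleftrightarrow> ring_ideal P \<and> 1 \<notin> P \<and> (\<forall>x y. x * y \<in> P \<longrightarrow> x \<in> P \<or> y \<in> P)"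

text \<open>Write a relation modulo Q j as S + g T, where g is the last element and S involves only
  the earlier ones. It holds modulo the larger prime Q (j - 1), which contains g, so S vanishes by
  induction on the number of elements. Then g T lies in Q j, which is prime and does not contain g,
  so T is a relation of lower degree.\<close>

lemma indep_mod_descending_primes:
  fixes Q :: "nat \<Rightarrow> ('n, 'k::field) mpoly set"
  assumes "\<And>j. j \<le> m \<Longrightarrow> prime_ring_ideal (Q j)"
    and "\<And>j. j < m \<Longrightarrow> Q (Suc j) \<subseteq> Q j" "\<And>j. j < m \<Longrightarrow> g j \<in> Q j" "\<And>j. j < m \<Longrightarrow> g j \<notin> Q (Suc j)"
    and "j \<le> m"
  shows "indep_mod (Q j) (meval g) (monomials j t)"
  using \<open>j \<le> m\<close>
proof (induction "j + t" arbitrary: j t rule: less_induct)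
  case less
  have Qj: "ring_ideal (Q j)" "1 \<notin> Q j"
    using assms(1)[OF less.prems] by (auto simp: prime_ring_ideal_def)
  show ?case
  proof (cases "j = 0 \<or> t = 0")
    case True
    then have "monomials j t = {0}"
      by (auto simp: monomials_zero_degree monomials_zero_variables)
    moreover have "const c \<notin> Q j" if "c \<noteq> 0" for c
      using ring_ideal_mult[OF Qj(1), of "const c" "const (1 / c)"] Qj(2) that by (auto simp: mult_single)
    ultimately show ?thesis
      by (auto simp: indep_mod_def)
  next
    case False
    then obtain j' t' where jt: "j = Suc j'" "t = Suc t'"
      by (metis not0_implies_Suc)
    have j': "j' < m" "ring_ideal (Q j')"
      using less.prems jt assms(1)[of j'] by (auto simp: prime_ring_ideal_def)
    let ?x = "Poly_Mapping.single j' (1 :: nat)"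
    show ?thesis
      unfolding indep_mod_def
    proof (intro allI impI)
      fix c :: "nat monomial \<Rightarrow> 'k"
      assume *: "(\<Sum>a\<in>monomials j t. const (c a) * meval g a) \<in> Q j"
      let ?S = "\<Sum>a\<in>monomials j' t. const (c a) * meval g a"
      let ?T = "\<Sum>b\<in>monomials j t'. const (c (?x + b)) * meval g b"
      have inj: "inj_on (\<lambda>b. ?x + b) (monomials j t')"
        by (auto simp: inj_on_def)
      have "(\<Sum>a\<in>(\<lambda>b. ?x + b) ` monomials j t'. const (c a) * meval g a) = g j' * ?T"
        unfolding sum.reindex[OF inj] by (simp add: meval_add sum_distrib_left mult_ac)
      moreover have "(\<Sum>a\<in>monomials j t. const (c a) * meval g a) =
          ?S + (\<Sum>a\<in>(\<lambda>b. ?x + b) ` monomials j t'. const (c a) * meval g a)"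
        unfolding jt monomials_Suc_Suc
        by (intro sum.union_disjoint monomials_disjoint finite_monomials finite_imageI)
      ultimately have sum: "(\<Sum>a\<in>monomials j t. const (c a) * meval g a) = ?S + g j' * ?T"
        by simp
      have "?S + g j' * ?T \<in> Q j'"
        using * sum assms(2)[OF j'(1)] jt by auto
      moreover have "g j' * ?T \<in> Q j'"
        by (intro ring_ideal_mult_right j' assms(3))
      ultimately have S_mem: "?S \<in> Q j'"
        using ring_ideal_diff[OF j'(2), of "?S + g j' * ?T" "g j' * ?T"] by simp
      have "indep_mod (Q j') (meval g) (monomials j' t)"
        using jt j' by (intro less.hyps) auto
      from indep_modD[OF this S_mem] have S: "c a = 0" if "a \<in> monomials j' t" for a
        using that .
      then have "g j' * ?T \<in> Q j"
        using * sum by simp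
      then have T_mem: "?T \<in> Q j"
        using assms(1)[OF less.prems] assms(4)[OF j'(1)] jt by (auto simp: prime_ring_ideal_def)
      have "indep_mod (Q j) (meval g) (monomials j t')"
        using jt less.prems by (intro less.hyps) auto
      from indep_modD[OF this T_mem] have "c (?x + b) = 0" if "b \<in> monomials j t'" for b
        using that .
      then show "\<forall>a\<in>monomials j t. c a = 0"
        unfolding jt monomials_Suc_Suc using S jt by auto
    qed
  qed
qed

text \<open>By Zorn's lemma there is an ideal maximal among those containing \<open>J\<close> and
  avoiding the multiplicative set \<open>S\<close>; such an ideal is prime.\<close>

lemma prime_ring_ideal_exists:
  fixes J :: "'r::comm_ring_1 set"
  assumes J: "ring_ideal J" "J \<inter> S = {}" and S: "1 \<in> S" "\<And>x y. x \<in> S \<Longrightarrow> y \<in> S \<Longrightarrow> x * y \<in> S"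
  obtains P where "prime_ring_ideal P" "J \<subseteq> P" "P \<inter> S = {}"
proof -
  define \<A> where "\<A> = {K. ring_ideal K \<and> J \<subseteq> K \<and> K \<inter> S = {}}"
  have Un: "\<Union>C \<in> \<A>" if C: "C \<noteq> {}" "subset.chain \<A> C" for C
  proof -
    have CA: "\<And>K. K \<in> C \<Longrightarrow> ring_ideal K \<and> J \<subseteq> K \<and> K \<inter> S = {}"
      and chain: "\<And>K L. K \<in> C \<Longrightarrow> L \<in> C \<Longrightarrow> K \<subseteq> L \<or> L \<subseteq> K"
      using C(2) by (auto simp: subset_chain_def \<A>_def)
    have "ring_ideal (\<Union>C)"
    proof (rule ring_idealI)
      show "0 \<in> \<Union>C"
        using C(1) CA ring_ideal_zero by blast
      show "r * x \<in> \<Union>C" if "x \<in> \<Union>C" for r x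
        using that CA ring_ideal_mult by blast
      show "x + y \<in> \<Union>C" if xy: "x \<in> \<Union>C" "y \<in> \<Union>C" for x y
      proof -
        obtain K L where "K \<in> C" "L \<in> C" "x \<in> K" "y \<in> L"
          using xy by blast
        then obtain M where "M \<in> C" "x \<in> M" "y \<in> M"
          using chain by (metis subsetD)
        then show ?thesis
          using CA ring_ideal_add by blast
      qed
    qed
    then show ?thesis
      using C(1) CA unfolding \<A>_def by blast
  qed
  have "\<A> \<noteq> {}"
    using J unfolding \<A>_def by blast
  from subset_Zorn_nonempty[OF this Un]
  obtain P where P: "P \<in> \<A>" and max: "\<And>K. K \<in> \<A> \<Longrightarrow> P \<subseteq> K \<Longrightarrow> K = P"
    by blast
  have idP: "ring_ideal P" and PS: "P \<inter> S = {}" and JP: "J \<subseteq> P"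
    using P by (auto simp: \<A>_def)
  have meets: "\<exists>m\<in>P. \<exists>a. m + a * x \<in> S" if "x \<notin> P" for x
  proof (rule ccontr)
    assume no: "\<not> (\<exists>m\<in>P. \<exists>a. m + a * x \<in> S)"
    let ?K = "{m + a * x | m a. m \<in> P}"
    have "ring_ideal ?K"
    proof (rule ring_idealI)
      show "0 \<in> ?K"
        using ring_ideal_zero[OF idP] by (intro CollectI exI[of _ 0]) simp
      show "u + v \<in> ?K" if uv: "u \<in> ?K" "v \<in> ?K" for u v
      proof -
        obtain m a n b where "u = m + a * x" "v = n + b * x" "m \<in> P" "n \<in> P"
          using uv by blast
        then show ?thesis
          using ring_ideal_add[OF idP]
          by (intro CollectI exI[of _ "m + n"] exI[of _ "a + b"]) (simp add: algebra_simps)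
      qed
      show "r * u \<in> ?K" if u: "u \<in> ?K" for r u
      proof -
        obtain m a where "u = m + a * x" "m \<in> P"
          using u by blast
        then show ?thesis
          using ring_ideal_mult[OF idP]
          by (intro CollectI exI[of _ "r * m"] exI[of _ "r * a"]) (simp add: algebra_simps)
      qed
    qed
    moreover have "P \<subseteq> ?K"
      by (force intro: exI[of _ 0])
    moreover have "?K \<inter> S = {}"
      using no by blast
    ultimately have "?K = P"
      using JP by (intro max) (auto simp: \<A>_def)
    moreover have "x \<in> ?K"
      using ring_ideal_zero[OF idP] by (intro CollectI exI[of _ 0] exI[of _ 1]) simp
    ultimately show False
      using that by simp
  qed
  have "x \<in> P \<or> y \<in> P" if xy: "x * y \<in> P" for x y
  proof (rule ccontr)
    assume "\<not> (x \<in> P \<or> y \<in> P)"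
    then obtain m a n b where mn: "m \<in> P" "m + a * x \<in> S" "n \<in> P" "n + b * y \<in> S"
      using meets by meson
    \<comment> \<open>Both factors lie in \<open>S\<close>, hence so does the product; each term of
      its expansion lies in \<open>P\<close>.\<close>
    have "(m + a * x) * (n + b * y) = (n + b * y) * m + (a * x) * n + (a * b) * (x * y)"
      by (simp add: algebra_simps)
    also have "\<dots> \<in> P"
      by (intro ring_ideal_add[OF idP] ring_ideal_mult[OF idP] mn xy)
    finally show False
      using S(2)[OF mn(2,4)] PS by blast
  qed
  then have "prime_ring_ideal P"
    using idP PS S(1) by (auto simp: prime_ring_ideal_def)
  then show ?thesis
    using that JP PS by blast
qed

section \<open>Dimension counts over the subring generated by linear forms\<close>

context quotient
begin

text \<open>The ideal \<open>J\<close> consists of relations among the \<open>w i\<close>, so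
  coefficients matter only modulo \<open>J\<close> and can be taken from the span of
  \<open>B\<close>. This gives the bound \<open>card B * card M\<close>; the case J = {0} uses no
  relation.\<close>

lemma spans_mod_products:
  fixes w :: "nat \<Rightarrow> ('n, 'k) mpoly"
  assumes J: "ring_ideal J" "\<And>q. q \<in> J \<Longrightarrow> subst w q \<in> I"
    and B: "finite B" "\<And>a. a \<in> monomials d t \<Longrightarrow> spans_mod J monomial_poly B (monomial_poly a)"
    and M: "finite M"
    and f: "\<And>m. Poly_Mapping.keys (c m) \<subseteq> monomials d t" "f - (\<Sum>m\<in>M. subst w (c m) * monomial_poly m) \<in> I"
  shows "spans_mod I (\<lambda>(a, m). meval w a * monomial_poly m) (B \<times> M) f"
proof (rule spans_mod_cong[OF I f(2)], rule spans_mod_sum[OF I])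
  interpret c: comm_ring_hom "const :: 'k \<Rightarrow> ('n, 'k) mpoly" by (rule const_comm_ring_hom)
  interpret w: comm_ring_hom "subst w" by (rule c.comm_ring_hom_peval)
  fix m assume m: "m \<in> M"
  let ?g = "\<lambda>(a, m). meval w a * monomial_poly m"
  have "spans_mod J monomial_poly B (c m)"
    using f(1)[of m] by (rule_tac spans_mod_if_monomials[OF J(1) B(2)]) auto
  then obtain e where "c m - (\<Sum>a\<in>B. const (e a) * monomial_poly a) \<in> J"
    by (auto simp: spans_mod_def)
  from J(2)[OF this] have "subst w (c m) - (\<Sum>a\<in>B. const (e a) * meval w a) \<in> I"
    by (simp add: w.hom_minus w.hom_sum w.hom_mult c.peval_single)
  from ring_ideal_mult_right[OF I this, of "monomial_poly m"]
  have "subst w (c m) * monomial_poly m - (\<Sum>a\<in>B. const (e a) * ?g (a, m)) \<in> I"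
    by (simp add: left_diff_distrib sum_distrib_right mult.assoc)
  moreover have "spans_mod I ?g (B \<times> M) (\<Sum>a\<in>B. const (e a) * ?g (a, m))"
    using B(1) M m by (intro spans_mod_sum spans_mod_const_mult spans_modI I) auto
  ultimately show "spans_mod I ?g (B \<times> M) (subst w (c m) * monomial_poly m)"
    by (rule spans_mod_cong[OF I])
qed

text \<open>Finite generation of k[X]/I over k[w] by the monomials \<open>M\<close>, with
  coefficients of degree no larger than the bound for the represented polynomial; this control makes
  counting possible.\<close>

definition represents :: "(nat \<Rightarrow> ('n, 'k) mpoly) \<Rightarrow> nat \<Rightarrow> 'n monomial set \<Rightarrow> bool"
  where "represents w d M \<longleftrightarrow> finite M \<and> (\<forall>t f. deg_le t f \<longrightarrow>
    (\<exists>c. (\<forall>m. Poly_Mapping.keys (c m) \<subseteq> monomials d t) \<and>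
      f - (\<Sum>m\<in>M. subst w (c m) * monomial_poly m) \<in> I))"

lemma representsD:
  "represents w d M \<Longrightarrow> deg_le t f \<Longrightarrow> \<exists>c. (\<forall>m. Poly_Mapping.keys (c m) \<subseteq> monomials d t) \<and>
    f - (\<Sum>m\<in>M. subst w (c m) * monomial_poly m) \<in> I"
  unfolding represents_def by simp

text \<open>A nonzero relation \<open>p\<close> of degree at most \<open>e\<close> leaves, modulo
  its multiples, at most C(t + d, d) - C(t - e + d, d) dimensions for the coefficients of degree at
  most \<open>t\<close>. Multiplied by \<open>card M\<close>, this falls below the assumed growth
  for suitable \<open>t\<close>.\<close>

lemma alg_independent_if_growth:
  assumes rep: "represents w d M"
    and growth: "\<And>t. \<exists>B. finite B \<and> (\<forall>a\<in>B. monomial_degree a \<le> t) \<and> indep_mod I monomial_poly B \<and>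
      (t + d) choose d \<le> card B"
    and p: "vars_in {..<d} p" "subst w p \<in> I"
  shows "p = 0"
proof (rule ccontr)
  assume "p \<noteq> 0"
  interpret c: comm_ring_hom "const :: 'k \<Rightarrow> ('n, 'k) mpoly" by (rule const_comm_ring_hom)
  interpret w: comm_ring_hom "subst w" by (rule c.comm_ring_hom_peval)
  have M: "finite M"
    using rep by (simp add: represents_def)
  obtain e where e: "deg_le e p"
    using deg_le_exists by blast
  obtain t where t: "t \<ge> e"
    "card M * (((t + d) choose d) - ((t - e + d) choose d)) < (t + d) choose d"
    using binomial_growth_dominates_increment by blast
  let ?J = "range (\<lambda>h. h * p)"
  have J: "ring_ideal ?J"
  proof (rule ring_idealI)
    show "0 \<in> ?J"
      by (rule image_eqI[of _ _ 0]) simp_all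
    show "x + y \<in> ?J" if "x \<in> ?J" "y \<in> ?J" for x y
      using that by (auto simp flip: distrib_right)
    show "r * x \<in> ?J" if "x \<in> ?J" for r x
      using that by (auto simp flip: mult.assoc)
  qed
  obtain A' where A': "A' \<subseteq> monomials d t" "indep_mod ?J monomial_poly A'"
    "\<And>a. a \<in> monomials d t \<Longrightarrow> spans_mod ?J monomial_poly A' (monomial_poly a)"
    using maximal_indep_mod[OF J finite_monomials, where g = monomial_poly] by metis
  have finA': "finite A'"
    using A'(1) finite_monomials by (rule finite_subset)
  let ?N = "monomials d (t - e)"
  \<comment> \<open>Monomials independent modulo \<open>p\<close>, together with the multiples of
    \<open>p\<close> by monomials of degree at most \<open>t - e\<close>: they are jointly
    independent, which bounds \<open>card A'\<close>.\<close>
  define g where "g = case_sum monomial_poly (\<lambda>b. monomial_poly b * p)"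
  have "card (A' <+> ?N) \<le> card (monomials d t)"
  proof (rule card_indep_le_spanning[OF ring_ideal_0])
    show "indep_mod {0} g (A' <+> ?N)"
      unfolding indep_mod_def
    proof (intro allI impI)
      fix c assume "(\<Sum>x\<in>A' <+> ?N. const (c x) * g x) \<in> {0}"
      then have 0: "(\<Sum>a\<in>A'. const (c (Inl a)) * monomial_poly a) +
          (\<Sum>b\<in>?N. const (c (Inr b)) * monomial_poly b) * p = 0" (is "?S + ?T * p = 0")
        using finA' by (simp add: sum.Plus g_def sum_distrib_right mult.assoc)
      then have "?S = (- ?T) * p"
        by (simp add: eq_neg_iff_add_eq_0)
      then have "?S \<in> ?J"
        by blast
      from indep_modD[OF A'(2) this] have l: "c (Inl a) = 0" if "a \<in> A'" for a
        using that .
      then have "?T * p = 0"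
        using 0 by simp
      then have "?T \<in> {0}"
        using \<open>p \<noteq> 0\<close> by simp
      from indep_modD[OF indep_mod_monomials[OF finite_monomials] this] have "c (Inr b) = 0" if "b \<in> ?N" for b
        using that .
      then show "\<forall>x\<in>A' <+> ?N. c x = 0"
        using l by auto
    qed
    fix x assume x: "x \<in> A' <+> ?N"
    have "Poly_Mapping.keys (g x) \<subseteq> monomials d t"
    proof (cases x)
      case (Inl a)
      then show ?thesis
        using x A'(1) by (auto simp: g_def)
    next
      case (Inr b)
      then have "b \<in> ?N"
        using x by auto
      then have "b + a \<in> monomials d t" if "a \<in> Poly_Mapping.keys p" for a
        using that p(1) e t(1) by (fastforce simp: monomials_def vars_in_def deg_le_def keys_plus_nat)
      then show ?thesis
        using keys_mult[of "monomial_poly b" p] Inr by (auto simp: g_def)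
    qed
    then show "spans_mod {0} monomial_poly (monomials d t) (g x)"
      by (rule_tac spans_mod_if_monomials[OF ring_ideal_0])
        (rule spans_modI[OF ring_ideal_0], auto)
  qed (use finA' in auto)
  then have cardA': "card A' \<le> ((t + d) choose d) - ((t - e + d) choose d)"
    using finA' by (simp add: card_Plus card_monomials)
  from growth[of t] obtain B where "finite B \<and> (\<forall>a\<in>B. monomial_degree a \<le> t) \<and> indep_mod I monomial_poly B \<and>
      (t + d) choose d \<le> card B" ..
  then have B: "finite B" "\<And>a. a \<in> B \<Longrightarrow> monomial_degree a \<le> t" "indep_mod I monomial_poly B"
      "(t + d) choose d \<le> card B"
    by simp_all
  have "card B \<le> card (A' \<times> M)"
  proof (rule card_indep_le_spanning[OF I B(1) _ B(3)])
    show "finite (A' \<times> M)"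
      using finA' M by simp
    fix b assume "b \<in> B"
    then have "deg_le t (monomial_poly b)"
      using B(2) by (simp add: deg_le_def)
    from representsD[OF rep this]
    obtain c where c: "\<And>m. Poly_Mapping.keys (c m) \<subseteq> monomials d t"
        "monomial_poly b - (\<Sum>m\<in>M. subst w (c m) * monomial_poly m) \<in> I"
      by blast
    have "subst w q \<in> I" if "q \<in> ?J" for q
      using that ring_ideal_mult[OF I p(2)] by (auto simp: w.hom_mult)
    from spans_mod_products[OF J this finA' A'(3) M c]
    show "spans_mod I (\<lambda>(a, m). meval w a * monomial_poly m) (A' \<times> M) (monomial_poly b)" .
  qed
  also have "\<dots> \<le> card M * (((t + d) choose d) - ((t - e + d) choose d))"
    using cardA' by (simp add: card_cartesian_product mult.commute)
  finally show False
    using B(4) t(2) by simp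
qed

text \<open>A longer chain yields d + 1 elements algebraically independent modulo \<open>I\<close>.
  If their degrees are at most \<open>e\<close>, their monomials of degree at most \<open>t\<close>
  give C(t + d + 1, d + 1) independent elements in a space of dimension at most card M * C(e t + d,
  d), which is impossible for suitable \<open>t\<close>.\<close>

lemma prime_chain_length_le:
  assumes rep: "represents w d M"
    and P: "\<And>i. i \<le> m \<Longrightarrow> prime_ring_ideal (P i)" "\<And>i. i < m \<Longrightarrow> P i \<subset> P (Suc i)" "I \<subseteq> P 0"
  shows "m \<le> d"
proof (rule ccontr)
  assume "\<not> m \<le> d"
  then have m: "Suc d \<le> m"
    by simp
  have M: "finite M"
    using rep by (simp add: represents_def)
  \<comment> \<open>The first d + 2 primes of the chain in reverse order, ending with
    \<open>Q (Suc d) = P 0\<close>.\<close>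
  define Q where "Q j = P (Suc d - j)" for j
  have PQ: "Q j = P (Suc (d - j))" "Q (Suc j) = P (d - j)" "P (d - j) \<subset> P (Suc (d - j))" if "j < Suc d" for j
    using that m P(2)[of "d - j"] by (simp_all add: Q_def Suc_diff_le)
  have "\<exists>f. j < Suc d \<longrightarrow> f \<in> Q j \<and> f \<notin> Q (Suc j)" for j
    using PQ[of j] by (cases "j < Suc d") auto
  then obtain g where g: "\<And>j. j < Suc d \<Longrightarrow> g j \<in> Q j" "\<And>j. j < Suc d \<Longrightarrow> g j \<notin> Q (Suc j)"
    by metis
  have ind: "indep_mod (Q (Suc d)) (meval g) (monomials (Suc d) t)" for t
    using PQ g P(1) m by (intro indep_mod_descending_primes[where m = "Suc d"]) (auto simp: Q_def)
  have "\<forall>j. \<exists>e. deg_le e (g j)"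
    using deg_le_exists by blast
  then obtain e' where e': "\<And>j. deg_le (e' j) (g j)"
    by metis
  \<comment> \<open>The successor guarantees \<open>e \<ge> 1\<close>, as the binomial estimate
    requires.\<close>
  define e where "e = Suc (Max (e' ` {..d}))"
  have e: "deg_le e (g j)" if "j < Suc d" for j
    using that by (intro deg_le_mono[OF e'] le_SucI Max_ge) (auto simp: e_def intro!: le_SucI Max_ge)
  obtain t where t: "card M * ((e * t + d) choose d) < (t + Suc d) choose Suc d"
    using binomial_growth_exceeds_lower_dimension[of e "card M" d] by (auto simp: e_def)
  have P0: "Q (Suc d) = P 0"
    by (simp add: Q_def)
  have indI: "indep_mod I (meval g) (monomials (Suc d) t)"
    using ind[of t] P(3) unfolding indep_mod_def P0 by blast
  have "card (monomials (Suc d) t) \<le> card (monomials d (e * t) \<times> M)"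
  proof (rule card_indep_le_spanning[OF I finite_monomials _ indI])
    fix a assume a: "a \<in> monomials (Suc d) t"
    have "deg_le (e * monomial_degree a) (meval g a)"
      using a by (intro deg_le_meval e) (auto simp: monomials_def)
    then have "deg_le (e * t) (meval g a)"
      using a by (elim deg_le_mono) (simp add: monomials_def)
    from representsD[OF rep this]
    obtain c where c: "\<And>m. Poly_Mapping.keys (c m) \<subseteq> monomials d (e * t)"
        "meval g a - (\<Sum>m\<in>M. subst w (c m) * monomial_poly m) \<in> I"
      by blast
    show "spans_mod I (\<lambda>(a, m). meval w a * monomial_poly m) (monomials d (e * t) \<times> M) (meval g a)"
      by (rule spans_mod_products[OF ring_ideal_0 _ _ _ M c])
        (auto simp: subst_zero ring_ideal_zero[OF I] intro!: spans_modI ring_ideal_0)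
  qed (use M in simp)
  then show False
    using t by (simp add: card_monomials card_cartesian_product mult.commute)
qed

text \<open>Integrality enters through the determinant: if \<open>u \<equiv> y w\<^sub>i\<close>, then multiplication by \<open>u\<close> has a matrix
  divisible by the variable \<open>X\<^sub>i\<close>, so that \<open>det (u \<cdot> 1 - X\<^sub>i \<cdot> A) = 0\<close> and putting \<open>X\<^sub>i = 0\<close> gives \<open>u = 0\<close>.\<close>

lemma disjoint_step:
  assumes rep: "represents w d M" "0 \<in> M"
    and J: "ring_ideal J" "I \<subseteq> J" "\<And>j. j < i \<Longrightarrow> w j \<in> J"
    and disj: "\<And>p. vars_in {i..<d} p \<Longrightarrow> subst w p \<in> J \<Longrightarrow> p = 0"
    and i: "i < d" and u: "vars_in {Suc i..<d} u" "subst w u - y * w i \<in> J"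
  shows "u = 0"
proof -
  interpret c: comm_ring_hom "const :: 'k \<Rightarrow> ('n, 'k) mpoly" by (rule const_comm_ring_hom)
  interpret w: comm_ring_hom "subst w" by (rule c.comm_ring_hom_peval)
  let ?X = "monomial_poly (Poly_Mapping.single i 1) :: (nat, 'k) mpoly"
  have X: "subst w ?X = w i"
    using c.peval_single[of w "Poly_Mapping.single i 1" 1] by simp
  have M: "finite M"
    using rep by (simp add: represents_def)
  obtain ms where ms: "set ms = M" "distinct ms"
    using finite_distinct_list[OF M] by blast
  let ?n = "length ms"
  obtain k0 where k0: "k0 < ?n" "ms ! k0 = 0"
    using rep(2) ms(1) by (metis in_set_conv_nth)
  have sum_ms: "(\<Sum>m\<in>M. h m) = (\<Sum>j<?n. h (ms ! j))" for h :: "'n monomial \<Rightarrow> ('n, 'k) mpoly"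
    using bij_betw_nth[OF ms(2) refl refl] ms(1) by (intro sum.reindex_bij_betw[symmetric]) simp
  \<comment> \<open>The forms \<open>w j\<close> with \<open>j < i\<close> vanish modulo
    \<open>J\<close>, so coefficients may be restricted to the variables from \<open>i\<close>
    on.\<close>
  have restrict: "subst w p - subst w (restrict_vars {i..<d} p) \<in> J" if p: "vars_in {..<d} p" for p
  proof -
    let ?q = "part (\<lambda>a. \<not> Poly_Mapping.keys a \<subseteq> {i..<d}) p"
    have "meval w a \<in> J" if a: "a \<in> Poly_Mapping.keys ?q" for a
    proof -
      obtain j where j: "j \<in> Poly_Mapping.keys a" "j \<notin> {i..<d}"
        using a unfolding keys_part by blast
      moreover have "j < d"
        using a j(1) p unfolding keys_part vars_in_def by blast
      ultimately have "j < i"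
        by simp
      obtain b where b: "a = Poly_Mapping.single j 1 + b"
        using j(1) by (rule monomial_minus_single)
      show ?thesis
        using J(3)[OF \<open>j < i\<close>] unfolding b meval_add by (simp add: ring_ideal_mult_right[OF J(1)])
    qed
    then have "subst w ?q \<in> J"
      unfolding peval_def by (intro ring_ideal_sum[OF J(1)] ring_ideal_mult[OF J(1)])
    moreover have "subst w p = subst w (restrict_vars {i..<d} p) + subst w ?q"
      by (simp only: part_compl flip: w.hom_add)
    ultimately show ?thesis
      by simp
  qed
  have reduced: "\<exists>a. (\<forall>m. vars_in {i..<d} (a m)) \<and> f - (\<Sum>j<?n. subst w (a (ms ! j)) * monomial_poly (ms ! j)) \<in> J" for f
  proof -
    obtain t where "deg_le t f"
      using deg_le_exists by blast
    from representsD[OF rep(1) this]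
    obtain c where c: "\<And>m. Poly_Mapping.keys (c m) \<subseteq> monomials d t"
        "f - (\<Sum>m\<in>M. subst w (c m) * monomial_poly m) \<in> I"
      by blast
    have "vars_in {..<d} (c m)" for m
      using c(1)[of m] by (auto simp: vars_in_def monomials_def)
    then have "(\<Sum>m\<in>M. subst w (c m) * monomial_poly m) -
        (\<Sum>m\<in>M. subst w (restrict_vars {i..<d} (c m)) * monomial_poly m) \<in> J"
      by (intro ring_ideal_sum_diff[OF J(1)])
        (simp add: ring_ideal_mult_right[OF J(1)] restrict flip: left_diff_distrib)
    moreover have "f - (\<Sum>m\<in>M. subst w (c m) * monomial_poly m) \<in> J"
      using c(2) J(2) by blast
    ultimately have "f - (\<Sum>m\<in>M. subst w (restrict_vars {i..<d} (c m)) * monomial_poly m) \<in> J"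
      using ring_ideal_diff_trans[OF J(1)] by blast
    then show ?thesis
      unfolding sum_ms by (intro exI[of _ "\<lambda>m. restrict_vars {i..<d} (c m)"]) simp
  qed
  have "\<forall>l. \<exists>a. (\<forall>m. vars_in {i..<d} (a m)) \<and>
      y * monomial_poly (ms ! l) - (\<Sum>j<?n. subst w (a (ms ! j)) * monomial_poly (ms ! j)) \<in> J"
    by (rule allI, rule reduced)
  from choice[OF this] obtain a where "\<forall>l. (\<forall>m. vars_in {i..<d} (a l m)) \<and>
      y * monomial_poly (ms ! l) - (\<Sum>j<?n. subst w (a l (ms ! j)) * monomial_poly (ms ! j)) \<in> J" ..
  then have a: "\<And>l m. vars_in {i..<d} (a l m)"
    "\<And>l. y * monomial_poly (ms ! l) - (\<Sum>j<?n. subst w (a l (ms ! j)) * monomial_poly (ms ! j)) \<in> J"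
    by simp_all
  \<comment> \<open>The matrix u 1 - X_i A, where A describes multiplication by \<open>y\<close> on
    the generators modulo \<open>J\<close>. Since \<open>subst w u\<close> is congruent to
    \<open>y * w i\<close>, it annihilates the column of generators.\<close>
  define m where "m l j = (if l = j then u else 0) - ?X * a l (ms ! j)" for l j
  let ?A = "mat ?n ?n (\<lambda>(l, j). m l j)"
  have A: "?A \<in> carrier_mat ?n ?n"
    by simp
  have row: "(\<Sum>j<?n. subst w (m l j) * monomial_poly (ms ! j)) \<in> J" if l: "l < ?n" for l
  proof -
    let ?x = "monomial_poly (ms ! l) :: ('n, 'k) mpoly"
    let ?S = "\<Sum>j<?n. subst w (a l (ms ! j)) * monomial_poly (ms ! j)"
    have "(\<Sum>j<?n. subst w (m l j) * monomial_poly (ms ! j)) =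
        (\<Sum>j<?n. (if l = j then subst w u * ?x else 0) - w i * (subst w (a l (ms ! j)) * monomial_poly (ms ! j)))"
      by (intro sum.cong refl)
        (auto simp: m_def w.hom_minus w.hom_mult X[unfolded One_nat_def] left_diff_distrib mult.assoc subst_zero)
    also have "\<dots> = subst w u * ?x - w i * ?S"
      using l by (simp add: sum_subtractf sum_distrib_left)
    also have "\<dots> = (subst w u - y * w i) * ?x + w i * (y * ?x - ?S)"
      by (simp add: algebra_simps)
    also have "\<dots> \<in> J"
      by (intro ring_ideal_add[OF J(1)] ring_ideal_mult[OF J(1)] ring_ideal_mult_right[OF J(1)] u(2) a(2))
    finally show ?thesis .
  qed
  \<comment> \<open>Row \<open>k0\<close> of the identity between adjugate and determinant. As
    \<open>ms ! k0\<close> is the monomial 1, applying it to the relations in \<open>row\<close>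
    puts the determinant itself into \<open>J\<close>.\<close>
  have adj: "(\<Sum>l<?n. adj_mat ?A $$ (k0, l) * m l j) = (if j = k0 then det ?A else 0)" if "j < ?n" for j
  proof -
    have "(adj_mat ?A * ?A) $$ (k0, j) = (det ?A \<cdot>\<^sub>m 1\<^sub>m ?n) $$ (k0, j)"
      using adj_mat(3)[OF A] by simp
    then show ?thesis
      using that k0(1) adj_mat(1)[OF A] by (auto simp: scalar_prod_def atLeast0LessThan)
  qed
  have "(\<Sum>l<?n. subst w (adj_mat ?A $$ (k0, l)) * (\<Sum>j<?n. subst w (m l j) * monomial_poly (ms ! j))) \<in> J"
    by (intro ring_ideal_sum[OF J(1)] ring_ideal_mult[OF J(1)] row) simp
  also have "(\<Sum>l<?n. subst w (adj_mat ?A $$ (k0, l)) * (\<Sum>j<?n. subst w (m l j) * monomial_poly (ms ! j))) =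
      (\<Sum>j<?n. subst w (\<Sum>l<?n. adj_mat ?A $$ (k0, l) * m l j) * monomial_poly (ms ! j))"
    unfolding sum_distrib_left w.hom_sum w.hom_mult sum_distrib_right
    by (subst sum.swap) (simp add: mult.assoc)
  also have "\<dots> = (\<Sum>j<?n. if j = k0 then subst w (det ?A) * monomial_poly (ms ! j) else 0)"
    by (intro sum.cong refl) (auto simp: adj subst_zero)
  also have "\<dots> = subst w (det ?A)"
    using k0 by simp
  finally have det_mem: "subst w (det ?A) \<in> J" .
  have map_det: "restrict_vars T (det ?A) = det (mat ?n ?n (\<lambda>(l, j). restrict_vars T (m l j)))" for T
    by (subst comm_ring_hom.hom_det[OF restrict_vars_comm_ring_hom, symmetric])
      (rule arg_cong[where f = det], rule eq_matI, auto)
  have "vars_in {i..<d} (m l j)" for l j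
  proof -
    have "vars_in {i..<d} (?X * a l (ms ! j))"
      using i by (intro vars_in_mult vars_in_single a(1)) auto
    moreover have "vars_in {i..<d} u"
      using u(1) by (rule vars_in_mono) auto
    ultimately show ?thesis
      unfolding m_def diff_conv_add_uminus by (intro vars_in_add vars_in_uminus) simp_all
  qed
  then have "restrict_vars {i..<d} (det ?A) = det ?A"
    unfolding map_det by (simp add: restrict_vars_id)
  then have "vars_in {i..<d} (det ?A)"
    by (metis vars_in_restrict_vars)
  then have "det ?A = 0"
    using det_mem by (rule disj)
  let ?R = "restrict_vars {Suc i..<d}"
  interpret R: comm_ring_hom ?R by (rule restrict_vars_comm_ring_hom)
  have "?R ?X = 0"
    by (simp add: part_single)
  then have "?R (m l j) = (if l = j then u else 0)" for l j
    by (simp add: m_def R.hom_minus R.hom_mult restrict_vars_id[OF u(1)])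
  then have "0 = det (mat ?n ?n (\<lambda>(l, j). if l = j then u else 0))"
    using map_det[of "{Suc i..<d}"] \<open>det ?A = 0\<close> by simp
  also have "mat ?n ?n (\<lambda>(l, j). if l = j then u else 0) = u \<cdot>\<^sub>m 1\<^sub>m ?n"
    by (rule eq_matI) auto
  finally show ?thesis
    by simp
qed

text \<open>By \<open>disjoint_step\<close>, adjoining \<open>w i\<close> to the prime at stage
  \<open>i\<close> keeps the ideal away from the nonzero polynomials in the later forms, so a prime
  at the next stage exists. The inclusion is strict because the earlier prime avoids
  \<open>w i\<close>, itself one of the excluded elements.\<close>

lemma prime_chain_exists:
  assumes rep: "represents w d M" "0 \<in> M"
    and ind: "\<And>p. vars_in {..<d} p \<Longrightarrow> subst w p \<in> I \<Longrightarrow> p = 0"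
  obtains P where "\<And>i. i \<le> d \<Longrightarrow> prime_ring_ideal (P i)" "\<And>i. i < d \<Longrightarrow> P i \<subset> P (Suc i)"
    "\<And>i. i \<le> d \<Longrightarrow> I \<subseteq> P i"
proof -
  interpret c: comm_ring_hom "const :: 'k \<Rightarrow> ('n, 'k) mpoly" by (rule const_comm_ring_hom)
  interpret w: comm_ring_hom "subst w" by (rule c.comm_ring_hom_peval)
  define disjoint_above where "disjoint_above i J \<longleftrightarrow> (\<forall>p. vars_in {i..<d} p \<longrightarrow> subst w p \<in> J \<longrightarrow> p = 0)" for i J
  define good where "good i P \<longleftrightarrow> prime_ring_ideal P \<and> I \<subseteq> P \<and> (\<forall>j<i. w j \<in> P) \<and> disjoint_above i P" for i P
  have extend: "\<exists>P. prime_ring_ideal P \<and> J \<subseteq> P \<and> disjoint_above i P" if J: "ring_ideal J" "disjoint_above i J" for i J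
  proof -
    let ?S = "{subst w p | p. vars_in {i..<d} p \<and> p \<noteq> 0}"
    have "J \<inter> ?S = {}"
      using J(2) by (auto simp: disjoint_above_def)
    moreover have "1 \<in> ?S"
      by (intro CollectI exI[of _ 1]) simp
    moreover have "x * y \<in> ?S" if xy: "x \<in> ?S" "y \<in> ?S" for x y
    proof -
      obtain p q where "vars_in {i..<d} p" "p \<noteq> 0" "x = subst w p" "vars_in {i..<d} q" "q \<noteq> 0" "y = subst w q"
        using xy by blast
      then show ?thesis
        by (intro CollectI exI[of _ "p * q"]) (auto simp: w.hom_mult vars_in_mult)
    qed
    ultimately obtain P where "prime_ring_ideal P" "J \<subseteq> P" "P \<inter> ?S = {}"
      by (rule prime_ring_ideal_exists[OF J(1)])
    then show ?thesis
      unfolding disjoint_above_def by blast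
  qed
  have base: "\<exists>P. 0 \<le> d \<longrightarrow> good 0 P"
  proof -
    have "disjoint_above 0 I"
      unfolding disjoint_above_def using ind by (simp add: atLeast0LessThan)
    from extend[OF I this] show ?thesis
      unfolding good_def by auto
  qed
  have step: "\<exists>P'. (Suc i \<le> d \<longrightarrow> good (Suc i) P') \<and> (i < d \<longrightarrow> P \<subset> P')" if P: "i \<le> d \<longrightarrow> good i P" for P i
  proof (cases "i < d")
    case True
    then have g: "prime_ring_ideal P" "I \<subseteq> P" "\<And>j. j < i \<Longrightarrow> w j \<in> P" "disjoint_above i P"
      using P by (auto simp: good_def)
    have idP: "ring_ideal P"
      using g(1) by (simp add: prime_ring_ideal_def)
    let ?J = "ideal_adjoin P (\<lambda>_. w i) 1"
    have J: "ring_ideal ?J" "P \<subseteq> ?J" "w i \<in> ?J"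
      using ring_ideal_adjoin[OF idP] ideal_adjoin_subset[OF idP]
        ideal_adjoin_form[OF idP, of 0 1 "\<lambda>_. w i"] by auto
    have "disjoint_above (Suc i) ?J"
      unfolding disjoint_above_def
    proof (intro allI impI)
      fix u assume u: "vars_in {Suc i..<d} u" "subst w u \<in> ?J"
      obtain y where y: "subst w u - y * w i \<in> P"
        using u(2) by (auto simp: ideal_adjoin_def)
      have dis: "p = 0" if "vars_in {i..<d} p" "subst w p \<in> P" for p
        using g(4) that by (simp add: disjoint_above_def)
      show "u = 0"
        by (rule disjoint_step[OF rep idP g(2,3) dis True u(1) y])
    qed
    from extend[OF J(1) this] obtain P' where P': "prime_ring_ideal P'" "?J \<subseteq> P'" "disjoint_above (Suc i) P'"
      by blast
    have sub: "P \<subseteq> P'" "w i \<in> P'"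
      using J P'(2) by auto
    have "w j \<in> P'" if "j < Suc i" for j
      using that sub g(3) by (auto simp: less_Suc_eq)
    then have "good (Suc i) P'"
      using P' g(2) sub(1) by (auto simp: good_def)
    moreover have "w i \<notin> P"
    proof
      let ?X = "monomial_poly (Poly_Mapping.single i 1) :: (nat, 'k) mpoly"
      assume "w i \<in> P"
      then have "subst w ?X \<in> P"
        using c.peval_single[of w "Poly_Mapping.single i 1" 1] by simp
      moreover have "vars_in {i..<d} ?X"
        using True by (intro vars_in_single) auto
      ultimately have "?X = 0"
        using g(4) by (simp add: disjoint_above_def)
      then show False
        by (metis lookup_single_eq lookup_zero zero_neq_one)
    qed
    ultimately show ?thesis
      using sub by blast
  qed auto
  \<comment> \<open>The recursion runs over all natural numbers; the guards \<open>i \<le> d\<close>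
    and \<open>i < d\<close> make its conditions vacuous afterwards.\<close>
  from dependent_nat_choice[where P = "\<lambda>i P. i \<le> d \<longrightarrow> good i P" and Q = "\<lambda>i P P'. i < d \<longrightarrow> P \<subset> P'",
      OF base step]
  obtain P where "\<forall>i. (i \<le> d \<longrightarrow> good i (P i)) \<and> (i < d \<longrightarrow> P i \<subset> P (Suc i))" ..
  then show ?thesis
    by (intro that[of P]) (auto simp: good_def)
qed

section \<open>Krull dimension and Noether normalization of the quotient\<close>

lemma primeideal_A_image:
  assumes P: "prime_ring_ideal P" "I \<subseteq> P"
  shows "primeideal (\<pi> ` P) A"
proof -
  interpret cring A by (rule cring_A)
  have idP: "ring_ideal P"
    using P(1) by (simp add: prime_ring_ideal_def)
  have mem: "\<pi> f \<in> \<pi> ` P \<longleftrightarrow> f \<in> P" for f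
    by (rule \<pi>_mem_image_iff[OF idP P(2)])
  have "ideal (\<pi> ` P) A"
    by (rule ideal_A_image[OF idP])
  then show ?thesis
  proof (rule primeidealI[OF _ is_cring])
    have "\<pi> 1 \<notin> \<pi> ` P"
      using P(1) by (simp add: mem prime_ring_ideal_def)
    then show "carrier A \<noteq> \<pi> ` P"
      using \<pi>_carrier by blast
    fix a b assume ab: "a \<in> carrier A" "b \<in> carrier A" "a \<otimes>\<^bsub>A\<^esub> b \<in> \<pi> ` P"
    obtain f g where fg: "a = \<pi> f" "b = \<pi> g"
      using ab(1,2) by (auto elim!: carrier_A_E)
    show "a \<in> \<pi> ` P \<or> b \<in> \<pi> ` P"
      using ab(3) P(1) unfolding fg mult_A mem prime_ring_ideal_def by blast
  qed
qed

lemma prime_ring_ideal_preimage: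
  assumes "primeideal P A"
  shows "prime_ring_ideal {f. \<pi> f \<in> P}" "I \<subseteq> {f. \<pi> f \<in> P}"
proof -
  interpret P: primeideal P A by (rule assms)
  have zero: "\<pi> 0 \<in> P"
    using additive_subgroup.zero_closed[OF P.is_additive_subgroup] by (simp add: zero_A)
  have "ring_ideal {f. \<pi> f \<in> P}"
  proof (rule ring_idealI)
    show "x + y \<in> {f. \<pi> f \<in> P}" if "x \<in> {f. \<pi> f \<in> P}" "y \<in> {f. \<pi> f \<in> P}" for x y
      using additive_subgroup.a_closed[OF P.is_additive_subgroup, of "\<pi> x" "\<pi> y"] that by (simp add: add_A)
    show "r * x \<in> {f. \<pi> f \<in> P}" if "x \<in> {f. \<pi> f \<in> P}" for r x
      using P.I_l_closed[of "\<pi> x" "\<pi> r"] that by (simp add: mult_A)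
  qed (use zero in simp)
  moreover have "\<pi> 1 \<notin> P"
    using P.I_notcarr P.one_imp_carrier by (auto simp: one_A)
  moreover have "\<pi> x \<in> P \<or> \<pi> y \<in> P" if "\<pi> (x * y) \<in> P" for x y
    using P.I_prime[of "\<pi> x" "\<pi> y"] that by (simp add: mult_A)
  ultimately show "prime_ring_ideal {f. \<pi> f \<in> P}"
    by (auto simp: prime_ring_ideal_def)
  show "I \<subseteq> {f. \<pi> f \<in> P}"
  proof
    fix f assume "f \<in> I"
    then have "\<pi> f = \<pi> 0"
      by (simp add: \<pi>_eq_iff)
    then show "f \<in> {f. \<pi> f \<in> P}"
      using zero by simp
  qed
qed

lemma krull_dim_A:
  assumes rep: "represents w d M" "0 \<in> M"
    and ind: "\<And>p. vars_in {..<d} p \<Longrightarrow> subst w p \<in> I \<Longrightarrow> p = 0"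
  shows "krull_dim A = enat d"
proof (rule antisym)
  show "krull_dim A \<le> enat d"
    unfolding krull_dim_def
  proof (rule Sup_least, clarify)
    fix m P
    assume P: "\<forall>i\<le>m. primeideal (P i) A" "\<forall>i<m. P i \<subset> P (Suc i)"
    have "m \<le> d"
    proof (rule prime_chain_length_le[OF rep(1), where P = "\<lambda>i. {f. \<pi> f \<in> P i}"])
      fix i assume i: "i < m"
      then have "primeideal (P (Suc i)) A"
        using P(1) by simp
      then interpret P: primeideal "P (Suc i)" A .
      \<comment> \<open>Every element of a prime of the quotient has a polynomial representative, so
        strict inclusions survive taking preimages.\<close>
      have "P (Suc i) \<subseteq> range \<pi>"
        using additive_subgroup.a_subset[OF P.is_additive_subgroup] by (simp add: carrier_A)
      moreover have "P i \<subset> P (Suc i)"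
        using P(2) i by simp
      moreover obtain x where "x \<in> P (Suc i)" "x \<notin> P i"
        using \<open>P i \<subset> P (Suc i)\<close> by blast
      ultimately show "{f. \<pi> f \<in> P i} \<subset> {f. \<pi> f \<in> P (Suc i)}"
        by (intro psubsetI) auto
    qed (use P(1) prime_ring_ideal_preimage in auto)
    then show "enat m \<le> enat d"
      by simp
  qed
  obtain P where P: "\<And>i. i \<le> d \<Longrightarrow> prime_ring_ideal (P i)" "\<And>i. i < d \<Longrightarrow> P i \<subset> P (Suc i)"
    "\<And>i. i \<le> d \<Longrightarrow> I \<subseteq> P i"
    using prime_chain_exists[OF rep ind] by blast
  have mem: "\<pi> f \<in> \<pi> ` P i \<longleftrightarrow> f \<in> P i" if "i \<le> d" for i f
    using P(1)[OF that] P(3)[OF that] by (intro \<pi>_mem_image_iff) (simp_all add: prime_ring_ideal_def)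
  have "\<pi> ` P i \<subset> \<pi> ` P (Suc i)" if i: "i < d" for i
  proof -
    obtain f where "f \<in> P (Suc i)" "f \<notin> P i"
      using P(2)[OF i] by blast
    then have "\<pi> f \<in> \<pi> ` P (Suc i)" "\<pi> f \<notin> \<pi> ` P i"
      using mem[of i] i by auto
    moreover have "\<pi> ` P i \<subseteq> \<pi> ` P (Suc i)"
      using P(2)[OF i] by (intro image_mono) auto
    ultimately show ?thesis
      by blast
  qed
  moreover have "primeideal (\<pi> ` P i) A" if "i \<le> d" for i
    using that by (intro primeideal_A_image P)
  ultimately show "enat d \<le> krull_dim A"
    unfolding krull_dim_def
    by (intro Sup_upper CollectI exI[of _ d] exI[of _ "\<lambda>i. \<pi> ` P i"] conjI refl allI impI)
qed

lemma linear_noether_system_A: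
  assumes rep: "represents w d M" "0 \<in> M" and w: "\<And>i. homogeneous 1 (w i)"
    and ind: "\<And>p. vars_in {..<d} p \<Longrightarrow> subst w p \<in> I \<Longrightarrow> p = 0"
  defines "zs \<equiv> map (\<lambda>i. \<pi> (w i)) [0..<d]"
  shows "linear_noether_system A zs" "lifts zs w"
proof -
  have M: "finite M"
    using rep by (simp add: represents_def)
  have len: "length zs = d"
    by (simp add: zs_def)
  show zs: "lifts zs w"
    using w by (simp add: lifts_def zs_def)
  define r where "r x = (SOME f. \<pi> f = x)" for x
  have r: "\<pi> (r (\<pi> f)) = \<pi> f" for f
    unfolding r_def by (rule someI_ex) blast
  have gen: "monomial_poly m \<in> lspan w d r (\<pi> ` monomial_poly ` M)" if "m \<in> M" for m
  proof (rule lspan_cong)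
    show "monomial_poly m - r (\<pi> (monomial_poly m)) \<in> I"
      using r \<pi>_eq_iff by metis
    show "r (\<pi> (monomial_poly m)) \<in> lspan w d r (\<pi> ` monomial_poly ` M)"
      using lspan_generator[of "\<pi> (monomial_poly m)" "\<pi> ` monomial_poly ` M" d 1 w r] that
      by (simp add: subst_one)
  qed
  have "f \<in> lspan w d r (\<pi> ` monomial_poly ` M)" for f
  proof -
    obtain t where "deg_le t f"
      using deg_le_exists by blast
    from representsD[OF rep(1) this]
    obtain c where c: "\<And>m. Poly_Mapping.keys (c m) \<subseteq> monomials d t"
        "f - (\<Sum>m\<in>M. subst w (c m) * monomial_poly m) \<in> I"
      by blast
    have "vars_in {..<d} (c m)" for m
      using c(1)[of m] by (auto simp: vars_in_def monomials_def)
    then show ?thesis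
      by (intro lspan_cong[OF c(2)] lspan_sum lspan_mult gen)
  qed
  then have "lspan w (length zs) r (\<pi> ` monomial_poly ` M) = UNIV"
    using len by auto
  moreover have "\<pi> (r s) = s" if "s \<in> \<pi> ` monomial_poly ` M" for s
    using that r by auto
  ultimately have "module_span A (generated_subalgebra A zs) (\<pi> ` monomial_poly ` M) = carrier A"
    using module_span_A_eq_carrier[OF zs, of "\<pi> ` monomial_poly ` M" r] by simp
  moreover have "finite (\<pi> ` monomial_poly ` M)" "\<pi> ` monomial_poly ` M \<subseteq> carrier A"
    using M by auto
  ultimately have "\<exists>S. finite S \<and> S \<subseteq> carrier A \<and> module_span A (generated_subalgebra A zs) S = carrier A"
    by (intro exI conjI)
  moreover have "alg_independent A zs"
    using ind len by (auto simp: alg_independent_A_iff[OF zs])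
  moreover have "set zs \<subseteq> component A 1"
    using w by (auto simp: zs_def component_A)
  moreover have "set zs \<subseteq> carrier A"
    by (auto simp: zs_def)
  ultimately show "linear_noether_system A zs"
    using krull_dim_A[OF rep ind] len by (simp add: linear_noether_system_def noether_normalization_def)
qed

end

section \<open>Leading ideals of graded ideals\<close>

context monomial_preorder_loc
begin

text \<open>If some monomial of degree \<open>t\<close> is maximal in \<open>f\<close>, then a
  monomial of degree \<open>t\<close> is maximal in \<open>f\<close> iff it is maximal in the
  component, since a dominated one already lies below that maximal monomial. Otherwise no term of
  degree \<open>t\<close> survives.\<close>

lemma hcomp_leading_part:
  fixes f :: "('n, 'k::comm_ring_1) mpoly"
  shows "hcomp t (leading_part lt f) = 0 \<or> hcomp t (leading_part lt f) = leading_part lt (hcomp t f)"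
proof (cases "hcomp t (leading_part lt f) = 0")
  case False
  then obtain a where "a \<in> Poly_Mapping.keys (hcomp t (leading_part lt f))"
    by (metis in_keys_iff lookup_zero poly_mapping_eqI)
  then have a: "a \<in> Poly_Mapping.keys f" "monomial_degree a = t" "\<And>b. b \<in> Poly_Mapping.keys f \<Longrightarrow> \<not> lt a b"
    by (auto simp: keys_part leading_part_eq_part)
  have "(\<exists>b\<in>Poly_Mapping.keys f. lt a' b) \<longleftrightarrow> (\<exists>b\<in>Poly_Mapping.keys (hcomp t f). lt a' b)"
    if a': "a' \<in> Poly_Mapping.keys f" "monomial_degree a' = t" for a'
  proof
    assume "\<exists>b\<in>Poly_Mapping.keys f. lt a' b"
    then obtain b where b: "b \<in> Poly_Mapping.keys f" "lt a' b"
      by blast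
    have "lt a' a"
    proof (rule ccontr)
      assume "\<not> lt a' a"
      then have "eqv a a'"
        using a(3)[OF a'(1)] by (simp add: incomparable_def)
      then show False
        using eqv_lt b a(3) by blast
    qed
    then show "\<exists>b\<in>Poly_Mapping.keys (hcomp t f). lt a' b"
      using a(1,2) by (auto simp: keys_part)
  qed (auto simp: keys_part)
  then show ?thesis
    unfolding leading_part_eq_part
    by (intro disjI2 poly_mapping_eqI) (auto simp: lookup_part in_keys_iff)
qed simp

text \<open>A nonzero term times a leading part is the leading part of the product, so linear spans
  of leading parts of homogeneous elements are closed under multiplication by terms. Thus plain
  linear combinations suffice in each degree, as \<open>deform_leading_parts\<close>
  requires.\<close>

lemma hcomp_leading_ideal:
  fixes I :: "('n, 'k::field) mpoly set"
  assumes I: "ring_ideal I" "graded I" and l: "l \<in> leading_ideal lt I"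
  shows "hcomp t l \<in> mpoly_module.span (leading_part lt ` {f \<in> I. homogeneous t f})"
proof -
  let ?G = "\<lambda>t. mpoly_module.span (leading_part lt ` {f \<in> I. homogeneous t f})"
  let ?J = "{l. \<forall>t. hcomp t l \<in> ?G t}"
  have single: "Poly_Mapping.single b c * g \<in> ?G (monomial_degree b + t)" if "g \<in> ?G t" for b c g t
    using that
  proof (induction rule: mpoly_module.span_induct_alt)
    case base
    show ?case
      by (simp add: mpoly_module.span_zero)
  next
    case (step e x y)
    then obtain f where f: "x = leading_part lt f" "f \<in> I" "homogeneous t f"
      by blast
    have "Poly_Mapping.single b c * x \<in> ?G (monomial_degree b + t)"
    proof (cases "c = 0")
      case True
      then show ?thesis
        by (simp add: mpoly_module.span_zero)
    next
      case False
      show ?thesis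
        unfolding f(1) leading_part_single_mult[OF False]
        using f ring_ideal_mult[OF I(1)] homogeneous_mult[OF homogeneous_single[OF refl]]
        by (intro mpoly_module.span_base imageI) simp
    qed
    then have "const e * (Poly_Mapping.single b c * x) + Poly_Mapping.single b c * y \<in> ?G (monomial_degree b + t)"
      using step.IH by (intro mpoly_module.span_add mpoly_module.span_scale)
    then show ?case
      by (simp add: algebra_simps)
  qed
  have "ring_ideal ?J"
  proof (rule ring_ideal_mpolyI)
    show "0 \<in> ?J"
      by (simp add: mpoly_module.span_zero)
    show "x + y \<in> ?J" if "x \<in> ?J" "y \<in> ?J" for x y
      using that by (auto simp: part_add intro: mpoly_module.span_add)
    show "Poly_Mapping.single b c * x \<in> ?J" if "x \<in> ?J" for b c x
    proof (intro CollectI allI)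
      fix t
      show "hcomp t (Poly_Mapping.single b c * x) \<in> ?G t"
        using single[of "hcomp (t - monomial_degree b) x" "t - monomial_degree b" b c] that
        by (cases "monomial_degree b \<le> t") (simp_all add: hcomp_single_mult mpoly_module.span_zero)
    qed
  qed
  moreover have "leading_part lt ` I \<subseteq> ?J"
  proof clarify
    fix f t assume "f \<in> I"
    then have "hcomp t f \<in> {f \<in> I. homogeneous t f}"
      using gradedD[OF I(2)] by simp
    then have "leading_part lt (hcomp t f) \<in> ?G t"
      by (intro mpoly_module.span_base imageI)
    then show "hcomp t (leading_part lt f) \<in> ?G t"
      using hcomp_leading_part[of t f] by (auto simp: mpoly_module.span_zero)
  qed
  ultimately have "leading_ideal lt I \<subseteq> ?J"
    unfolding leading_ideal_def by (rule genideal_mpoly_ring(3))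
  then show ?thesis
    using l by blast
qed

lemma graded_leading_ideal:
  fixes I :: "('n, 'k::field) mpoly set"
  assumes I: "ring_ideal I" "graded I"
  shows "graded (leading_ideal lt I)"
  unfolding graded_def
proof (intro ballI allI)
  fix f t assume "f \<in> leading_ideal lt I"
  have L: "ring_ideal (leading_ideal lt I)" "leading_part lt ` I \<subseteq> leading_ideal lt I"
    unfolding leading_ideal_def by (rule genideal_mpoly_ring)+
  have "mpoly_module.span (leading_part lt ` {f \<in> I. homogeneous t f}) \<subseteq> leading_ideal lt I"
  proof (rule mpoly_module.span_minimal)
    show "leading_part lt ` {f \<in> I. homogeneous t f} \<subseteq> leading_ideal lt I"
      using L(2) by blast
    show "mpoly_module.subspace (leading_ideal lt I)"
      by (rule mpoly_module.subspaceI)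
        (simp_all add: ring_ideal_zero[OF L(1)] ring_ideal_add[OF L(1)] ring_ideal_mult[OF L(1)])
  qed
  then show "hcomp t f \<in> leading_ideal lt I"
    using hcomp_leading_ideal[OF I \<open>f \<in> leading_ideal lt I\<close>, of t] by blast
qed

text \<open>The deformation scales the elements of \<open>I\<close> and leaves the forms
  \<open>w i\<close> fixed. The inverse scaling brings the former back into \<open>I\<close> and
  turns the latter into the new forms \<open>v i\<close>.\<close>

lemma deform_reduction:
  fixes I :: "('n, 'k::field) mpoly set"
  assumes inf: "infinite (UNIV :: 'k set)"
    and fin: "finite {a :: 'n monomial. monomial_degree a = Suc r}"
    and I: "ring_ideal I" "graded I" and w: "\<And>i. homogeneous 1 (w i)"
    and mem: "\<And>a. monomial_degree a = Suc r \<Longrightarrow> monomial_poly a \<in> ideal_adjoin (leading_ideal lt I) w d"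
  obtains v where "\<And>i. homogeneous 1 (v i)"
    and "\<And>a. monomial_degree a = Suc r \<Longrightarrow> monomial_poly a \<in> ideal_adjoin I v d"
proof -
  let ?G = "{f \<in> I. homogeneous (Suc r) f}"
  let ?H = "{monomial_poly b * w i | b i. monomial_degree b = r \<and> i < d}"
  have span: "monomial_poly a \<in> mpoly_module.span (leading_part lt ` ?G \<union> ?H)" if a: "monomial_degree a = Suc r" for a
  proof -
    obtain g where g: "monomial_poly a - (\<Sum>i<d. g i * w i) \<in> leading_ideal lt I"
      using mem[OF a] by (auto simp: ideal_adjoin_def)
    \<comment> \<open>Taking the component of degree r + 1 turns the leading ideal into a span of
      leading parts and the coefficients \<open>g i\<close> into forms of degree
      \<open>r\<close>.\<close>
    have "hcomp (Suc r) (monomial_poly a - (\<Sum>i<d. g i * w i)) \<in> mpoly_module.span (leading_part lt ` ?G \<union> ?H)"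
      using hcomp_leading_ideal[OF I g] mpoly_module.span_mono by blast
    then have 1: "monomial_poly a - (\<Sum>i<d. hcomp r (g i) * w i) \<in> mpoly_module.span (leading_part lt ` ?G \<union> ?H)"
      using a by (simp add: hcomp_linear_combination[OF w] part_single)
    have 2: "(\<Sum>i<d. hcomp r (g i) * w i) \<in> mpoly_module.span (leading_part lt ` ?G \<union> ?H)"
    proof (rule mpoly_module.span_sum)
      fix i assume "i \<in> {..<d}"
      then have "Poly_Mapping.single b c * w i \<in> mpoly_module.span (leading_part lt ` ?G \<union> ?H)"
        if "monomial_degree b = r" for b c
      proof -
        have "monomial_poly b * w i \<in> ?H"
          using that \<open>i \<in> {..<d}\<close> by blast
        then have "const c * (monomial_poly b * w i) \<in> mpoly_module.span (leading_part lt ` ?G \<union> ?H)"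
          by (intro mpoly_module.span_scale mpoly_module.span_base) simp
        then show ?thesis
          by (simp add: mult_single flip: mult.assoc)
      qed
      then have "(\<Sum>b\<in>Poly_Mapping.keys (hcomp r (g i)). Poly_Mapping.single b (Poly_Mapping.lookup (hcomp r (g i)) b) * w i)
          \<in> mpoly_module.span (leading_part lt ` ?G \<union> ?H)"
        by (intro mpoly_module.span_sum) (auto simp: keys_part)
      then show "hcomp r (g i) * w i \<in> mpoly_module.span (leading_part lt ` ?G \<union> ?H)"
        by (simp flip: sum_distrib_right poly_mapping_sum_single)
    qed
    show ?thesis
      using mpoly_module.span_add[OF 1 2] by simp
  qed
  have "homogeneous (Suc r) f" if f: "f \<in> ?G \<union> ?H" for f
  proof (cases "f \<in> ?G")
    case False
    then obtain b i where "f = monomial_poly b * w i" "monomial_degree b = r"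
      using f by blast
    then show ?thesis
      using homogeneous_mult[OF homogeneous_single w, of b r 1 i] by simp
  qed simp
  from deform_leading_parts[OF inf fin this span]
  obtain s where s: "\<And>i. s i \<noteq> 0"
    "\<And>a. monomial_degree a = Suc r \<Longrightarrow> monomial_poly a \<in> mpoly_module.span (rescale s ` ?G \<union> ?H)"
    by blast
  define s' where "s' i = 1 / s i" for i
  have inverse: "meval s a * meval s' a = 1" for a
  proof -
    have "meval s a * meval s' a = meval (\<lambda>_. 1) a"
      using s(1) by (simp add: s'_def flip: meval_mult)
    then show ?thesis
      by (simp add: meval_def)
  qed
  interpret h: comm_ring_hom "rescale s'" by (rule rescale_comm_ring_hom)
  define v where "v i = rescale s' (w i)" for i
  have v: "homogeneous 1 (v i)" for i
    using w[of i] by (auto simp: v_def homogeneous_def in_keys_iff lookup_rescale)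
  let ?K = "ideal_adjoin I v d"
  have K: "ring_ideal ?K"
    by (rule ring_ideal_adjoin[OF I(1)])
  have "mpoly_module.span (rescale s ` ?G \<union> ?H) \<subseteq> {f. rescale s' f \<in> ?K}"
  proof (rule mpoly_module.span_minimal)
    have "rescale s' (rescale s f) = f" for f
      by (rule poly_mapping_eqI) (simp add: lookup_rescale mult.assoc inverse)
    then have "rescale s' f \<in> ?K" if "f \<in> rescale s ` ?G" for f
      using that ideal_adjoin_subset[OF I(1)] by auto
    moreover have "rescale s' f \<in> ?K" if f: "f \<in> ?H" for f
    proof -
      obtain b i where "f = monomial_poly b * w i" "i < d"
        using f by blast
      then show ?thesis
        using ideal_adjoin_form[OF I(1), of i d v] ring_ideal_mult[OF K]
        by (simp add: h.hom_mult flip: v_def)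
    qed
    ultimately show "rescale s ` ?G \<union> ?H \<subseteq> {f. rescale s' f \<in> ?K}"
      by blast
    show "mpoly_module.subspace {f. rescale s' f \<in> ?K}"
      by (rule mpoly_module.subspaceI)
        (simp_all add: h.hom_add h.hom_mult ring_ideal_zero[OF K] ring_ideal_add[OF K] ring_ideal_mult[OF K])
  qed
  then have "rescale s' (monomial_poly a) \<in> ?K" if "monomial_degree a = Suc r" for a
    using s(2)[OF that] by blast
  \<comment> \<open>Rescaling multiplies a monomial by a nonzero scalar; the factor
    \<open>meval s a\<close> cancels it.\<close>
  then have mem': "const (meval s a) * rescale s' (monomial_poly a) \<in> ?K" if "monomial_degree a = Suc r" for a
    using that by (intro ring_ideal_mult[OF K])
  have "const (meval s a) * rescale s' (monomial_poly a) = monomial_poly a" for a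
    by (simp add: rescale_single mult_single inverse)
  with mem' show ?thesis
    by (intro that[OF v]) simp
qed

end

theorem proposition4p15:
  fixes lt :: "'n::finite monomial \<Rightarrow> 'n monomial \<Rightarrow> bool"
    and I :: "('n, 'k::field) mpoly set"
  assumes "infinite (UNIV :: 'k set)"
    and "monomial_preorder lt"
    and "homogeneous_ideal I"
  shows "reduction_number (quotient_algebra I)
       \<le> reduction_number (quotient_algebra (leading_ideal lt I))"
proof -
  interpret monomial_preorder_loc lt
    by unfold_locales (rule assms(2))
  note I = homogeneous_ideal_graded[OF assms(3)]
  let ?L = "leading_ideal lt I"
  have L: "ring_ideal ?L"
    unfolding leading_ideal_def by (rule genideal_mpoly_ring(1))
  interpret I: quotient I
    by unfold_locales (rule I(1))
  interpret L: quotient ?L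
    by unfold_locales (rule L)
  show ?thesis
    unfolding reduction_number_def[of "quotient_algebra ?L"]
  proof (rule Inf_greatest, clarify)
    \<comment> \<open>It suffices to match each minimal reduction on the right by one for
      \<open>I\<close> of no larger value; without any, the right-hand infimum is infinite.\<close>
    fix Q assume "minimal_reduction (quotient_algebra ?L) Q"
    then obtain zs where zs: "linear_noether_system (quotient_algebra ?L) zs"
        "Q = Idl\<^bsub>quotient_algebra ?L\<^esub> (set zs)"
      by (auto simp: minimal_reduction_def)
    show "reduction_number (quotient_algebra I) \<le> reduction_number_wrt (quotient_algebra ?L) Q"
    proof (cases "reduction_number_wrt (quotient_algebra ?L) Q")
      case (enat r)
      have "set zs \<subseteq> component (quotient_algebra ?L) 1"
        using zs(1) by (simp add: linear_noether_system_def)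
      then obtain w where lifts: "L.lifts zs w"
        by (rule L.lifts_exists)
      then have w: "homogeneous 1 (w i)" for i
        by (simp add: L.lifts_def)
      let ?d = "length zs"
      have "alg_independent (quotient_algebra ?L) zs"
        using zs(1) by (simp add: linear_noether_system_def noether_normalization_def)
      then have ind_L: "p = 0" if "vars_in {..<?d} p" "subst w p \<in> ?L" for p
        using L.alg_independent_A_iff[OF lifts] that by blast
      have "reduction_number_wrt (quotient_algebra ?L) (Idl\<^bsub>quotient_algebra ?L\<^esub> (set zs)) \<le> enat r"
        using enat zs(2) by simp
      from L.monomials_mem_if_reduction_number_wrt_le[OF graded_leading_ideal[OF I] zs(1) lifts this]
      have mem_L: "monomial_poly a \<in> ideal_adjoin ?L w ?d" if "monomial_degree a = Suc r" for a
        using that .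
      have "finite {a :: 'n monomial. monomial_degree a = Suc r}"
        by (rule finite_subset[OF _ finite_monomials_degree_le[of "Suc r"]]) auto
      from deform_reduction[OF assms(1) this I w mem_L]
      obtain v where v: "\<And>i. homogeneous 1 (v i)"
        "\<And>a. monomial_degree a = Suc r \<Longrightarrow> monomial_poly a \<in> ideal_adjoin I v ?d"
        by blast
      \<comment> \<open>These monomials generate over the new forms \<open>v i\<close> and include
        the monomial 1, which the determinant argument uses.\<close>
      let ?M = "{a :: 'n monomial. monomial_degree a \<le> r}"
      have rep: "I.represents v ?d ?M"
        unfolding I.represents_def
        using finite_monomials_degree_le I.bounded_degree_representation[OF I(2) v finite_monomials_degree_le] by blast
      \<comment> \<open>The lower bound comes from the old forms, known to be independent modulo the
        leading ideal; it is then used to prove independence of the new forms modulo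
        \<open>I\<close>.\<close>
      have growth: "\<exists>B. finite B \<and> (\<forall>a\<in>B. monomial_degree a \<le> t) \<and> indep_mod I monomial_poly B \<and>
          (t + ?d) choose ?d \<le> card B" for t
      proof -
        obtain B where B: "B \<subseteq> {a. monomial_degree a \<le> t}" "indep_mod I monomial_poly B" "(t + ?d) choose ?d \<le> card B"
          by (rule indep_monomials_exist[OF finite_monomials_degree_le w ind_L])
        have "finite B"
          using B(1) finite_monomials_degree_le by (rule finite_subset)
        then show ?thesis
          using B by (intro exI[of _ B]) auto
      qed
      have ind: "p = 0" if "vars_in {..<?d} p" "subst v p \<in> I" for p
        by (rule I.alg_independent_if_growth[OF rep growth that])
      let ?zs = "map (\<lambda>i. I.\<pi> (v i)) [0..<?d]"
      have zero: "0 \<in> ?M"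
        by simp
      have zs': "linear_noether_system (quotient_algebra I) ?zs"
        by (rule I.linear_noether_system_A(1)[OF rep zero v(1) ind])
      have lifts': "I.lifts ?zs v"
        by (rule I.linear_noether_system_A(2)[OF rep zero v(1) ind])
      have "minimal_reduction (quotient_algebra I) (Idl\<^bsub>quotient_algebra I\<^esub> (set ?zs))"
        using zs' by (auto simp: minimal_reduction_def)
      moreover have "reduction_number_wrt (quotient_algebra I) (Idl\<^bsub>quotient_algebra I\<^esub> (set ?zs)) \<le> enat r"
        using v(2) by (intro I.reduction_number_wrt_le_if_monomials_mem[OF I(2) lifts']) simp
      ultimately show ?thesis
        unfolding reduction_number_def enat by (intro Inf_lower2) auto
    qed simp
  qed
qed

end
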